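(* Let $n\ge 1$ and $m\ge 0$ be integers and let $\alpha>-1$. Let $\mathcal{A}^{2,\alpha}_m(\mathbb{B}^n)$ be the space of all holomorphic functions $f$ on the open unit ball $\mathbb{B}^n=\{z\in\mathbb{C}^n: |z|<1\}$ such that $$\|f\|_{\alpha,m}^2:=\|f_{1,m}\|_\alpha^2+m!\sum_{|p|=m}\frac{1}{p!}\|D^p f_{2,m}\|_\alpha^2<+\infty,$$ where $\|g\|_\alpha^2=\int_{\mathbb{B}^n}|g(z)|^2(1-|z|^2)^\alpha\,d\lambda(z)$. Then $\mathcal{A}^{2,\alpha}_m(\mathbb{B}^n)$, equipped with the inner product associated with $\|\cdot\|_{\alpha,m}$, is a reproducing kernel Hilbert space, and its reproducing kernel is $$K(z,w)=\frac{\Gamma(\alpha+n+1)}{\pi^n\Gamma(\alpha+1)}\sum_{k<m}(\alpha+n+1)_k\frac{\langle z,w\rangle^k}{k!}+\frac{\Gamma(\alpha+n+1)}{\pi^n\Gamma(\alpha+1)}\,\frac{\langle z,w\rangle^m}{(m!)^2}\,{}_3F_2\!\left(\begin{matrix}1,\,1,\,\alpha+n+1\\ m+1,\,m+1\end{matrix}\,\Big|\,\langle z,w\rangle\right),\qquad z,w\in\mathbb{B}^n.$$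
   Context: $\langle z,w\rangle=\sum_{j=1}^n z_j\overline{w_j}$ and $|z|=\sqrt{\langle z,z\rangle}$ on $\mathbb{C}^n$; $d\lambda$ is Lebesgue measure on $\mathbb{C}^n\cong\mathbb{R}^{2n}$. For a multi-index $p=(p_1,\dots,p_n)\in(\mathbb{Z}^+)^n$ (nonnegative integers), $|p|=p_1+\cdots+p_n$, $p!=p_1!\cdots p_n!$, $z^p=z_1^{p_1}\cdots z_n^{p_n}$, and $D^p=\frac{\partial^{|p|}}{\partial z_1^{p_1}\cdots\partial z_n^{p_n}}$. For a holomorphic $f(z)=\sum_p a_p z^p$, one writes $f=f_{1,m}+f_{2,m}$ with $f_{1,m}=\sum_{|p|<m}a_pz^p$ and $f_{2,m}=\sum_{|p|\ge m}a_pz^p$. The inner product is $\langle f,g\rangle_{\alpha,m}=\langle f_{1,m},g_{1,m}\rangle_\alpha+m!\sum_{|p|=m}\frac{1}{p!}\langle D^pf_{2,m},D^pg_{2,m}\rangle_\alpha$ with $\langle u,v\rangle_\alpha=\int_{\mathbb{B}^n}u\overline{v}(1-|z|^2)^\alpha d\lambda$. $(a)_k=a(a+1)\cdots(a+k-1)$ is the Pochhammer symbol, and ${}_3F_2\!\left(\begin{matrix}a_1,a_2,a_3\\ b_1,b_2\end{matrix}\,\Big|\,x\right)=\sum_{k\ge0}\frac{(a_1)_k(a_2)_k(a_3)_k}{(b_1)_k(b_2)_k}\frac{x^k}{k!}$. *)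

theory Defs
  imports "HOL-Analysis.Analysis"
begin

text \<open>C^n is modelled as complex^'n for a finite index type 'n, n = CARD('n).
  The Euclidean norm of complex^'n is |z|, and lborel on it is Lebesgue measure on R^(2n).\<close>

definition cinner :: "complex^'n \<Rightarrow> complex^'n \<Rightarrow> complex" where
  "cinner z w = (\<Sum>j\<in>UNIV. z$j * cnj (w$j))"

type_synonym 'n multiidx = "'n \<Rightarrow> nat"

definition mabs :: "'n::finite multiidx \<Rightarrow> nat" where
  "mabs p = (\<Sum>j\<in>UNIV. p j)"

definition mfact :: "'n::finite multiidx \<Rightarrow> real" where
  "mfact p = (\<Prod>j\<in>UNIV. fact (p j))"

definition monom :: "complex^'n \<Rightarrow> 'n::finite multiidx \<Rightarrow> complex" where
  "monom z p = (\<Prod>j\<in>UNIV. (z$j) ^ p j)"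

definition holo_ball :: "(complex^'n::finite \<Rightarrow> complex) \<Rightarrow> bool" where
  "holo_ball f \<longleftrightarrow> (\<forall>z\<in>ball 0 1. \<exists>c::'n \<Rightarrow> complex.
       (f has_derivative (\<lambda>v. \<Sum>j\<in>UNIV. c j * v$j)) (at z))"

definition pcoeff :: "(complex^'n::finite \<Rightarrow> complex) \<Rightarrow> 'n multiidx \<Rightarrow> complex" where
  "pcoeff f = (THE a. \<forall>z\<in>ball 0 1. ((\<lambda>p. a p * monom z p) has_sum f z) UNIV)"

definition f1 :: "nat \<Rightarrow> (complex^'n::finite \<Rightarrow> complex) \<Rightarrow> complex^'n \<Rightarrow> complex" where
  "f1 m f z = (\<Sum>p\<in>{p. mabs p < m}. pcoeff f p * monom z p)"

definition f2 :: "nat \<Rightarrow> (complex^'n::finite \<Rightarrow> complex) \<Rightarrow> complex^'n \<Rightarrow> complex" where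
  "f2 m f z = f z - f1 m f z"

definition pd :: "'n::finite \<Rightarrow> (complex^'n \<Rightarrow> complex) \<Rightarrow> complex^'n \<Rightarrow> complex" where
  "pd j g z = deriv (\<lambda>t. g (z + axis j t)) 0"

definition coord_list :: "'n::finite list" where
  "coord_list = (SOME xs. distinct xs \<and> set xs = UNIV)"

definition Dp :: "'n::finite multiidx \<Rightarrow> (complex^'n \<Rightarrow> complex) \<Rightarrow> complex^'n \<Rightarrow> complex" where
  "Dp p g = foldr (\<lambda>j h. (pd j ^^ p j) h) coord_list g"

definition weight :: "real \<Rightarrow> complex^'n::finite \<Rightarrow> real" where
  "weight \<alpha> z = (1 - (norm z)^2) powr \<alpha>"

definition wip :: "real \<Rightarrow> (complex^'n::finite \<Rightarrow> complex) \<Rightarrow> (complex^'n \<Rightarrow> complex) \<Rightarrow> complex" where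
  "wip \<alpha> u v = set_lebesgue_integral lborel (ball 0 1)
      (\<lambda>z. complex_of_real (weight \<alpha> z) * (u z * cnj (v z)))"

definition wnorm2 :: "real \<Rightarrow> (complex^'n::finite \<Rightarrow> complex) \<Rightarrow> ennreal" where
  "wnorm2 \<alpha> u = set_nn_integral lborel (ball 0 1)
      (\<lambda>z. ennreal ((cmod (u z))^2 * weight \<alpha> z))"

definition Anorm2 :: "real \<Rightarrow> nat \<Rightarrow> (complex^'n::finite \<Rightarrow> complex) \<Rightarrow> ennreal" where
  "Anorm2 \<alpha> m f = wnorm2 \<alpha> (f1 m f)
     + ennreal (fact m) * (\<Sum>p\<in>{p::'n multiidx. mabs p = m}.
          ennreal (1 / mfact p) * wnorm2 \<alpha> (Dp p (f2 m f)))"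

definition Aip :: "real \<Rightarrow> nat \<Rightarrow> (complex^'n::finite \<Rightarrow> complex) \<Rightarrow> (complex^'n \<Rightarrow> complex) \<Rightarrow> complex" where
  "Aip \<alpha> m f g = wip \<alpha> (f1 m f) (f1 m g)
     + of_real (fact m) * (\<Sum>p\<in>{p::'n multiidx. mabs p = m}.
          of_real (1 / mfact p) * wip \<alpha> (Dp p (f2 m f)) (Dp p (f2 m g)))"

definition Aspace :: "real \<Rightarrow> nat \<Rightarrow> (complex^'n::finite \<Rightarrow> complex) set" where
  "Aspace \<alpha> m = {f. holo_ball f \<and> Anorm2 \<alpha> m f < top}"

text \<open>H is a space of functions (only their values on X matter), ip an inner product on H.
  H is a complex inner product space (positive definite modulo equality on X), complete,
  and K is its reproducing kernel: K(.,w) \<in> H and f(w) = ip f (K(.,w)).\<close>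
definition rkhs_with_kernel ::
  "'a set \<Rightarrow> ('a \<Rightarrow> complex) set \<Rightarrow> (('a \<Rightarrow> complex) \<Rightarrow> ('a \<Rightarrow> complex) \<Rightarrow> complex)
     \<Rightarrow> ('a \<Rightarrow> 'a \<Rightarrow> complex) \<Rightarrow> bool" where
  "rkhs_with_kernel X H ip K \<longleftrightarrow>
     (\<lambda>_. 0) \<in> H \<and>
     (\<forall>f\<in>H. \<forall>g\<in>H. (\<lambda>x. f x + g x) \<in> H) \<and>
     (\<forall>f\<in>H. \<forall>c. (\<lambda>x. c * f x) \<in> H) \<and>
     (\<forall>f\<in>H. \<forall>g\<in>H. \<forall>h\<in>H. ip (\<lambda>x. f x + g x) h = ip f h + ip g h) \<and>
     (\<forall>f\<in>H. \<forall>g\<in>H. \<forall>c. ip (\<lambda>x. c * f x) g = c * ip f g) \<and>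
     (\<forall>f\<in>H. \<forall>g\<in>H. ip g f = cnj (ip f g)) \<and>
     (\<forall>f\<in>H. ip f f \<in> \<real> \<and> Re (ip f f) \<ge> 0) \<and>
     (\<forall>f\<in>H. ip f f = 0 \<longrightarrow> (\<forall>x\<in>X. f x = 0)) \<and>
     (\<forall>F::nat \<Rightarrow> 'a \<Rightarrow> complex. (\<forall>k. F k \<in> H) \<longrightarrow>
        (\<forall>e>0. \<exists>N. \<forall>i\<ge>N. \<forall>j\<ge>N.
            Re (ip (\<lambda>x. F i x - F j x) (\<lambda>x. F i x - F j x)) < e) \<longrightarrow>
        (\<exists>f\<in>H. (\<lambda>k. Re (ip (\<lambda>x. F k x - f x) (\<lambda>x. F k x - f x))) \<longlonglongrightarrow> 0)) \<and>
     (\<forall>w\<in>X. (\<lambda>z. K z w) \<in> H \<and> (\<forall>f\<in>H. f w = ip f (\<lambda>z. K z w)))"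

definition hyp3F2 :: "complex \<Rightarrow> complex \<Rightarrow> complex \<Rightarrow> complex \<Rightarrow> complex \<Rightarrow> complex \<Rightarrow> complex" where
  "hyp3F2 a1 a2 a3 b1 b2 x = (\<Sum>k. pochhammer a1 k * pochhammer a2 k * pochhammer a3 k
       / (pochhammer b1 k * pochhammer b2 k) * x ^ k / fact k)"

definition bergman_kernel :: "real \<Rightarrow> nat \<Rightarrow> complex^'n::finite \<Rightarrow> complex^'n \<Rightarrow> complex" where
  "bergman_kernel \<alpha> m z w =
     (let n = CARD('n);
          C = complex_of_real (Gamma (\<alpha> + real n + 1) / (pi ^ n * Gamma (\<alpha> + 1)));
          s = cinner z w
      in C * (\<Sum>k<m. of_real (pochhammer (\<alpha> + real n + 1) k) * s ^ k / fact k)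
         + C * s ^ m / (fact m)^2
             * hyp3F2 1 1 (of_real (\<alpha> + real n + 1)) (of_nat m + 1) (of_nat m + 1) s)"

end

theory Submission
  imports Defs "HOL-Complex_Analysis.Complex_Analysis" "HOL-Probability.Infinite_Product_Measure"
begin

text \<open>In the coefficients of the power series \<open>f = \<Sum> a\<^sub>p z\<^sup>p\<close> the space is a weighted \<open>\<ell>\<^sup>2\<close> space: with
  \<open>c\<^sub>p = \<pi>\<^sup>n p! \<Gamma>(\<alpha>+1) / \<Gamma>(\<alpha>+n+1+|p|)\<close> one has \<open>\<parallel>\<Sum> b\<^sub>p z\<^sup>p\<parallel>\<^sup>2 = \<Sum> c\<^sub>p |b\<^sub>p|\<^sup>2\<close>, because the measure is
  invariant under the torus action and Parseval's identity holds on each torus orbit; the value of \<open>c\<^sub>p\<close> is a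
  Dirichlet integral. Applying this to the derivatives \<open>D\<^sup>q\<close> and summing over \<open>|q| = m\<close> with Vandermonde's
  identity gives weights \<open>N\<^sub>p\<close> with \<open>\<langle>f, g\<rangle> = \<Sum> N\<^sub>p a\<^sub>p cnj b\<^sub>p\<close>. The kernel is then
  \<open>\<Sum> z\<^sup>p cnj (w\<^sup>p) / N\<^sub>p\<close>, which the multinomial theorem turns into a power series in \<open>\<langle>z, w\<rangle>\<close>.\<close>

section \<open>Multi-index sums\<close>

text \<open>Norms are computed as integrals with values in the extended nonnegative reals, so
  Tonelli applies to every power series, and finiteness of the norm turns into summability of the
  weighted squares; inner products follow by polarization. As \<open>pcoeff\<close> is a definite
  description, it carries information only after each holomorphic function is shown to have exactly
  one expansion valid on the entire ball. Cauchy's formula lives on polydiscs, and the ball is a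
  union of polydiscs about 0 whose polyradii vary, so one expansion is found for each polyradius and
  all are identified by uniqueness near 0. Conversely, \<open>holo_ball\<close> asks for a total
  complex-linear derivative, so a function given by coefficients has to be differentiated termwise
  in all variables at once. Infinite sums over multi-indices are unconditional, which permits
  regrouping by degree and shifting by \<open>q\<close>. The kernel depends on the inner product
  alone because \<open>N\<^sub>p\<close> is \<open>p!\<close> times a function of |p|: the binomial
  products in the sum over |q| = m collapse to one binomial coefficient in |p|.\<close>

definition midx :: "'n set \<Rightarrow> nat \<Rightarrow> ('n \<Rightarrow> nat) set" where
  "midx J k = {p. (\<forall>j. j \<notin> J \<longrightarrow> p j = 0) \<and> (\<Sum>j\<in>J. p j) = k}"

lemma midx_empty: "midx {} k = (if k = 0 then {\<lambda>_. 0} else {})"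
  by (auto simp: midx_def)

lemma midx_UNIV: "midx (UNIV :: 'n::finite set) k = {p. mabs p = k}"
  by (simp add: midx_def mabs_def)

lemma finite_midx:
  assumes "finite J"
  shows "finite (midx J k)"
proof -
  have "midx J k \<subseteq> {p. \<forall>j. (j \<in> J \<longrightarrow> p j \<in> {..k}) \<and> (j \<notin> J \<longrightarrow> p j = 0)}"
    using assms by (auto simp: midx_def intro!: member_le_sum)
  then show ?thesis
    using finite_set_of_finite_funs[OF assms, of "{..k}" 0] by (rule finite_subset) auto
qed

text \<open>Since members of \<open>midx J k\<close> vanish off \<open>J\<close>,
  \<open>(l, q) \<mapsto> q(i := l)\<close> is a bijection that splits off one exponent. Sums of
  products over coordinates thus become iterated convolutions, which is what the inductions on
  \<open>J\<close> below use.\<close>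

lemma sum_midx_insert:
  fixes h :: "'n \<Rightarrow> nat \<Rightarrow> 'a::comm_semiring_1"
  assumes "finite J" "i \<notin> J"
  shows "(\<Sum>p\<in>midx (insert i J) k. \<Prod>j\<in>insert i J. h j (p j)) =
         (\<Sum>l\<le>k. h i l * (\<Sum>p\<in>midx J (k - l). \<Prod>j\<in>J. h j (p j)))"
proof -
  have "(\<Sum>l\<le>k. h i l * (\<Sum>p\<in>midx J (k - l). \<Prod>j\<in>J. h j (p j))) =
        (\<Sum>l\<le>k. \<Sum>p\<in>midx J (k - l). h i l * (\<Prod>j\<in>J. h j (p j)))"
    by (simp add: sum_distrib_left)
  also have "\<dots> = (\<Sum>(l,p)\<in>(SIGMA l:{..k}. midx J (k - l)). h i l * (\<Prod>j\<in>J. h j (p j)))"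
    by (rule sum.Sigma) (auto simp: finite_midx assms)
  also have "\<dots> = (\<Sum>p\<in>midx (insert i J) k. \<Prod>j\<in>insert i J. h j (p j))"
  proof (rule sum.reindex_bij_witness[of _ "\<lambda>p. (p i, p(i := 0))" "\<lambda>(l, q). q(i := l)"], goal_cases)
    case (1 x)
    then show ?case using assms by (auto simp: midx_def)
  next
    case (2 x)
    obtain l p where x: "x = (l, p)" by (cases x)
    have "(\<Sum>j\<in>J. (p(i := l)) j) = (\<Sum>j\<in>J. p j)"
      using assms by (intro sum.cong) auto
    then show ?case using 2 assms by (auto simp: midx_def x)
  next
    case (3 p)
    then show ?case by auto
  next
    case (4 p)
    have "(\<Sum>j\<in>J. (p(i := 0)) j) = (\<Sum>j\<in>J. p j)"
      using assms by (intro sum.cong) auto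
    then show ?case using 4 assms by (auto simp: midx_def)
  next
    case (5 x)
    obtain l p where x: "x = (l, p)" by (cases x)
    have "(\<Prod>j\<in>J. h j ((p(i := l)) j)) = (\<Prod>j\<in>J. h j (p j))"
      using assms by (intro prod.cong) auto
    then show ?case using assms by (simp add: x)
  qed
  finally show ?thesis ..
qed

text \<open>The two-term Vandermonde identity, iterated over the coordinates. It collapses the sum
  over all derivatives of order \<open>m\<close> in \<open>anorm_eq\<close>.\<close>

lemma multi_vandermonde:
  fixes P :: "'n \<Rightarrow> nat"
  assumes "finite J"
  shows "(\<Sum>p\<in>midx J k. \<Prod>j\<in>J. P j choose p j) = (\<Sum>j\<in>J. P j) choose k"
  using assms
proof (induction J arbitrary: k)
  case empty
  then show ?case by (simp add: midx_empty)
next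
  case (insert i J)
  have "(\<Sum>p\<in>midx (insert i J) k. \<Prod>j\<in>insert i J. P j choose p j) =
        (\<Sum>l\<le>k. (P i choose l) * ((\<Sum>j\<in>J. P j) choose (k - l)))"
    by (simp only: sum_midx_insert[OF insert(1,2), of "\<lambda>j q. P j choose q"] insert.IH)
  then show ?case
    using insert(1,2) by (simp add: vandermonde)
qed

text \<open>Dividing by factorials turns the binomial theorem into a convolution, the shape in which
  \<open>sum_midx_insert\<close> can be iterated.\<close>

lemma multinomial_power:
  fixes x :: "'n \<Rightarrow> 'a::field_char_0"
  assumes "finite J"
  shows "(\<Sum>p\<in>midx J k. \<Prod>j\<in>J. x j ^ p j / fact (p j)) = (\<Sum>j\<in>J. x j) ^ k / fact k"
  using assms
proof (induction J arbitrary: k)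
  case empty
  then show ?case by (simp add: midx_empty)
next
  case (insert i J)
  have "(\<Sum>p\<in>midx (insert i J) k. \<Prod>j\<in>insert i J. x j ^ p j / fact (p j)) =
        (\<Sum>l\<le>k. x i ^ l / fact l * ((\<Sum>j\<in>J. x j) ^ (k - l) / fact (k - l)))"
    by (simp only: sum_midx_insert[OF insert(1,2), of "\<lambda>j q. x j ^ q / fact q"] insert.IH)
  also have "\<dots> = (x i + (\<Sum>j\<in>J. x j)) ^ k / fact k"
    unfolding binomial_ring sum_divide_distrib
    by (intro sum.cong refl) (simp add: binomial_fact field_simps)
  finally show ?case
    using insert(1,2) by simp
qed

section \<open>Fourier analysis on the torus\<close>

text \<open>A density on the whole line instead of a restriction to \<open>{0..1}\<close>: the space
  is all of the reals, so measurability is plain Borel measurability and functions on the torus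
  carry no domain.\<close>

definition unit_interval :: "real measure" where
  "unit_interval = density lborel (indicator {0..1})"

lemma sets_unit_interval [measurable_cong, simp]: "sets unit_interval = sets borel"
  and space_unit_interval [simp]: "space unit_interval = UNIV"
  by (simp_all add: unit_interval_def)

lemma prob_space_unit_interval: "prob_space unit_interval"
  by (rule prob_spaceI) (simp add: unit_interval_def emeasure_density)

lemma integral_unit_interval:
  fixes f :: "real \<Rightarrow> 'a::{banach, second_countable_topology}"
  assumes "f \<in> borel_measurable borel"
  shows "integral\<^sup>L unit_interval f = (\<integral>x. indicator {0..1} x *\<^sub>R f x \<partial>lborel)"
proof -
  have eq: "unit_interval = density lborel (\<lambda>x. ennreal (indicator {0..1} x))"
    unfolding unit_interval_def by (intro density_cong) (auto simp: indicator_def)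
  show ?thesis unfolding eq by (subst integral_density) (use assms in auto)
qed

lemma borel_measurable_cnj [measurable (raw)]:
  "f \<in> borel_measurable M \<Longrightarrow> (\<lambda>x. cnj (f x)) \<in> borel_measurable M"
  by (rule measurable_compose[of f M borel cnj borel])
     (auto intro!: borel_measurable_continuous_onI continuous_intros)

definition expi :: "real \<Rightarrow> complex" where
  "expi t = cis (2 * pi * t)"

lemma norm_expi [simp]: "cmod (expi t) = 1"
  by (simp add: expi_def)

lemma expi_neq_0 [simp]: "expi t \<noteq> 0"
  by (simp add: expi_def)

lemma continuous_on_expi [continuous_intros]: "continuous_on A expi"
  unfolding expi_def[abs_def] by (intro continuous_intros)

lemma borel_measurable_expi [measurable]: "expi \<in> borel_measurable borel"
  by (intro borel_measurable_continuous_onI continuous_on_expi)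

text \<open>For \<open>a \<noteq> b\<close> the integrand is \<open>cis (k * t)\<close> with
  \<open>k\<close> a nonzero integer multiple of \<open>2 * pi\<close>, whose primitive takes the
  same value at 0 and 1.\<close>

lemma integral_expi_orthogonal:
  "(\<integral>t. expi t ^ a * cnj (expi t) ^ b \<partial>unit_interval) = (if a = b then 1 else 0)"
proof (cases "a = b")
  case True
  interpret prob_space unit_interval by (rule prob_space_unit_interval)
  have "expi t ^ a * cnj (expi t) ^ b = 1" for t
    unfolding True power_mult_distrib[symmetric] complex_norm_square[symmetric] by simp
  then show ?thesis using True prob_space by simp
next
  case False
  define k where "k = 2 * pi * (real a - real b)"
  have k0: "k \<noteq> 0" using False by (simp add: k_def)
  have eq: "expi t ^ a * cnj (expi t) ^ b = cis (k * t)" for t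
    unfolding expi_def cis_cnj Complex.DeMoivre cis_mult k_def by (rule arg_cong[where f = cis]) (simp add: algebra_simps)
  have "(\<integral>t. indicator {0..1} t *\<^sub>R cis (k * t) \<partial>lborel) = cis (k * 1) / (\<i> * k) - cis (k * 0) / (\<i> * k)"
  proof (rule integral_FTC_Icc)
    fix x :: real
    have "((\<lambda>x. cis (k * x) / (\<i> * k)) has_vector_derivative cis (k * x)) (at x within {0..1})"
      using k0 unfolding cis_conv_exp
      by (auto intro!: derivative_eq_intros has_vector_derivative_real_field simp: field_simps)
    then show "((\<lambda>x. cis (k * x) / (\<i> * k)) has_vector_derivative cis (k * x)) (at x within {0..1})" .
  qed (auto intro!: continuous_intros)
  moreover have "cis k = 1"
    unfolding k_def using cis_multiple_2pi[of "real a - real b"] by simp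
  ultimately show ?thesis
    using False by (subst integral_unit_interval)
      (auto simp: eq intro!: borel_measurable_continuous_onI continuous_intros)
qed

definition torus :: "('n::finite \<Rightarrow> real) measure" where
  "torus = PiM UNIV (\<lambda>_. unit_interval)"

lemma product_sigma_finite_unit_interval: "product_sigma_finite (\<lambda>_. unit_interval)"
  by (simp add: product_sigma_finite_def prob_space_unit_interval prob_space_imp_sigma_finite)

lemma prob_space_torus: "prob_space torus"
  unfolding torus_def by (intro prob_space_PiM prob_space_unit_interval)

lemma space_torus [simp]: "space torus = UNIV"
  by (simp add: torus_def space_PiM)

lemma measurable_torus_component [measurable]: "(\<lambda>t. t j) \<in> borel_measurable torus"
  unfolding torus_def by (simp cong: measurable_cong_sets)

definition tchar :: "('n::finite \<Rightarrow> nat) \<Rightarrow> ('n \<Rightarrow> real) \<Rightarrow> complex" where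
  "tchar p t = (\<Prod>j\<in>UNIV. expi (t j) ^ p j)"

lemma norm_tchar [simp]: "cmod (tchar p t) = 1"
  by (simp add: tchar_def prod_norm[symmetric] norm_power)

lemma borel_measurable_tchar [measurable]: "tchar p \<in> borel_measurable torus"
  unfolding tchar_def[abs_def] by measurable

lemma integral_tchar_orthogonal:
  "(\<integral>t. tchar p t * cnj (tchar q t) \<partial>torus) = (if p = q then 1 else 0)"
proof -
  have int: "integrable unit_interval (\<lambda>t. expi t ^ a * cnj (expi t) ^ b)" for a b
  proof (rule finite_measure.integrable_const_bound[where B = 1])
    have "(\<lambda>t. expi t ^ a * cnj (expi t) ^ b) \<in> borel_measurable borel"
      by (intro borel_measurable_continuous_onI continuous_intros)
    then show "(\<lambda>t. expi t ^ a * cnj (expi t) ^ b) \<in> borel_measurable unit_interval"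
      by (simp cong: measurable_cong_sets)
  qed (auto simp: norm_mult norm_power prob_space.finite_measure prob_space_unit_interval)
  have "(\<integral>t. tchar p t * cnj (tchar q t) \<partial>torus) =
        (\<integral>t. (\<Prod>j\<in>UNIV. expi (t j) ^ p j * cnj (expi (t j)) ^ q j) \<partial>PiM UNIV (\<lambda>_. unit_interval))"
    by (simp add: torus_def tchar_def prod.distrib)
  also have "\<dots> = (\<Prod>j\<in>UNIV. if p j = q j then 1 else 0)"
    using product_sigma_finite.product_integral_prod[OF product_sigma_finite_unit_interval, of UNIV "\<lambda>j s. expi s ^ p j * cnj (expi s) ^ q j"] int
    by (simp add: integral_expi_orthogonal)
  also have "\<dots> = (if p = q then 1 else 0)"
    by (auto simp: fun_eq_iff prod_zero_iff)
  finally show ?thesis .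
qed

text \<open>Dominated convergence concerns sequences, whereas \<open>has_sum\<close> is a limit
  along the net of finite subsets. The summable bounds give uniform convergence by the Weierstrass
  test, and uniform limits pass through an integral against a probability measure.\<close>

lemma (in prob_space) integral_has_sum:
  fixes f :: "'i \<Rightarrow> 'a \<Rightarrow> 'b::{banach, second_countable_topology}"
  assumes [measurable]: "\<And>i. f i \<in> borel_measurable M" "G \<in> borel_measurable M"
    and bound: "\<And>i x. x \<in> space M \<Longrightarrow> norm (f i x) \<le> B i"
    and B: "B summable_on UNIV"
    and sum: "\<And>x. x \<in> space M \<Longrightarrow> ((\<lambda>i. f i x) has_sum G x) UNIV"
  shows "((\<lambda>i. \<integral>x. f i x \<partial>M) has_sum (\<integral>x. G x \<partial>M)) UNIV" and "integrable M G"
proof -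
  have intf: "integrable M (f i)" for i
    using bound by (intro integrable_const_bound[where B = "B i"]) auto
  have ul: "uniform_limit (space M) (\<lambda>F x. \<Sum>i\<in>F. f i x) G (finite_subsets_at_top UNIV)"
    by (rule Weierstrass_m_test_general'[OF bound sum B])
  have ev: "\<forall>\<^sub>F F in finite_subsets_at_top UNIV. \<forall>x\<in>space M. dist (\<Sum>i\<in>F. f i x) (G x) < e" if "e > 0" for e
    using uniform_limitD[OF ul that] .
  \<comment> \<open>One partial sum within distance 1 of \<open>G\<close> suffices: the bounded
    difference is integrable on a probability space, and so is the partial sum.\<close>
  have "\<exists>F. finite F \<and> (\<forall>x\<in>space M. dist (\<Sum>i\<in>F. f i x) (G x) < 1)"
    using ev[of 1] by (auto simp: eventually_finite_subsets_at_top)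
  then obtain F where F: "finite F" "\<And>x. x \<in> space M \<Longrightarrow> dist (\<Sum>i\<in>F. f i x) (G x) < 1" by blast
  have "integrable M (\<lambda>x. G x - (\<Sum>i\<in>F. f i x))"
    using F(2) by (intro integrable_const_bound[where B = 1] AE_I2)
       (auto simp: dist_norm norm_minus_commute less_imp_le)
  then have "integrable M (\<lambda>x. (G x - (\<Sum>i\<in>F. f i x)) + (\<Sum>i\<in>F. f i x))"
    by (intro Bochner_Integration.integrable_add Bochner_Integration.integrable_sum intf)
  then show intG: "integrable M G" by simp
  show "((\<lambda>i. \<integral>x. f i x \<partial>M) has_sum (\<integral>x. G x \<partial>M)) UNIV"
    unfolding has_sum_def
  proof (rule tendstoI)
    fix e :: real assume e: "e > 0"
    from ev[of "e/2"] e have "\<forall>\<^sub>F F in finite_subsets_at_top UNIV. \<forall>x\<in>space M. dist (\<Sum>i\<in>F. f i x) (G x) < e/2"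
      by simp
    then show "\<forall>\<^sub>F F in finite_subsets_at_top UNIV. dist (\<Sum>i\<in>F. \<integral>x. f i x \<partial>M) (\<integral>x. G x \<partial>M) < e"
    proof eventually_elim
      case (elim F)
      have "norm (\<integral>x. (\<Sum>i\<in>F. f i x) - G x \<partial>M) \<le> (\<integral>x. norm ((\<Sum>i\<in>F. f i x) - G x) \<partial>M)"
        by simp
      also have "\<dots> \<le> (\<integral>x. e/2 \<partial>M)"
        using elim by (intro integral_mono integrable_norm Bochner_Integration.integrable_diff
            Bochner_Integration.integrable_sum intf intG) (auto simp: dist_norm less_imp_le)
      also have "\<dots> < e" using e prob_space by simp
      finally show ?case
        using intf intG by (simp add: dist_norm)
    qed
  qed
qed

text \<open>Summable coefficients allow integration term by term against
  \<open>cnj (tchar q t)\<close>, and orthogonality leaves only \<open>p = q\<close>.\<close>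

lemma torus_coefficient:
  fixes \<beta> :: "('n::finite \<Rightarrow> nat) \<Rightarrow> complex"
  assumes summ: "(\<lambda>p. cmod (\<beta> p)) summable_on UNIV"
    and [measurable]: "G \<in> borel_measurable torus"
    and sum: "\<And>t. ((\<lambda>p. \<beta> p * tchar p t) has_sum G t) UNIV"
  shows "(\<integral>t. G t * cnj (tchar q t) \<partial>torus) = \<beta> q"
proof -
  interpret T: prob_space "torus :: ('n \<Rightarrow> real) measure" by (rule prob_space_torus)
  have "((\<lambda>p. \<integral>t. \<beta> p * tchar p t * cnj (tchar q t) \<partial>torus) has_sum
         (\<integral>t. G t * cnj (tchar q t) \<partial>torus)) UNIV"
  proof (rule T.integral_has_sum[OF _ _ _ summ])
    show "(\<lambda>t. \<beta> p * tchar p t * cnj (tchar q t)) \<in> borel_measurable torus" for p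
      by measurable
    show "(\<lambda>t. G t * cnj (tchar q t)) \<in> borel_measurable torus"
      by measurable
  qed (auto simp: norm_mult intro!: has_sum_cmult_left sum)
  moreover have "(\<integral>t. \<beta> p * tchar p t * cnj (tchar q t) \<partial>torus) = (if p = q then \<beta> q else 0)" for p
    using integral_tchar_orthogonal[of p q] by (simp add: mult.assoc)
  ultimately have "((\<lambda>p. if p = q then \<beta> q else 0) has_sum (\<integral>t. G t * cnj (tchar q t) \<partial>torus)) UNIV"
    by simp
  moreover have "((\<lambda>p. if p = q then \<beta> q else 0) has_sum \<beta> q) UNIV"
    using has_sum_finite_neutralI[of "{q}" UNIV "\<lambda>p. if p = q then \<beta> q else 0" "\<beta> q"] by auto
  ultimately show ?thesis by (rule has_sum_unique)
qed

text \<open>Only one factor of \<open>G t * cnj (G t)\<close> is expanded, so no double series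
  arises. The terms are dominated by \<open>cmod (\<beta> p) * S\<close>, and each integral is
  \<open>\<beta> p\<close> times a conjugated Fourier coefficient of \<open>G\<close>, known from
  \<open>torus_coefficient\<close>.\<close>

lemma torus_parseval:
  fixes \<beta> :: "('n::finite \<Rightarrow> nat) \<Rightarrow> complex"
  assumes summ: "(\<lambda>p. cmod (\<beta> p)) summable_on UNIV"
    and [measurable]: "G \<in> borel_measurable torus"
    and sum: "\<And>t. ((\<lambda>p. \<beta> p * tchar p t) has_sum G t) UNIV"
  shows "((\<lambda>p. (cmod (\<beta> p))\<^sup>2) has_sum (\<integral>t. (cmod (G t))\<^sup>2 \<partial>torus)) UNIV"
    and "integrable torus (\<lambda>t. (cmod (G t))\<^sup>2)"
proof -
  interpret T: prob_space "torus :: ('n \<Rightarrow> real) measure" by (rule prob_space_torus)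
  define S where "S = infsum (\<lambda>p. cmod (\<beta> p)) UNIV"
  have G_le: "cmod (G t) \<le> S" for t
    unfolding S_def using norm_infsum_bound[of "\<lambda>p. \<beta> p * tchar p t" UNIV] sum[of t] summ
    by (auto simp: norm_mult has_sum_iff)
  have b: "(\<lambda>p. cmod (\<beta> p) * S) summable_on UNIV"
    by (intro summable_on_cmult_left summ)
  have le: "cmod (\<beta> p * tchar p t * cnj (G t)) \<le> cmod (\<beta> p) * S" for p t
    using G_le by (auto simp: norm_mult intro!: mult_left_mono)
  have hs: "((\<lambda>p. \<beta> p * tchar p t * cnj (G t)) has_sum (of_real ((cmod (G t))\<^sup>2))) UNIV" for t
    unfolding complex_norm_square by (intro has_sum_cmult_left sum)
  have *: "(\<integral>t. \<beta> p * tchar p t * cnj (G t) \<partial>torus) = of_real ((cmod (\<beta> p))\<^sup>2)" for p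
  proof -
    have "(\<integral>t. \<beta> p * tchar p t * cnj (G t) \<partial>torus) =
          (\<integral>t. \<beta> p * cnj (G t * cnj (tchar p t)) \<partial>torus)"
      by (simp add: mult_ac)
    also have "\<dots> = \<beta> p * cnj (\<integral>t. G t * cnj (tchar p t) \<partial>torus)"
      by (simp only: integral_mult_right_zero Bochner_Integration.integral_cnj)
    also have "\<dots> = of_real ((cmod (\<beta> p))\<^sup>2)"
      by (simp only: torus_coefficient[OF summ _ sum] assms complex_norm_square)
    finally show ?thesis .
  qed
  have 1: "((\<lambda>p. complex_of_real ((cmod (\<beta> p))\<^sup>2)) has_sum
            (\<integral>t. complex_of_real ((cmod (G t))\<^sup>2) \<partial>torus)) UNIV"
    and 2: "integrable torus (\<lambda>t. complex_of_real ((cmod (G t))\<^sup>2))"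
  proof -
    have m1: "(\<lambda>t. \<beta> p * tchar p t * cnj (G t)) \<in> borel_measurable torus" for p
      by measurable
    have m2: "(\<lambda>t. complex_of_real ((cmod (G t))\<^sup>2)) \<in> borel_measurable torus"
      by measurable
    note hs' = T.integral_has_sum[OF m1 m2 le b hs]
    show "((\<lambda>p. complex_of_real ((cmod (\<beta> p))\<^sup>2)) has_sum
            (\<integral>t. complex_of_real ((cmod (G t))\<^sup>2) \<partial>torus)) UNIV"
      using hs'(1) by (simp only: *)
    show "integrable torus (\<lambda>t. complex_of_real ((cmod (G t))\<^sup>2))"
      by (rule hs'(2))
  qed
  show "integrable torus (\<lambda>t. (cmod (G t))\<^sup>2)"
    using 2 by (simp only: complex_of_real_integrable_eq)
  show "((\<lambda>p. (cmod (\<beta> p))\<^sup>2) has_sum (\<integral>t. (cmod (G t))\<^sup>2 \<partial>torus)) UNIV"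
    using has_sum_Re[OF 1] by (simp only: integral_complex_of_real Re_complex_of_real)
qed

section \<open>Geometric series in several variables\<close>

lemma summable_on_multi_geometric:
  fixes x :: "'n::finite \<Rightarrow> real"
  assumes "\<And>j. 0 \<le> x j" "\<And>j. x j < 1"
  shows "(\<lambda>p. \<Prod>j\<in>UNIV. x j ^ p j) summable_on UNIV"
proof -
  have "Infinite_Set_Sum.abs_summable_on (\<lambda>k. x j ^ k) UNIV" for j
    using assms by (auto simp: abs_summable_on_nat_iff' summable_geometric norm_power)
  then have "Infinite_Set_Sum.abs_summable_on (\<lambda>p. \<Prod>j\<in>UNIV. x j ^ p j) (PiE UNIV (\<lambda>_. UNIV))"
    by (intro abs_summable_on_prod_PiE) auto
  then have "Infinite_Sum.abs_summable_on (\<lambda>p. \<Prod>j\<in>UNIV. x j ^ p j) UNIV"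
    unfolding abs_summable_equivalent by simp
  then show ?thesis by (rule abs_summable_summable)
qed

lemma has_sum_multi_geometric:
  fixes x :: "'n::finite \<Rightarrow> complex"
  assumes "\<And>j. cmod (x j) < 1"
  shows "((\<lambda>p. \<Prod>j\<in>UNIV. x j ^ p j) has_sum (\<Prod>j\<in>UNIV. 1 / (1 - x j))) UNIV"
proof -
  have sn: "summable (\<lambda>k. norm (x j ^ k))" for j
    using assms[of j] by (auto simp: norm_power summable_geometric)
  have s: "(\<lambda>k. norm (x j ^ k)) summable_on UNIV" for j
    using sn[of j] by (intro norm_summable_imp_summable_on) auto
  have g: "infsum (\<lambda>k. x j ^ k) UNIV = 1 / (1 - x j)" for j
    using norm_summable_imp_has_sum[OF sn geometric_sums[OF assms]] by (auto simp: has_sum_iff)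
  have "infsum (\<lambda>p. \<Prod>j\<in>UNIV. x j ^ p j) (PiE UNIV (\<lambda>_. UNIV)) = (\<Prod>j\<in>UNIV. infsum (\<lambda>k. x j ^ k) UNIV)"
    by (rule infsum_prod_PiE_abs[OF _ s]) auto
  moreover have "(\<lambda>p. \<Prod>j\<in>UNIV. x j ^ p j) summable_on UNIV"
  proof (rule abs_summable_summable)
    show "(\<lambda>p. norm (\<Prod>j\<in>UNIV. x j ^ p j)) summable_on UNIV"
      using summable_on_multi_geometric[of "\<lambda>j. cmod (x j)"] assms
      by (simp add: prod_norm[symmetric] norm_power)
  qed
  ultimately show ?thesis
    by (simp add: has_sum_iff g)
qed

section \<open>Power series expansion on the ball\<close>

lemma mem_unit_ball_iff: "(z :: complex^'n::finite) \<in> ball 0 1 \<longleftrightarrow> (\<Sum>j\<in>UNIV. (cmod (z$j))\<^sup>2) < 1"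
  by (simp add: norm_vec_def L2_set_def)

lemma norm_monom: "cmod (Defs.monom z p) = (\<Prod>j\<in>UNIV. cmod (z$j) ^ p j)"
  by (simp add: Defs.monom_def norm_power flip: prod_norm)

lemma borel_measurable_vec_lambda [measurable (raw)]:
  fixes g :: "'n::finite \<Rightarrow> 'a \<Rightarrow> 'b::euclidean_space"
  assumes "\<And>j. g j \<in> borel_measurable M"
  shows "(\<lambda>x. \<chi> j. g j x) \<in> borel_measurable M"
proof (subst borel_measurable_euclidean_space, safe)
  fix b :: "'b^'n" assume "b \<in> Basis"
  then obtain k u where b: "b = axis k u" by (auto simp: Basis_vec_def)
  show "(\<lambda>x. (\<chi> j. g j x) \<bullet> b) \<in> borel_measurable M"
    using assms by (simp add: b inner_axis)
qed

definition rot :: "('n::finite \<Rightarrow> real) \<Rightarrow> complex^'n \<Rightarrow> complex^'n" where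
  "rot t z = (\<chi> j. expi (t j) * z$j)"

text \<open>Monomials are joint eigenfunctions of the torus action, so a power series restricted to
  an orbit is a Fourier series with coefficients \<open>a p * monom z p\<close>.\<close>

lemma monom_rot: "Defs.monom (rot t z) p = tchar p t * Defs.monom z p"
  by (simp add: Defs.monom_def rot_def tchar_def power_mult_distrib prod.distrib)

lemma norm_rot [simp]: "norm (rot t z) = norm z"
  by (simp add: norm_vec_def rot_def norm_mult)

text \<open>On a single torus orbit the difference of the two series is a Fourier series with sum 0,
  so all its coefficients vanish.\<close>

lemma monom_series_unique:
  fixes a b :: "('n::finite \<Rightarrow> nat) \<Rightarrow> complex"
  assumes \<rho>: "\<rho> > 0"
    and a: "\<And>z. (\<And>j. cmod (z$j) < \<rho>) \<Longrightarrow> ((\<lambda>p. a p * Defs.monom z p) has_sum f z) UNIV"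
    and b: "\<And>z. (\<And>j. cmod (z$j) < \<rho>) \<Longrightarrow> ((\<lambda>p. b p * Defs.monom z p) has_sum f z) UNIV"
  shows "a = b"
proof
  fix q
  \<comment> \<open>No coordinate of this point is 0, so no monomial vanishes there and it can be
    divided out at the end.\<close>
  define z :: "complex^'n" where "z = (\<chi> j. of_real (\<rho> / 2))"
  define \<beta> where "\<beta> p = (a p - b p) * Defs.monom z p" for p
  have 1: "((\<lambda>p. (a p - b p) * Defs.monom (rot t z) p) has_sum 0) UNIV" for t
  proof -
    have "cmod (rot t z $ j) < \<rho>" for j
      using \<rho> by (simp add: rot_def z_def norm_mult)
    then have "((\<lambda>p. a p * Defs.monom (rot t z) p + (-1) * (b p * Defs.monom (rot t z) p))
        has_sum (f (rot t z) + (-1) * f (rot t z))) UNIV"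
      by (intro has_sum_add has_sum_cmult_right a b)
    then show ?thesis
      by (simp add: left_diff_distrib)
  qed
  have 2: "((\<lambda>p. \<beta> p * tchar p t) has_sum 0) UNIV" for t
    using 1[of t] by (simp add: monom_rot \<beta>_def mult_ac)
  \<comment> \<open>Unconditional convergence of complex series is absolute; characters have modulus
    1, so one point of the torus already gives summability of
    \<open>cmod (\<beta> p)\<close>.\<close>
  have "(\<lambda>p. \<beta> p * tchar p (\<lambda>_. 0)) summable_on UNIV"
    using 2 unfolding summable_on_def by blast
  then have "(\<lambda>p. cmod (\<beta> p)) summable_on UNIV"
    by (simp add: summable_on_iff_abs_summable_on_complex norm_mult)
  from torus_coefficient[OF this _ 2, of q] have "\<beta> q = 0" by simp
  moreover have "Defs.monom z q \<noteq> 0"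
    using \<rho> by (simp add: Defs.monom_def z_def)
  ultimately show "a q = b q" by (simp add: \<beta>_def)
qed

section \<open>Cauchy's integral formula on polydiscs\<close>

text \<open>The velocity of the circle is \<open>2 * pi * \<i>\<close> times its point, which
  cancels the usual prefactor and leaves the kernel as \<open>1 / (1 - w / \<zeta>)\<close> with
  \<zeta> on the circle: the sum of a geometric series, from which the coefficients will be read
  off.\<close>

lemma Cauchy_unit_interval:
  fixes h :: "complex \<Rightarrow> complex"
  assumes r: "r > 0" and cont: "continuous_on (cball 0 r) h" and holo: "h holomorphic_on ball 0 r"
    and w: "cmod w < r"
  shows "(\<integral>y. h (r * expi y) * (1 / (1 - w / (r * expi y))) \<partial>unit_interval) = h w"
proof -
  let ?g = "\<lambda>y. h (r * expi y) * (1 / (1 - w / (r * expi y)))"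
  have ne: "r * expi y \<noteq> w" for y
  proof
    assume "r * expi y = w"
    then have "cmod w = r" using r by (auto simp: norm_mult)
    then show False using w by simp
  qed
  have circ: "circlepath 0 r y = r * expi y" for y
    by (simp add: circlepath expi_def cis_conv_exp mult_ac)
  have "((\<lambda>x. h (circlepath 0 r x) / (circlepath 0 r x - w) *
            vector_derivative (circlepath 0 r) (at x within {0..1})) has_integral
          2 * of_real pi * \<i> * h w) {0..1}"
    using Cauchy_integral_circlepath[OF cont holo, of w] w by (simp add: has_contour_integral_def)
  then have "((\<lambda>x. (2 * of_real pi * \<i>) * ?g x) has_integral 2 * of_real pi * \<i> * h w) {0..1}"
  proof (rule has_integral_eq[rotated])
    fix x :: real assume x: "x \<in> {0..1}"
    then have "vector_derivative (circlepath 0 r) (at x within {0..1}) = 2 * of_real pi * \<i> * (r * expi x)"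
      by (subst vector_derivative_circlepath01) (auto simp: expi_def cis_conv_exp mult_ac)
    moreover have "X / (A - w) * (2 * of_real pi * \<i> * A) = (2 * of_real pi * \<i>) * (X * (1 / (1 - w / A)))"
      if "A \<noteq> 0" "A \<noteq> w" for X A
      using that by (simp add: field_simps)
    ultimately show "h (circlepath 0 r x) / (circlepath 0 r x - w) *
            vector_derivative (circlepath 0 r) (at x within {0..1}) = (2 * of_real pi * \<i>) * ?g x"
      using ne[of x] r by (simp only: circ) simp
  qed
  from has_integral_mult_right[OF this, of "1 / (2 * of_real pi * \<i>)"]
  have int: "(?g has_integral h w) {0..1}" by (simp add: mult.assoc[symmetric])
  have "1 - w / (r * expi y) \<noteq> 0" for y
    using ne[of y] r by auto
  then have contg: "continuous_on UNIV ?g"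
    using r by (intro continuous_intros continuous_on_compose2[OF cont])
       (auto simp: norm_mult)
  have "(\<integral>y. ?g y \<partial>unit_interval) = (\<integral>x. indicator {0..1} x *\<^sub>R ?g x \<partial>lborel)"
    by (intro integral_unit_interval borel_measurable_continuous_onI contg)
  also have "\<dots> = integral {0..1} ?g"
    unfolding set_lebesgue_integral_def[symmetric]
    by (intro set_borel_integral_eq_integral borel_integrable_atLeastAtMost' continuous_on_subset[OF contg]) auto
  also have "\<dots> = h w" using int by (rule integral_unique)
  finally show ?thesis .
qed

lemma holo_ball_continuous_on: "holo_ball f \<Longrightarrow> continuous_on (ball 0 1) f"
  unfolding holo_ball_def
  by (intro continuous_at_imp_continuous_on ballI) (auto dest!: bspec has_derivative_continuous)

definition upd :: "complex^'n \<Rightarrow> 'n \<Rightarrow> complex \<Rightarrow> complex^'n" where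
  "upd z i s = (\<chi> j. if j = i then s else z$j)"

lemma has_derivative_upd:
  fixes z :: "complex^'n::finite"
  shows "(upd z i has_derivative axis i) (at s within S)"
proof -
  have "linear (axis i :: complex \<Rightarrow> complex^'n)"
    by (rule linearI) (auto simp: axis_def vec_eq_iff)
  then have "bounded_linear (axis i :: complex \<Rightarrow> complex^'n)"
    by (simp add: linear_conv_bounded_linear)
  then have "((\<lambda>s. upd z i 0 + axis i s) has_derivative axis i) (at s within S)"
    by (auto intro!: derivative_eq_intros bounded_linear_imp_has_derivative)
  moreover have "(\<lambda>s. upd z i 0 + axis i s) = upd z i"
    by (auto simp: upd_def axis_def vec_eq_iff fun_eq_iff)
  ultimately show ?thesis by simp
qed

lemma holo_ball_upd:
  assumes "holo_ball f" "upd z i s \<in> ball 0 1"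
  obtains d where "((\<lambda>s. f (upd z i s)) has_field_derivative d) (at s)"
proof -
  from assms obtain c where c: "(f has_derivative (\<lambda>v. \<Sum>j\<in>UNIV. c j * v$j)) (at (upd z i s))"
    unfolding holo_ball_def by blast
  have "((\<lambda>s. f (upd z i s)) has_derivative (\<lambda>x. \<Sum>j\<in>UNIV. c j * (axis i x)$j)) (at s)"
    by (rule has_derivative_compose[OF has_derivative_upd c])
  also have "(\<lambda>x. \<Sum>j\<in>UNIV. c j * (axis i x)$j) = (*) (c i)"
    by (simp add: axis_def fun_eq_iff if_distrib cong: if_cong)
  finally show ?thesis using that by (simp add: has_field_derivative_def)
qed

definition polydisc :: "('n::finite \<Rightarrow> real) \<Rightarrow> (complex^'n) set" where
  "polydisc r = {z. \<forall>j. cmod (z$j) \<le> r j}"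

lemma polydisc_subset_ball:
  assumes "\<And>j. r j \<ge> 0" "(\<Sum>j\<in>UNIV. (r j)\<^sup>2) < 1"
  shows "polydisc r \<subseteq> ball 0 1"
proof
  fix z assume "z \<in> polydisc r"
  then have "(\<Sum>j\<in>UNIV. (cmod (z$j))\<^sup>2) \<le> (\<Sum>j\<in>UNIV. (r j)\<^sup>2)"
    by (intro sum_mono power_mono) (auto simp: polydisc_def)
  then show "z \<in> ball 0 1" using assms(2) by (simp only: mem_unit_ball_iff)
qed

lemma closed_polydisc: "closed (polydisc r)"
  unfolding polydisc_def by (intro closed_Collect_all closed_Collect_le continuous_intros)

lemma compact_polydisc:
  assumes "\<And>j. r j \<ge> 0" "(\<Sum>j\<in>UNIV. (r j)\<^sup>2) < 1"
  shows "compact (polydisc r)"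
  using polydisc_subset_ball[OF assms] closed_polydisc bounded_subset[OF bounded_ball]
  by (auto simp: compact_eq_bounded_closed)


text \<open>One coordinate at a time: those in \<open>J\<close> run over their circles, the others
  rest at \<open>z\<close>, and the induction moves one coordinate into \<open>J\<close> by Fubini.
  As the squared radii add up to less than 1, all points met lie in the ball, where every
  one-variable slice is holomorphic.\<close>

lemma Cauchy_torus:
  fixes f :: "complex^'n::finite \<Rightarrow> complex" and z :: "complex^'n"
  assumes f: "holo_ball f" and r: "\<And>j. r j > 0" "(\<Sum>j\<in>UNIV. (r j)\<^sup>2) < 1"
    and "finite J" "\<And>j. cmod (z$j) < r j"
  shows "(\<integral>t. f (\<chi> j. if j \<in> J then r j * expi (t j) else z$j) *
              (\<Prod>j\<in>J. 1 / (1 - z$j / (r j * expi (t j)))) \<partial>PiM J (\<lambda>_. unit_interval)) = f z"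
  using assms(4-)
proof (induction J)
  case empty
  interpret prob_space "PiM {} (\<lambda>_::'n. unit_interval)"
    by (intro prob_space_PiM prob_space_unit_interval)
  show ?case by (simp add: prob_space)
next
  case (insert i J)
  interpret product_sigma_finite "\<lambda>_. unit_interval" by (rule product_sigma_finite_unit_interval)
  have r0: "r j \<ge> 0" for j using r(1)[of j] by simp
  note sub = polydisc_subset_ball[OF r0 r(2)]
  let ?U = "\<lambda>_::'n. unit_interval"
  define P where "P J t z = (\<chi> j. if j \<in> J then r j * expi (t j) else z$j)" for J t and z :: "complex^'n"
  define k where "k j y = 1 / (1 - z$j / (r j * expi y))" for j y
  define F where "F t = f (P (insert i J) t z) * (\<Prod>j\<in>insert i J. k j (t j))" for t
  have zr: "cmod (z$j) \<le> r j" for j using insert.prems[of j] by simp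
  have P_in: "P J t w \<in> polydisc r" if "w \<in> polydisc r" for J t w
    using r0 that by (auto simp: P_def polydisc_def norm_mult)
  have z_in: "z \<in> polydisc r" using zr by (simp add: polydisc_def)
  have cont: "continuous_on (polydisc r) f"
    using holo_ball_continuous_on[OF f] sub continuous_on_subset by blast
  have "compact (f ` polydisc r)"
    by (intro compact_continuous_image cont compact_polydisc r0 r(2))
  then obtain M where M: "\<And>w. w \<in> polydisc r \<Longrightarrow> cmod (f w) \<le> M"
    using compact_imp_bounded[of "f ` polydisc r"] by (auto simp: bounded_iff)
  have k_le: "cmod (k j y) \<le> 1 / (1 - cmod (z$j) / r j)" for j y
  proof -
    have "1 - cmod (z$j) / r j \<le> cmod (1 - z$j / (r j * expi y))"
      using norm_triangle_ineq2[of 1 "z$j / (r j * expi y)"] r(1)[of j]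
      by (simp add: norm_divide norm_mult)
    moreover have "1 - cmod (z$j) / r j > 0" using insert.prems[of j] r(1)[of j] by simp
    ultimately show ?thesis unfolding k_def norm_divide by (intro frac_le) auto
  qed
  have k_meas: "k j \<in> borel_measurable borel" for j
    unfolding k_def by measurable
  \<comment> \<open>Nothing is known about \<open>f\<close> outside the ball, so measurability comes
    from \<open>f\<close> cut off at the closed polydisc, where it is continuous.\<close>
  have meas_f: "(\<lambda>w. indicator (polydisc r) w *\<^sub>R f w) \<in> borel_measurable borel"
    by (intro borel_measurable_continuous_on_indicator borel_closed closed_polydisc cont)
  have P_meas: "(\<lambda>t. P (insert i J) t z) \<in> borel_measurable (PiM (insert i J) ?U)"
    unfolding P_def
  proof (rule borel_measurable_vec_lambda)
    fix j 
    show "(\<lambda>t. if j \<in> insert i J then r j * expi (t j) else z$j) \<in> borel_measurable (PiM (insert i J) ?U)"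
    proof (cases "j \<in> insert i J")
      case True
      then have [measurable]: "(\<lambda>t. t j) \<in> measurable (PiM (insert i J) ?U) borel"
        using measurable_component_singleton[of j "insert i J" ?U] by (simp cong: measurable_cong_sets)
      show ?thesis using True by simp
    qed auto
  qed
  have F_meas: "F \<in> borel_measurable (PiM (insert i J) ?U)"
  proof -
    have "(\<lambda>t. indicator (polydisc r) (P (insert i J) t z) *\<^sub>R f (P (insert i J) t z))
            \<in> borel_measurable (PiM (insert i J) ?U)"
      using measurable_compose[OF P_meas meas_f] .
    then have 1: "(\<lambda>t. f (P (insert i J) t z)) \<in> borel_measurable (PiM (insert i J) ?U)"
      by (simp add: P_in z_in)
    have 2: "(\<lambda>t. k j (t j)) \<in> borel_measurable (PiM (insert i J) ?U)" if "j \<in> insert i J" for j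
      using measurable_compose[OF measurable_component_singleton[of j "insert i J" ?U], of "k j" borel] that k_meas
      by (simp cong: measurable_cong_sets)
    show ?thesis unfolding F_def by (intro borel_measurable_times 1 borel_measurable_prod 2)
  qed
  \<comment> \<open>Fubini for Bochner integrals demands integrability: \<open>f\<close> is bounded
    on the compact polydisc and each kernel stays away from its pole because
    \<open>cmod (z$j) < r j\<close>.\<close>
  have F_int: "integrable (PiM (insert i J) ?U) F"
  proof -
    interpret prob_space "PiM (insert i J) ?U"
      by (intro prob_space_PiM prob_space_unit_interval)
    have "norm (F t) \<le> M * (\<Prod>j\<in>insert i J. 1 / (1 - cmod (z$j) / r j))" for t
      unfolding F_def norm_mult prod_norm[symmetric]
      by (intro mult_mono M P_in z_in prod_mono conjI k_le prod_nonneg)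
         (auto intro: order_trans[OF norm_ge_zero M[OF z_in]])
    then show ?thesis
      by (intro integrable_const_bound[OF _ F_meas] AE_I2)
  qed
  \<comment> \<open>The inner integral is the one-variable formula for the slice through coordinate
    \<open>i\<close>, evaluated at \<open>z$i\<close>, with the other factors constant.\<close>
  have step: "(\<integral>y. F (x(i := y)) \<partial>unit_interval) = f (P J x z) * (\<Prod>j\<in>J. k j (x j))" for x
  proof -
    let ?w = "P J x z"
    have w_in: "?w \<in> polydisc r" by (intro P_in z_in)
    have wi: "?w $ i = z $ i" using insert.hyps by (simp add: P_def)
    have upd_in: "upd ?w i s \<in> polydisc r" if "cmod s \<le> r i" for s :: complex
      using that w_in by (auto simp: polydisc_def upd_def)
    have "F (x(i := y)) = f (upd ?w i (r i * expi y)) * k i y * (\<Prod>j\<in>J. k j (x j))" for y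
    proof -
      have "P (insert i J) (x(i := y)) z = upd ?w i (r i * expi y)"
        by (auto simp: P_def upd_def vec_eq_iff)
      moreover have "(\<Prod>j\<in>J. k j ((x(i := y)) j)) = (\<Prod>j\<in>J. k j (x j))"
        using insert.hyps by (intro prod.cong) auto
      ultimately show ?thesis
        using insert.hyps by (simp add: F_def mult_ac)
    qed
    moreover have "(\<integral>y. f (upd ?w i (r i * expi y)) * k i y \<partial>unit_interval) = f (upd ?w i (z$i))"
      unfolding k_def
    proof (rule Cauchy_unit_interval[where h = "\<lambda>s. f (upd ?w i s)"])
      have "continuous_on (cball 0 (r i)) (upd ?w i)"
        by (rule has_derivative_continuous_on) (rule has_derivative_upd)
      then show "continuous_on (cball 0 (r i)) (\<lambda>s. f (upd ?w i s))"
        using upd_in by (intro continuous_on_compose2[OF cont]) auto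
      show "(\<lambda>s. f (upd ?w i s)) holomorphic_on ball 0 (r i)"
        unfolding holomorphic_on_open[OF open_ball]
      proof safe
        fix s :: complex assume "s \<in> ball 0 (r i)"
        then have "upd ?w i s \<in> ball 0 1" using upd_in[of s] sub by auto
        then show "\<exists>d. ((\<lambda>s. f (upd ?w i s)) has_field_derivative d) (at s)"
          using holo_ball_upd[OF f] by blast
      qed
    qed (use r(1) insert.prems in auto)
    moreover have "upd ?w i (z$i) = ?w"
      using wi by (auto simp: upd_def vec_eq_iff)
    ultimately show ?thesis by simp
  qed
  have "(\<integral>t. F t \<partial>PiM (insert i J) ?U) = (\<integral>x. f (P J x z) * (\<Prod>j\<in>J. k j (x j)) \<partial>PiM J ?U)"
    by (subst product_integral_insert[OF insert.hyps F_int]) (simp only: step)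
  also have "\<dots> = f z"
    using insert.IH[OF insert.prems] by (simp add: P_def k_def)
  finally show ?case by (simp add: F_def P_def k_def)
qed


text \<open>All moduli are enlarged by one small \<open>e\<close>; the inequality defining the ball
  is strict, so it survives.\<close>

lemma polyradius_exists:
  fixes z :: "complex^'n::finite"
  assumes "z \<in> ball 0 1"
  obtains r where "\<And>j. cmod (z$j) < r j" "(\<Sum>j\<in>UNIV. (r j)\<^sup>2) < 1"
proof -
  have "((\<lambda>e. \<Sum>j\<in>UNIV. (cmod (z$j) + e)\<^sup>2) \<longlongrightarrow> (\<Sum>j\<in>UNIV. (cmod (z$j) + 0)\<^sup>2)) (at_right 0)"
    by (intro tendsto_intros)
  then have "\<forall>\<^sub>F e in at_right 0. (\<Sum>j\<in>UNIV. (cmod (z$j) + e)\<^sup>2) < 1"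
    using assms unfolding mem_unit_ball_iff by (intro order_tendstoD(2)) auto
  moreover have "\<forall>\<^sub>F e::real in at_right 0. e > 0"
    by (rule eventually_at_right_less)
  ultimately have "\<forall>\<^sub>F e in at_right 0. (\<Sum>j\<in>UNIV. (cmod (z$j) + e)\<^sup>2) < 1 \<and> e > 0"
    by eventually_elim simp
  then obtain e where "(\<Sum>j\<in>UNIV. (cmod (z$j) + e)\<^sup>2) < 1" "e > 0"
    using eventually_happens'[of "at_right (0::real)"] by (auto simp: trivial_limit_at_right_real)
  then show ?thesis by (intro that[of "\<lambda>j. cmod (z$j) + e"]) auto
qed

text \<open>Each Cauchy kernel \<open>1 / (1 - x t j)\<close> is a geometric series whose ratio has
  modulus \<open>cmod (z$j) / r j < 1\<close> for every \<open>t\<close>, so the multiple series can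
  be integrated term by term over the torus.\<close>

lemma polydisc_series:
  fixes f :: "complex^'n::finite \<Rightarrow> complex"
  assumes f: "holo_ball f" and r: "\<And>j. r j > 0" "(\<Sum>j\<in>UNIV. (r j)\<^sup>2) < 1"
  obtains a where "\<And>z. (\<And>j. cmod (z$j) < r j) \<Longrightarrow> ((\<lambda>p. a p * Defs.monom z p) has_sum f z) UNIV"
proof -
  interpret T: prob_space "torus :: ('n \<Rightarrow> real) measure" by (rule prob_space_torus)
  have r0: "r j \<ge> 0" for j using r(1)[of j] by simp
  note sub = polydisc_subset_ball[OF r0 r(2)]
  define P where "P t = (\<chi> j. r j * expi (t j))" for t :: "'n \<Rightarrow> real"
  \<comment> \<open>Fixed before \<open>z\<close>: the coefficients depend on \<open>r\<close> but
    not on the point of the polydisc.\<close>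
  define a where "a p = (\<integral>t. f (P t) * (\<Prod>j\<in>UNIV. (1 / (r j * expi (t j))) ^ p j) \<partial>torus)" for p
  have P_in: "P t \<in> polydisc r" for t
    using r0 by (auto simp: P_def polydisc_def norm_mult)
  have cont: "continuous_on (polydisc r) f"
    using holo_ball_continuous_on[OF f] sub continuous_on_subset by blast
  have "compact (f ` polydisc r)"
    by (intro compact_continuous_image cont compact_polydisc r0 r(2))
  then obtain M where M: "\<And>w. w \<in> polydisc r \<Longrightarrow> cmod (f w) \<le> M"
    using compact_imp_bounded[of "f ` polydisc r"] by (auto simp: bounded_iff)
  have meas_f: "(\<lambda>w. indicator (polydisc r) w *\<^sub>R f w) \<in> borel_measurable borel"
    by (intro borel_measurable_continuous_on_indicator borel_closed closed_polydisc cont)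
  have P_meas: "P \<in> borel_measurable torus"
    unfolding P_def by measurable
  have fP_meas [measurable]: "(\<lambda>t. f (P t)) \<in> borel_measurable torus"
    using measurable_compose[OF P_meas meas_f] by (simp add: P_in)
  have "((\<lambda>p. a p * Defs.monom z p) has_sum f z) UNIV" if z: "\<And>j. cmod (z$j) < r j" for z
  proof -
    define x where "x t j = z$j / (r j * expi (t j))" for t :: "'n \<Rightarrow> real" and j
    have xr: "cmod (x t j) = cmod (z$j) / r j" for t j
      using r0[of j] by (simp add: x_def norm_divide norm_mult)
    have x1: "cmod (z$j) / r j < 1" for j using z[of j] r(1)[of j] by simp
    have x_meas [measurable]: "(\<lambda>t. x t j) \<in> borel_measurable torus" for j
      unfolding x_def by measurable
    have m1: "(\<lambda>t. f (P t) * (\<Prod>j\<in>UNIV. x t j ^ p j)) \<in> borel_measurable torus" for p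
      by measurable
    have m2: "(\<lambda>t. f (P t) * (\<Prod>j\<in>UNIV. 1 / (1 - x t j))) \<in> borel_measurable torus"
      by measurable
    have le: "cmod (f (P t) * (\<Prod>j\<in>UNIV. x t j ^ p j)) \<le> M * (\<Prod>j\<in>UNIV. (cmod (z$j) / r j) ^ p j)" for t p
      unfolding norm_mult prod_norm[symmetric] norm_power xr
      by (intro mult_right_mono M P_in prod_nonneg) (auto simp: r0)
    have sm: "(\<lambda>p. M * (\<Prod>j\<in>UNIV. (cmod (z$j) / r j) ^ p j)) summable_on UNIV"
      by (intro summable_on_cmult_right summable_on_multi_geometric x1) (simp add: r0)
    have hs: "((\<lambda>p. f (P t) * (\<Prod>j\<in>UNIV. x t j ^ p j)) has_sum f (P t) * (\<Prod>j\<in>UNIV. 1 / (1 - x t j))) UNIV" for t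
      by (intro has_sum_cmult_right has_sum_multi_geometric) (simp add: xr x1)
    have "((\<lambda>p. \<integral>t. f (P t) * (\<Prod>j\<in>UNIV. x t j ^ p j) \<partial>torus) has_sum
        (\<integral>t. f (P t) * (\<Prod>j\<in>UNIV. 1 / (1 - x t j)) \<partial>torus)) UNIV"
      by (rule T.integral_has_sum(1)[OF m1 m2 le sm hs])
    moreover have "(\<integral>t. f (P t) * (\<Prod>j\<in>UNIV. 1 / (1 - x t j)) \<partial>torus) = f z"
      using Cauchy_torus[OF f r, of UNIV z] z by (simp add: P_def x_def torus_def)
    moreover have "(\<integral>t. f (P t) * (\<Prod>j\<in>UNIV. x t j ^ p j) \<partial>torus) = a p * Defs.monom z p" for p
    proof -
      have "f (P t) * (\<Prod>j\<in>UNIV. x t j ^ p j) =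
            f (P t) * (\<Prod>j\<in>UNIV. (1 / (r j * expi (t j))) ^ p j) * Defs.monom z p" for t
        by (simp add: x_def Defs.monom_def power_divide prod_dividef)
      then show ?thesis by (simp only: a_def integral_mult_left_zero)
    qed
    ultimately show ?thesis by simp
  qed
  then show ?thesis by (rule that)
qed

section \<open>Expansion on the entire ball\<close>

text \<open>The predicate under the definite description in \<open>pcoeff\<close>. As a relation
  between coefficients and function it can be carried through sums, truncations and derivatives
  without mentioning \<open>pcoeff\<close>.\<close>

definition pseries :: "(('n::finite \<Rightarrow> nat) \<Rightarrow> complex) \<Rightarrow> (complex^'n \<Rightarrow> complex) \<Rightarrow> bool" where
  "pseries a f \<longleftrightarrow> (\<forall>z\<in>ball 0 1. ((\<lambda>p. a p * Defs.monom z p) has_sum f z) UNIV)"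

lemma pseriesD: "pseries a f \<Longrightarrow> z \<in> ball 0 1 \<Longrightarrow> ((\<lambda>p. a p * Defs.monom z p) has_sum f z) UNIV"
  by (simp add: pseries_def)

text \<open>A polydisc with equal radii, as \<open>monom_series_unique\<close> wants: with radius
  1/(2n) the squares add up to at most 1/(4n).\<close>

lemma small_polydisc_subset:
  fixes z :: "complex^'n::finite"
  assumes "\<And>j. cmod (z$j) < 1 / (2 * real CARD('n))"
  shows "z \<in> ball 0 1"
proof -
  have "(\<Sum>j\<in>UNIV. (cmod (z$j))\<^sup>2) \<le> (\<Sum>j\<in>(UNIV::'n set). (1 / (2 * real CARD('n)))\<^sup>2)"
    using assms by (intro sum_mono power_mono) (auto intro: less_imp_le)
  also have "\<dots> = 1 / (4 * real CARD('n))"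
    by (simp add: power2_eq_square field_simps)
  also have "\<dots> < 1"
  proof -
    have "CARD('n) \<ge> 1" by (simp add: Suc_leI)
    then have "real CARD('n) \<ge> 1" by linarith
    then have "1 < 4 * real CARD('n)" by linarith
    then show ?thesis by (simp add: field_simps)
  qed
  finally show ?thesis by (simp only: mem_unit_ball_iff)
qed

lemma pseries_unique: "pseries a f \<Longrightarrow> pseries b f \<Longrightarrow> a = (b :: ('n::finite \<Rightarrow> nat) \<Rightarrow> complex)"
  by (rule monom_series_unique[of "1 / (2 * real CARD('n))" a f])
     (auto intro!: pseriesD small_polydisc_subset simp del: mem_ball)

lemma pcoeff_eq: "pseries a f \<Longrightarrow> pcoeff f = a"
  unfolding pcoeff_def pseries_def[symmetric] by (rule the_equality) (auto intro: pseries_unique)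

text \<open>Every point of the ball lies in some polydisc about 0 with its own expansion. Any two
  such expansions agree on a small polydisc with equal radii, hence have the same
  coefficients.\<close>

lemma holo_ball_imp_pseries:
  fixes f :: "complex^'n::finite \<Rightarrow> complex"
  assumes f: "holo_ball f"
  shows "pseries (pcoeff f) f"
proof -
  \<comment> \<open>The gluing: a series representing \<open>f\<close> near 0 also represents it at
    an arbitrary \<open>z\<close> of the ball.\<close>
  have *: "((\<lambda>p. a p * Defs.monom z p) has_sum f z) UNIV"
    if a: "\<And>z. (\<And>j. cmod (z$j) < \<rho>) \<Longrightarrow> ((\<lambda>p. a p * Defs.monom z p) has_sum f z) UNIV"
      and \<rho>: "\<rho> > 0" and z: "z \<in> ball 0 1" for a \<rho> z
  proof -
    from polyradius_exists[OF z] obtain r where r: "\<And>j. cmod (z$j) < r j" "(\<Sum>j\<in>UNIV. (r j)\<^sup>2) < 1"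
      by blast
    have r0: "r j > 0" for j using r(1)[of j] by (rule le_less_trans[OF norm_ge_zero])
    from polydisc_series[OF f r0 r(2)] obtain b where
      b: "\<And>z. (\<And>j. cmod (z$j) < r j) \<Longrightarrow> ((\<lambda>p. b p * Defs.monom z p) has_sum f z) UNIV" by blast
    \<comment> \<open>Small enough for both expansions to be valid where all coordinates are below
      \<open>\<rho>'\<close>.\<close>
    define \<rho>' where "\<rho>' = min \<rho> (Min (range r))"
    have \<rho>': "\<rho>' > 0" "\<rho>' \<le> \<rho>" "\<And>j. \<rho>' \<le> r j"
      using \<rho> r0 by (auto simp: \<rho>'_def intro!: min.coboundedI2 Min_le)
    have "a = b"
      by (rule monom_series_unique[OF \<rho>'(1), of a f]) (intro a b, metis \<rho>' less_le_trans)+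
    then show ?thesis using b r(1) by simp
  qed
  define \<rho> where "\<rho> = 1 / (2 * real CARD('n))"
  have \<rho>: "\<rho> > 0" by (simp add: \<rho>_def)
  \<comment> \<open>This point only serves to produce a polyradius with all entries above
    \<open>\<rho> / 2\<close>, hence one reference expansion near 0.\<close>
  have "(\<chi> j. complex_of_real (\<rho> / 2)) \<in> (ball 0 1 :: (complex^'n) set)"
    using \<rho> by (intro small_polydisc_subset) (simp add: \<rho>_def[symmetric])
  from polyradius_exists[OF this] obtain r :: "'n \<Rightarrow> real" where r: "\<And>j. \<rho> / 2 < r j" "(\<Sum>j\<in>UNIV. (r j)\<^sup>2) < 1"
    using \<rho> by auto
  have "r j > 0" for j using r(1)[of j] \<rho> by simp
  from polydisc_series[OF f this r(2)] obtain a where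
    a: "\<And>z. (\<And>j. cmod (z$j) < r j) \<Longrightarrow> ((\<lambda>p. a p * Defs.monom z p) has_sum f z) UNIV" by blast
  have "pseries a f"
    unfolding pseries_def
  proof
    fix z :: "complex^'n" assume z: "z \<in> ball 0 1"
    have "((\<lambda>p. a p * Defs.monom w p) has_sum f w) UNIV" if "\<And>j. cmod (w$j) < \<rho> / 2" for w :: "complex^'n"
      by (rule a) (use that r(1) in \<open>metis less_trans\<close>)
    then show "((\<lambda>p. a p * Defs.monom z p) has_sum f z) UNIV"
      by (rule *[of "\<rho> / 2"]) (use \<rho> z in auto)
  qed
  then show ?thesis using pcoeff_eq by blast
qed

section \<open>Termwise differentiation\<close>

lemma pseries_abs_summable:
  "pseries a f \<Longrightarrow> z \<in> ball 0 1 \<Longrightarrow> (\<lambda>p. cmod (a p) * cmod (Defs.monom z p)) summable_on UNIV"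
  using pseriesD[of a f z] summable_on_iff_abs_summable_on_complex[of "\<lambda>p. a p * Defs.monom z p" UNIV]
  by (auto simp: norm_mult summable_on_def)

lemma pseries_add: "pseries a f \<Longrightarrow> pseries b g \<Longrightarrow> pseries (\<lambda>p. a p + b p) (\<lambda>z. f z + g z)"
  unfolding pseries_def by (auto simp: distrib_right intro!: has_sum_add)

lemma pseries_cmult: "pseries a f \<Longrightarrow> pseries (\<lambda>p. c * a p) (\<lambda>z. c * f z)"
  unfolding pseries_def by (auto simp: mult.assoc intro!: has_sum_cmult_right)

lemma pseries_diff: "pseries a f \<Longrightarrow> pseries b g \<Longrightarrow> pseries (\<lambda>p. a p - b p) (\<lambda>z. f z - g z)"
  using pseries_add[of a f "\<lambda>p. (-1) * b p" "\<lambda>z. (-1) * g z"] pseries_cmult[of b g "-1"] by simp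

lemma finite_mabs_less: "finite {p :: 'n::finite \<Rightarrow> nat. mabs p < m}"
proof -
  have "{p :: 'n \<Rightarrow> nat. mabs p < m} = (\<Union>k<m. midx UNIV k)"
    by (auto simp: midx_UNIV)
  then show ?thesis by (simp add: finite_midx)
qed

lemma pseries_f1:
  assumes "pseries a f"
  shows "pseries (\<lambda>p. if mabs p < m then a p else 0) (f1 m f)"
  unfolding pseries_def
proof
  fix z :: "complex^'a"
  show "((\<lambda>p. (if mabs p < m then a p else 0) * Defs.monom z p) has_sum f1 m f z) UNIV"
    unfolding f1_def pcoeff_eq[OF assms]
    by (rule has_sum_finite_neutralI[OF finite_mabs_less[of m]]) auto
qed

lemma pseries_f2:
  assumes "pseries a f"
  shows "pseries (\<lambda>p. if mabs p < m then 0 else a p) (f2 m f)"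
proof -
  have "f2 m f = (\<lambda>z. f z - f1 m f z)" by (simp add: f2_def fun_eq_iff)
  moreover have "(\<lambda>p. a p - (if mabs p < m then a p else 0)) = (\<lambda>p. if mabs p < m then 0 else a p)"
    by auto
  ultimately show ?thesis
    using pseries_diff[OF assms pseries_f1[OF assms, of m]] by simp
qed

text \<open>The partial derivative of a monomial. When \<open>p j = 0\<close> the truncated exponent
  \<open>p j - 1\<close> is harmless, since the factor \<open>of_nat (p j)\<close> is 0.\<close>

definition dmonom :: "'n::finite \<Rightarrow> complex^'n \<Rightarrow> ('n \<Rightarrow> nat) \<Rightarrow> complex" where
  "dmonom j z p = of_nat (p j) * z$j ^ (p j - 1) * (\<Prod>k\<in>-{j}. z$k ^ p k)"

lemma monom_remove: "Defs.monom z p = z$j ^ p j * (\<Prod>k\<in>-{j}. z$k ^ p k)"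
  unfolding Defs.monom_def by (subst prod.remove[of UNIV j]) (auto simp: Compl_eq_Diff_UNIV)

lemma monom_axis: "Defs.monom (z + axis j t) p = (z$j + t) ^ p j * (\<Prod>k\<in>-{j}. z$k ^ p k)"
  unfolding monom_remove[of _ p j] by (simp add: axis_def)

lemma monom_mono:
  fixes z w :: "complex^'n::finite"
  assumes "\<And>k. cmod (z$k) \<le> cmod (w$k)"
  shows "cmod (Defs.monom z p) \<le> cmod (Defs.monom w p)"
  unfolding norm_monom using assms by (intro prod_mono conjI power_mono) auto

lemma dmonom_mono:
  fixes z w :: "complex^'n::finite"
  assumes "\<And>k. cmod (z$k) \<le> cmod (w$k)"
  shows "cmod (dmonom j z p) \<le> cmod (dmonom j w p)"
  unfolding dmonom_def norm_mult norm_power prod_norm[symmetric]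
  using assms by (intro mult_mono prod_mono conjI power_mono prod_nonneg) auto

text \<open>Absolute convergence at the dominating point \<open>w\<close> supplies the Weierstrass
  bounds near \<open>z\<close>.\<close>

lemma polyradius_vec:
  fixes z :: "complex^'n::finite"
  assumes "z \<in> ball 0 1"
  obtains w where "w \<in> ball 0 1" "\<And>j. cmod (z$j) < cmod (w$j)"
proof -
  from polyradius_exists[OF assms] obtain r where r: "\<And>j. cmod (z$j) < r j" "(\<Sum>j\<in>UNIV. (r j)\<^sup>2) < 1"
    by blast
  have "r j > 0" for j using r(1)[of j] by (rule le_less_trans[OF norm_ge_zero])
  then have "\<bar>r j\<bar> = r j" for j by (simp add: less_imp_le)
  then show ?thesis
    using r by (intro that[of "\<chi> j. of_real (r j)"]) (auto simp only: mem_unit_ball_iff vec_lambda_beta norm_of_real)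
qed

text \<open>In the single variable \<open>t\<close> the finite partial sums are polynomials
  converging uniformly on a disc, so their derivatives converge to the derivative of the limit,
  along the same net of finite index sets.\<close>

lemma pd_has_sum:
  fixes z :: "complex^'n::finite"
  assumes a: "pseries a f" and z: "z \<in> ball 0 1"
  shows "((\<lambda>p. a p * dmonom j z p) has_sum pd j f z) UNIV"
proof -
  from polyradius_vec[OF z] obtain w where w: "w \<in> ball 0 1" "\<And>j. cmod (z$j) < cmod (w$j)" by blast
  \<comment> \<open>The room left in coordinate \<open>j\<close>: for
    \<open>cmod t \<le> \<rho>\<close> the moved point is still dominated by
    \<open>w\<close>.\<close>
  define \<rho> where "\<rho> = cmod (w$j) - cmod (z$j)"
  have \<rho>: "\<rho> > 0" using w(2)[of j] by (simp add: \<rho>_def)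
  define S where "S F t = (\<Sum>p\<in>F. a p * Defs.monom (z + axis j t) p)" for F t
  define S' where "S' F t = (\<Sum>p\<in>F. a p * (of_nat (p j) * (z$j + t) ^ (p j - 1) * (\<Prod>k\<in>-{j}. z$k ^ p k)))" for F t
  have le: "cmod ((z + axis j t)$k) \<le> cmod (w$k)" if "t \<in> cball 0 \<rho>" for t :: complex and k
    using that w(2)[of k] norm_triangle_ineq[of "z$j" t] by (auto simp: axis_def \<rho>_def)
  have in_ball: "z + axis j t \<in> ball 0 1" if "t \<in> cball 0 \<rho>" for t :: complex
  proof -
    have "(\<Sum>k\<in>UNIV. (cmod ((z + axis j t)$k))\<^sup>2) \<le> (\<Sum>k\<in>UNIV. (cmod (w$k))\<^sup>2)"
      by (intro sum_mono power_mono le that norm_ge_zero)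
    then show ?thesis using w(1) by (simp only: mem_unit_ball_iff)
  qed
  have ul: "uniform_limit (cball 0 \<rho>) S (\<lambda>t. f (z + axis j t)) (finite_subsets_at_top UNIV)"
    unfolding S_def
  proof (rule Weierstrass_m_test_general'[OF _ _ pseries_abs_summable[OF a w(1)]])
    fix p and t :: complex assume "t \<in> cball 0 \<rho>"
    then show "cmod (a p * Defs.monom (z + axis j t) p) \<le> cmod (a p) * cmod (Defs.monom w p)"
      unfolding norm_mult by (intro mult_left_mono monom_mono le) auto
  qed (intro pseriesD[OF a] in_ball)
  have der: "(S F has_field_derivative S' F t) (at t within X)" for F t X
    unfolding S_def S'_def monom_axis
    by (auto intro!: DERIV_sum derivative_eq_intros simp: algebra_simps)
  have "continuous_on (cball 0 \<rho>) (S F)" for F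
    using der by (intro DERIV_continuous_on)
  then have ev: "\<forall>\<^sub>F F in finite_subsets_at_top UNIV. continuous_on (cball 0 \<rho>) (S F) \<and>
        (\<forall>w\<in>ball 0 \<rho>. (S F has_field_derivative S' F w) (at w))"
    using der by auto
  obtain g' where g': "\<And>t. t \<in> ball 0 \<rho> \<Longrightarrow> ((\<lambda>t. f (z + axis j t)) has_field_derivative g' t) (at t)
      \<and> ((\<lambda>F. S' F t) \<longlongrightarrow> g' t) (finite_subsets_at_top UNIV)"
    using has_complex_derivative_uniform_limit[OF ev ul finite_subsets_at_top_neq_bot \<rho>] by blast
  have "pd j f z = g' 0"
    unfolding pd_def using g'[of 0] \<rho> by (intro DERIV_imp_deriv) auto
  moreover have "S' F 0 = (\<Sum>p\<in>F. a p * dmonom j z p)" for F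
    by (simp add: S'_def dmonom_def)
  ultimately show ?thesis
    using g'[of 0] \<rho> by (simp add: has_sum_def)
qed

text \<open>Terms with \<open>p j = 0\<close> vanish, and the remaining indices are exactly those
  obtained by raising the \<open>j\<close>-th exponent by one.\<close>

lemma pseries_pd:
  fixes f :: "complex^'n::finite \<Rightarrow> complex"
  assumes a: "pseries a f"
  shows "pseries (\<lambda>p. of_nat (Suc (p j)) * a (p(j := Suc (p j)))) (pd j f)"
  unfolding pseries_def
proof
  fix z :: "complex^'n" assume z: "z \<in> ball 0 1"
  define h where "h p = p(j := Suc (p j))" for p :: "'n \<Rightarrow> nat"
  have inj: "inj h"
    by (rule injI) (auto simp: h_def fun_eq_iff split: if_splits)
  have "p \<in> range h" if "p j \<noteq> 0" for p
    using that by (intro image_eqI[of _ _ "p(j := p j - 1)"]) (auto simp: h_def)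
  then have "((\<lambda>p. a p * dmonom j z p) has_sum pd j f z) UNIV \<longleftrightarrow>
        ((\<lambda>p. a p * dmonom j z p) has_sum pd j f z) (range h)"
    by (intro has_sum_cong_neutral) (auto simp: dmonom_def)
  then have "(((\<lambda>p. a p * dmonom j z p) \<circ> h) has_sum pd j f z) UNIV"
    using pd_has_sum[OF a z, of j] has_sum_reindex[OF inj] by metis
  moreover have "(\<lambda>p. a p * dmonom j z p) \<circ> h = (\<lambda>p. of_nat (Suc (p j)) * a (h p) * Defs.monom z p)"
    unfolding monom_remove[of z _ j] by (simp add: dmonom_def h_def mult_ac fun_eq_iff)
  ultimately show "((\<lambda>p. of_nat (Suc (p j)) * a (p(j := Suc (p j))) * Defs.monom z p) has_sum pd j f z) UNIV"
    by (simp only: h_def)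
qed

lemma pseries_pd_power:
  assumes a: "pseries a f"
  shows "pseries (\<lambda>p. fact (p j + k) / fact (p j) * a (p(j := p j + k))) ((pd j ^^ k) f)"
proof (induction k)
  case 0
  then show ?case using a by simp
next
  case (Suc k)
  have "of_nat (Suc (p j)) * (fact ((p(j := Suc (p j))) j + k) / fact ((p(j := Suc (p j))) j) *
          a ((p(j := Suc (p j)))(j := (p(j := Suc (p j))) j + k))) =
        fact (p j + Suc k) / fact (p j) * a (p(j := p j + Suc k))" for p
  proof -
    have "of_nat (Suc (p j)) * (fact (Suc (p j) + k) / fact (Suc (p j))) =
          (fact (p j + Suc k) / fact (p j) :: complex)"
      unfolding fact_Suc[of "p j"] by (simp del: of_nat_Suc fact_Suc)
    then show ?thesis
      by (simp only: fun_upd_same fun_upd_upd mult.assoc[symmetric] add_Suc add_Suc_right)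
  qed
  then show ?case
    using pseries_pd[OF Suc.IH, of j] by (simp del: fun_upd_apply)
qed

text \<open>Distinctness ensures that the derivative in the head coordinate changes an exponent not
  touched by the tail, so the factorial quotients multiply without interaction.\<close>

lemma pseries_pd_foldr:
  assumes a: "pseries a f" and "distinct xs"
  shows "pseries (\<lambda>p. (\<Prod>j\<in>set xs. fact (p j + q j) / fact (p j)) *
             a (\<lambda>j. if j \<in> set xs then p j + q j else p j))
           (foldr (\<lambda>j h. (pd j ^^ q j) h) xs f)"
  using assms(2)
proof (induction xs)
  case Nil
  then show ?case using a by simp
next
  case (Cons x xs)
  have "fact (p x + q x) / fact (p x) *
        ((\<Prod>j\<in>set xs. fact ((p(x := p x + q x)) j + q j) / fact ((p(x := p x + q x)) j)) *
          a (\<lambda>j. if j \<in> set xs then (p(x := p x + q x)) j + q j else (p(x := p x + q x)) j)) =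
        (\<Prod>j\<in>set (x # xs). fact (p j + q j) / fact (p j)) *
          a (\<lambda>j. if j \<in> set (x # xs) then p j + q j else p j)" for p
  proof -
    have "(\<Prod>j\<in>set xs. fact ((p(x := p x + q x)) j + q j) / fact ((p(x := p x + q x)) j)) =
          (\<Prod>j\<in>set xs. fact (p j + q j) / (fact (p j) :: complex))"
      using Cons.prems by (intro prod.cong) auto
    moreover have "(\<lambda>j. if j \<in> set xs then (p(x := p x + q x)) j + q j else (p(x := p x + q x)) j) =
          (\<lambda>j. if j \<in> set (x # xs) then p j + q j else p j)"
      using Cons.prems by (auto simp: fun_eq_iff)
    ultimately show ?thesis using Cons.prems by simp
  qed
  then show ?case
    using pseries_pd_power[OF Cons.IH, of x "q x"] Cons.prems by simp
qed

lemma pseries_Dp: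
  assumes "pseries a f"
  shows "pseries (\<lambda>p. of_real (mfact (\<lambda>j. p j + q j) / mfact p) * a (\<lambda>j. p j + q j)) (Dp q f)"
proof -
  \<comment> \<open>\<open>coord_list\<close> is a choice; all that matters is that it lists each
    coordinate once, which holds as soon as such a list exists.\<close>
  have "\<exists>xs :: 'a list. distinct xs \<and> set xs = UNIV"
    using finite_distinct_list[OF finite, of "UNIV :: 'a set"] by blast
  then have "distinct (coord_list :: 'a list) \<and> set (coord_list :: 'a list) = UNIV"
    unfolding coord_list_def by (rule someI_ex)
  then show ?thesis
    using pseries_pd_foldr[OF assms, of coord_list q]
    by (simp add: Dp_def mfact_def prod_dividef)
qed

section \<open>Power series are holomorphic\<close>

lemma has_derivative_monom:
  "((\<lambda>z. Defs.monom z p) has_derivative (\<lambda>v. \<Sum>j\<in>UNIV. dmonom j z p * v$j)) (at z within X)"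
proof -
  have "((\<lambda>z. \<Prod>j\<in>UNIV. z$j ^ p j) has_derivative
      (\<lambda>v. \<Sum>j\<in>UNIV. (of_nat (p j) * z$j ^ (p j - 1) * v$j) * (\<Prod>k\<in>UNIV-{j}. z$k ^ p k))) (at z within X)"
    by (intro has_derivative_prod) (auto intro!: derivative_eq_intros bounded_linear_imp_has_derivative bounded_linear_vec_nth simp: mult_ac)
  then show ?thesis
    by (simp add: Defs.monom_def dmonom_def Compl_eq_Diff_UNIV mult_ac)
qed

text \<open>\<open>holo_ball\<close> asks for a total derivative, so partial derivatives alone do
  not suffice. Uniform convergence of all partial derivative series near \<open>z0\<close> gives
  uniform convergence of the total derivatives, and termwise differentiation applies.\<close>

lemma pseries_imp_holo_ball:
  fixes f :: "complex^'n::finite \<Rightarrow> complex"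
  assumes a: "pseries a f"
  shows "holo_ball f"
  unfolding holo_ball_def
proof
  fix z0 :: "complex^'n" assume z0: "z0 \<in> ball 0 1"
  from polyradius_vec[OF z0] obtain w where w: "w \<in> ball 0 1" "\<And>j. cmod (z0$j) < cmod (w$j)" by blast
  define S where "S = (\<Inter>j. {z :: complex^'n. cmod (z$j) < cmod (w$j)})"
  have "open S" unfolding S_def
    by (intro open_INT ballI open_Collect_less continuous_intros) simp
  moreover have "z0 \<in> S" using w(2) by (simp add: S_def)
  ultimately obtain \<delta> where \<delta>: "\<delta> > 0" "ball z0 \<delta> \<subseteq> S" 
    by (meson openE)
  have le: "cmod (z$k) \<le> cmod (w$k)" if "z \<in> ball z0 \<delta>" for z :: "complex^'n" and k
  proof -
    have "z \<in> S" using that \<delta>(2) by blast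
    then have "cmod (z$k) < cmod (w$k)" by (simp add: S_def)
    then show ?thesis by simp
  qed
  have in_ball: "z \<in> ball 0 1" if "z \<in> ball z0 \<delta>" for z
  proof -
    have "(\<Sum>k\<in>UNIV. (cmod (z$k))\<^sup>2) \<le> (\<Sum>k\<in>UNIV. (cmod (w$k))\<^sup>2)"
      by (intro sum_mono power_mono le that norm_ge_zero)
    then show ?thesis using w(1) by (simp only: mem_unit_ball_iff)
  qed
  define e :: "nat \<Rightarrow> 'n \<Rightarrow> nat" where "e = from_nat_into UNIV"
  \<comment> \<open>Termwise differentiation is about sequences, so the countable set of
    multi-indices is enumerated; the constant functions show that it is infinite, which makes the
    enumeration a bijection.\<close>
  have "infinite (range (\<lambda>k::nat. (\<lambda>_::'n. k)))"
    by (rule range_inj_infinite) (auto intro!: injI simp: fun_eq_iff)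
  then have "infinite (UNIV :: ('n \<Rightarrow> nat) set)"
    by (rule infinite_super[OF subset_UNIV])
  then have e: "bij e"
    unfolding e_def by (rule bij_betw_from_nat_into[OF countableI_type])
  \<comment> \<open>Initial segments of the enumeration eventually contain any given finite set, so
    limits along finite subsets become limits of the sequence.\<close>
  have lim_e: "filterlim (\<lambda>n. e ` {..<n}) (finite_subsets_at_top UNIV) sequentially"
    unfolding filterlim_iff
  proof (intro allI impI)
    fix P :: "('n \<Rightarrow> nat) set \<Rightarrow> bool" assume "eventually P (finite_subsets_at_top UNIV)"
    then obtain X where X: "finite X" "\<And>Y. finite Y \<Longrightarrow> X \<subseteq> Y \<Longrightarrow> P Y"
      by (auto simp: eventually_finite_subsets_at_top)
    have "finite (e -` X)" using e X(1) by (intro finite_vimageI) (auto simp: bij_is_inj)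
    then obtain N where N: "\<And>i. e i \<in> X \<Longrightarrow> i < N" by (auto simp: finite_nat_set_iff_bounded)
    have "X \<subseteq> e ` {..<n}" if "n \<ge> N" for n
    proof
      fix p assume p: "p \<in> X"
      obtain i where i: "p = e i" using bij_is_surj[OF e] by (metis surjD)
      then show "p \<in> e ` {..<n}" using N[of i] p that by auto
    qed
    then show "\<forall>\<^sub>F n in sequentially. P (e ` {..<n})"
      using X(2) by (intro eventually_sequentiallyI[of N]) auto
  qed
  have sum_e: "(\<Sum>p\<in>e ` {..<n}. F p) = (\<Sum>i<n. F (e i))" for F :: "_ \<Rightarrow> complex" and n
    using e by (subst sum.reindex) (auto intro: inj_on_subset bij_is_inj)
  have ul: "uniform_limit (ball z0 \<delta>) (\<lambda>n z. \<Sum>i<n. a (e i) * dmonom j z (e i)) (pd j f) sequentially" for j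
  proof -
    have "(\<lambda>p. cmod (a p) * cmod (dmonom j w p)) summable_on UNIV"
      using pd_has_sum[OF a w(1), of j] summable_on_iff_abs_summable_on_complex[of "\<lambda>p. a p * dmonom j w p" UNIV]
      by (auto simp: norm_mult summable_on_def)
    then have "uniform_limit (ball z0 \<delta>) (\<lambda>F z. \<Sum>p\<in>F. a p * dmonom j z p) (pd j f) (finite_subsets_at_top UNIV)"
      by (rule Weierstrass_m_test_general'[rotated 2])
         (auto simp: norm_mult simp del: mem_ball intro!: mult_left_mono dmonom_mono le pd_has_sum[OF a] in_ball)
    from filterlim_compose[OF this lim_e] show ?thesis unfolding sum_e .
  qed
  have "\<exists>g. \<forall>x\<in>ball z0 \<delta>. (\<lambda>n. a (e n) * Defs.monom x (e n)) sums g x \<and>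
      (g has_derivative (\<lambda>v. \<Sum>j\<in>UNIV. pd j f x * v$j)) (at x within ball z0 \<delta>)"
  proof (rule has_derivative_series[where f' = "\<lambda>n x v. a (e n) * (\<Sum>j\<in>UNIV. dmonom j x (e n) * v$j)"])
    show "((\<lambda>x. a (e n) * Defs.monom x (e n)) has_derivative
         (\<lambda>v. a (e n) * (\<Sum>j\<in>UNIV. dmonom j x (e n) * v$j))) (at x within ball z0 \<delta>)" for n x
      by (intro derivative_intros has_derivative_monom)
  next
    fix \<epsilon> :: real assume \<epsilon>: "\<epsilon> > 0"
    \<comment> \<open>The allowed error is shared equally among the coordinates.\<close>
    define \<eta> where "\<eta> = \<epsilon> / real CARD('n)"
    have \<eta>: "\<eta> > 0" using \<epsilon> by (simp add: \<eta>_def)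
    have "\<forall>\<^sub>F n in sequentially. \<forall>j. \<forall>z\<in>ball z0 \<delta>. dist (\<Sum>i<n. a (e i) * dmonom j z (e i)) (pd j f z) < \<eta>"
      using uniform_limitD[OF ul \<eta>] by (intro eventually_all_finite)
    then show "\<forall>\<^sub>F n in sequentially. \<forall>x\<in>ball z0 \<delta>. \<forall>h.
        norm ((\<Sum>i<n. a (e i) * (\<Sum>j\<in>UNIV. dmonom j x (e i) * h$j)) - (\<Sum>j\<in>UNIV. pd j f x * h$j)) \<le> \<epsilon> * norm h"
    proof eventually_elim
      case (elim n)
      show ?case
      proof (intro ballI allI)
        fix x h :: "complex^'n" assume x: "x \<in> ball z0 \<delta>"
        have "(\<Sum>i<n. a (e i) * (\<Sum>j\<in>UNIV. dmonom j x (e i) * h$j)) =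
              (\<Sum>j\<in>UNIV. (\<Sum>i<n. a (e i) * dmonom j x (e i)) * h$j)"
          unfolding sum_distrib_left sum_distrib_right by (subst sum.swap) (simp add: mult_ac)
        then have "norm ((\<Sum>i<n. a (e i) * (\<Sum>j\<in>UNIV. dmonom j x (e i) * h$j)) - (\<Sum>j\<in>UNIV. pd j f x * h$j)) =
              norm (\<Sum>j\<in>UNIV. ((\<Sum>i<n. a (e i) * dmonom j x (e i)) - pd j f x) * h$j)"
          by (simp add: left_diff_distrib sum_subtractf)
        also have "\<dots> \<le> (\<Sum>j\<in>(UNIV::'n set). \<eta> * norm h)"
        proof (rule sum_norm_le)
          fix j
          have "cmod ((\<Sum>i<n. a (e i) * dmonom j x (e i)) - pd j f x) \<le> \<eta>"
            using elim x by (auto simp: dist_norm intro: less_imp_le)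
          then show "norm (((\<Sum>i<n. a (e i) * dmonom j x (e i)) - pd j f x) * h$j) \<le> \<eta> * norm h"
            unfolding norm_mult using \<eta> by (intro mult_mono Finite_Cartesian_Product.norm_nth_le) auto
        qed
        also have "\<dots> = \<epsilon> * norm h" by (simp add: \<eta>_def)
        finally show "norm ((\<Sum>i<n. a (e i) * (\<Sum>j\<in>UNIV. dmonom j x (e i) * h$j)) - (\<Sum>j\<in>UNIV. pd j f x * h$j)) \<le> \<epsilon> * norm h" .
      qed
    qed
  next
    have "((\<lambda>i. a (e i) * Defs.monom z0 (e i)) has_sum f z0) UNIV"
      using pseriesD[OF a z0] has_sum_reindex_bij_betw[OF e, of "\<lambda>p. a p * Defs.monom z0 p"] by simp
    then show "(\<lambda>n. a (e n) * Defs.monom z0 (e n)) sums f z0"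
      by (rule has_sum_imp_sums)
  qed (use \<delta> in auto)
  then obtain g where g: "\<And>x. x \<in> ball z0 \<delta> \<Longrightarrow> (\<lambda>n. a (e n) * Defs.monom x (e n)) sums g x"
      "\<And>x. x \<in> ball z0 \<delta> \<Longrightarrow> (g has_derivative (\<lambda>v. \<Sum>j\<in>UNIV. pd j f x * v$j)) (at x within ball z0 \<delta>)" by blast
  have gf: "g x = f x" if "x \<in> ball z0 \<delta>" for x
  proof -
    have "((\<lambda>i. a (e i) * Defs.monom x (e i)) has_sum f x) UNIV"
      using pseriesD[OF a in_ball[OF that]] has_sum_reindex_bij_betw[OF e, of "\<lambda>p. a p * Defs.monom x p"] by simp
    from has_sum_imp_sums[OF this] show ?thesis using g(1)[OF that] sums_unique2 by blast
  qed
  have z0_in: "z0 \<in> ball z0 \<delta>" using \<delta> by simp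
  have "(g has_derivative (\<lambda>v. \<Sum>j\<in>UNIV. pd j f z0 * v$j)) (at z0)"
    using g(2)[OF z0_in] by (simp only: at_within_open[OF z0_in open_ball])
  then have "(f has_derivative (\<lambda>v. \<Sum>j\<in>UNIV. pd j f z0 * v$j)) (at z0)"
    by (rule has_derivative_transform_within_open[OF _ open_ball z0_in gf])
  then show "\<exists>c. (f has_derivative (\<lambda>v. \<Sum>j\<in>UNIV. c j * v$j)) (at z0)" by (intro exI[of _ "\<lambda>j. pd j f z0"])
qed

section \<open>Rotation invariance of Lebesgue measure\<close>

text \<open>Lebesgue measure is characterised by its values on boxes, and a box of vectors is a
  product of boxes because the basis consists of the \<open>axis j b\<close>. This gives access to
  Tonelli and to invariance arguments coordinate by coordinate.\<close>

lemma lborel_vec_eq: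
  "(lborel :: ('b::euclidean_space^'n::finite) measure) = distr (PiM UNIV (\<lambda>_. lborel)) borel (\<lambda>x. \<chi> j. x j)"
proof (rule lborel_eqI)
  interpret product_sigma_finite "\<lambda>_::'n. lborel :: 'b measure" ..
  fix l u :: "'b^'n" assume lu: "\<And>b. b \<in> Basis \<Longrightarrow> l \<bullet> b \<le> u \<bullet> b"
  have le: "l$j \<bullet> b \<le> u$j \<bullet> b" if "b \<in> Basis" for j b
    using lu[of "axis j b"] that by (simp add: inner_axis axis_in_Basis_iff)
  have meas: "(\<lambda>x. \<chi> j. x j) \<in> measurable (PiM UNIV (\<lambda>_::'n. lborel :: 'b measure)) borel"
    by (intro borel_measurable_vec_lambda) (simp cong: measurable_cong_sets)
  have "(\<lambda>x. \<chi> j. x j) -` box l u \<inter> space (PiM UNIV (\<lambda>_. lborel)) = PiE UNIV (\<lambda>j. box (l$j) (u$j))"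
    by (auto simp: mem_box Basis_vec_def inner_axis space_PiM PiE_UNIV_domain Pi_iff)
  then have "emeasure (distr (PiM UNIV (\<lambda>_. lborel)) borel (\<lambda>x. \<chi> j. x j)) (box l u) =
      (\<Prod>j\<in>UNIV. emeasure lborel (box (l$j) (u$j)))"
    using meas by (simp add: emeasure_distr emeasure_PiM)
  also have "\<dots> = (\<Prod>j\<in>UNIV. ennreal (\<Prod>b\<in>Basis. (u$j - l$j) \<bullet> b))"
    using le by (simp add: emeasure_lborel_box)
  also have "\<dots> = ennreal (\<Prod>j\<in>UNIV. \<Prod>b\<in>Basis. (u$j - l$j) \<bullet> b)"
    using le by (intro prod_ennreal prod_nonneg) (auto simp: inner_diff_left)
  also have "(\<Prod>j\<in>UNIV. \<Prod>b\<in>Basis. (u$j - l$j) \<bullet> b) = (\<Prod>(j,b)\<in>UNIV \<times> Basis. (u$j - l$j) \<bullet> b)"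
    by (rule prod.cartesian_product)
  also have "\<dots> = (\<Prod>b\<in>(\<lambda>(j,b). axis j b) ` (UNIV \<times> Basis). (u - l) \<bullet> b)"
    by (subst prod.reindex) (auto simp: inj_on_def axis_eq_axis inner_axis nonzero_Basis intro!: prod.cong)
  also have "(\<lambda>(j,b). axis j b) ` (UNIV \<times> Basis) = (Basis :: ('b^'n) set)"
    by (auto simp: Basis_vec_def)
  finally show "emeasure (distr (PiM UNIV (\<lambda>_. lborel)) borel (\<lambda>x. \<chi> j. x j)) (box l u) =
      ennreal (\<Prod>b\<in>Basis. (u - l) \<bullet> b)" .
qed simp

lemma nn_integral_lborel_vec:
  assumes "h \<in> borel_measurable borel"
  shows "(\<integral>\<^sup>+z. h z \<partial>(lborel :: ('b::euclidean_space^'n::finite) measure)) =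
         (\<integral>\<^sup>+x. h (\<chi> j. x j) \<partial>PiM UNIV (\<lambda>_. lborel))"
proof -
  have meas: "(\<lambda>x. \<chi> j. x j) \<in> measurable (PiM UNIV (\<lambda>_::'n. lborel :: 'b measure)) borel"
    by (intro borel_measurable_vec_lambda) (simp cong: measurable_cong_sets)
  show ?thesis
    by (subst lborel_vec_eq) (rule nn_integral_distr[OF meas], use assms in simp)
qed

section \<open>Rotations of the plane and of the torus orbits\<close>

lemma lborel_complex_eq: "lborel = distr (lborel \<Otimes>\<^sub>M lborel) borel (\<lambda>(x, y). Complex x y)"
proof (rule lborel_eqI)
  fix l u :: complex assume lu: "\<And>b. b \<in> Basis \<Longrightarrow> l \<bullet> b \<le> u \<bullet> b"
  have le: "Re l \<le> Re u" "Im l \<le> Im u"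
    using lu[of 1] lu[of \<i>] by (auto simp: Basis_complex_def)
  have meas: "(\<lambda>(x, y). Complex x y) \<in> measurable (lborel \<Otimes>\<^sub>M lborel) borel"
    unfolding Complex_eq by measurable
  have "(\<lambda>(x, y). Complex x y) -` box l u \<inter> space (lborel \<Otimes>\<^sub>M lborel) = box (Re l) (Re u) \<times> box (Im l) (Im u)"
    by (auto simp: mem_box Basis_complex_def space_pair_measure)
  then have "emeasure (distr (lborel \<Otimes>\<^sub>M lborel) borel (\<lambda>(x, y). Complex x y)) (box l u) =
      emeasure lborel (box (Re l) (Re u)) * emeasure lborel (box (Im l) (Im u))"
    using meas by (simp add: emeasure_distr lborel.emeasure_pair_measure_Times)
  also have "\<dots> = ennreal ((Re u - Re l) * (Im u - Im l))"
    using le by (simp add: ennreal_mult)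
  also have "(Re u - Re l) * (Im u - Im l) = (\<Prod>b\<in>Basis. (u - l) \<bullet> b)"
    by (simp add: Basis_complex_def)
  finally show "emeasure (distr (lborel \<Otimes>\<^sub>M lborel) borel (\<lambda>(x, y). Complex x y)) (box l u) =
      ennreal (\<Prod>b\<in>Basis. (u - l) \<bullet> b)" .
qed simp

lemma nn_integral_lborel_complex:
  assumes h: "h \<in> borel_measurable borel"
  shows "(\<integral>\<^sup>+z. h z \<partial>lborel) = (\<integral>\<^sup>+y. \<integral>\<^sup>+x. h (Complex x y) \<partial>lborel \<partial>lborel)"
    and "(\<integral>\<^sup>+z. h z \<partial>lborel) = (\<integral>\<^sup>+x. \<integral>\<^sup>+y. h (Complex x y) \<partial>lborel \<partial>lborel)"
proof -
  have meas: "(\<lambda>(x, y). Complex x y) \<in> measurable (lborel \<Otimes>\<^sub>M lborel) borel"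
    unfolding Complex_eq by measurable
  have hm: "(\<lambda>(x, y). h (Complex x y)) \<in> borel_measurable (lborel \<Otimes>\<^sub>M lborel)"
    using measurable_compose[OF meas h] by (simp add: case_prod_unfold)
  have "(\<integral>\<^sup>+z. h z \<partial>lborel) = (\<integral>\<^sup>+z. h (case z of (x, y) \<Rightarrow> Complex x y) \<partial>(lborel \<Otimes>\<^sub>M lborel))"
    by (subst lborel_complex_eq) (rule nn_integral_distr[OF meas], use h in simp)
  then have *: "(\<integral>\<^sup>+z. h z \<partial>lborel) = (\<integral>\<^sup>+z. (case z of (x, y) \<Rightarrow> h (Complex x y)) \<partial>(lborel \<Otimes>\<^sub>M lborel))"
    by (simp add: case_prod_unfold)
  show "(\<integral>\<^sup>+z. h z \<partial>lborel) = (\<integral>\<^sup>+x. \<integral>\<^sup>+y. h (Complex x y) \<partial>lborel \<partial>lborel)"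
    unfolding * by (subst lborel.nn_integral_fst[OF hm, symmetric]) simp
  show "(\<integral>\<^sup>+z. h z \<partial>lborel) = (\<integral>\<^sup>+y. \<integral>\<^sup>+x. h (Complex x y) \<partial>lborel \<partial>lborel)"
    unfolding * by (subst lborel_pair.nn_integral_snd[OF hm, symmetric]) simp
qed

text \<open>Tonelli with the moving variable innermost: for a fixed value of the other coordinate a
  shear is a translation.\<close>

lemma nn_integral_shear:
  assumes h: "h \<in> borel_measurable borel"
  shows "(\<integral>\<^sup>+z. h (Complex (Re z + a * Im z) (Im z)) \<partial>lborel) = (\<integral>\<^sup>+z. h z \<partial>lborel)"
    and "(\<integral>\<^sup>+z. h (Complex (Re z) (Im z + a * Re z)) \<partial>lborel) = (\<integral>\<^sup>+z. h z \<partial>lborel)"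
proof -
  have 1: "(\<lambda>z. h (Complex (Re z + a * Im z) (Im z))) \<in> borel_measurable borel"
    by (rule measurable_compose[OF _ h]) (simp add: Complex_eq)
  have 2: "(\<lambda>z. h (Complex (Re z) (Im z + a * Re z))) \<in> borel_measurable borel"
    by (rule measurable_compose[OF _ h]) (simp add: Complex_eq)
  have 3: "(\<lambda>x. h (Complex x y)) \<in> borel_measurable borel" for y
    by (rule measurable_compose[OF _ h]) (simp add: Complex_eq)
  have 4: "(\<lambda>y. h (Complex x y)) \<in> borel_measurable borel" for x
    by (rule measurable_compose[OF _ h]) (simp add: Complex_eq)
  show "(\<integral>\<^sup>+z. h (Complex (Re z + a * Im z) (Im z)) \<partial>lborel) = (\<integral>\<^sup>+z. h z \<partial>lborel)"
    unfolding nn_integral_lborel_complex(1)[OF 1] nn_integral_lborel_complex(1)[OF h]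
  proof (rule nn_integral_cong)
    fix y
    show "(\<integral>\<^sup>+x. h (Complex (Re (Complex x y) + a * Im (Complex x y)) (Im (Complex x y))) \<partial>lborel) =
          (\<integral>\<^sup>+x. h (Complex x y) \<partial>lborel)"
      using nn_integral_real_affine[OF 3, of 1 y "a * y"] by (simp add: add.commute)
  qed
  show "(\<integral>\<^sup>+z. h (Complex (Re z) (Im z + a * Re z)) \<partial>lborel) = (\<integral>\<^sup>+z. h z \<partial>lborel)"
    unfolding nn_integral_lborel_complex(2)[OF 2] nn_integral_lborel_complex(2)[OF h]
  proof (rule nn_integral_cong)
    fix x
    show "(\<integral>\<^sup>+y. h (Complex (Re (Complex x y)) (Im (Complex x y) + a * Re (Complex x y))) \<partial>lborel) =
          (\<integral>\<^sup>+y. h (Complex x y) \<partial>lborel)"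
      using nn_integral_real_affine[OF 4, of 1 x "a * x"] by (simp add: add.commute)
  qed
qed

text \<open>A rotation whose sine does not vanish is a product of three shears.\<close>

lemma nn_integral_lborel_rotate:
  assumes c: "cmod c = 1" and h: "h \<in> borel_measurable borel"
  shows "(\<integral>\<^sup>+z. h (c * z) \<partial>lborel) = (\<integral>\<^sup>+z. h z \<partial>lborel)"
proof -
  have main: "(\<integral>\<^sup>+z. h (c * z) \<partial>lborel) = (\<integral>\<^sup>+z. h z \<partial>lborel)"
    if c: "cmod c = 1" and s: "Im c \<noteq> 0" and h: "h \<in> borel_measurable borel" for c and h :: "complex \<Rightarrow> ennreal"
  proof -
    \<comment> \<open>For \<open>c = cis \<theta>\<close> this is -tan(\<theta>/2); shears with
      slopes \<open>a\<close>, \<open>Im c\<close>, \<open>a\<close> compose to multiplication by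
      \<open>c\<close>.\<close>
    define a where "a = (Re c - 1) / Im c"
    define X where "X z = Complex (Re z + a * Im z) (Im z)" for z
    define Y where "Y z = Complex (Re z) (Im z + Im c * Re z)" for z
    have [measurable]: "X \<in> borel_measurable borel" "Y \<in> borel_measurable borel"
      unfolding X_def Y_def Complex_eq by measurable
    have "(Re c)\<^sup>2 + (Im c)\<^sup>2 = 1" using c by (metis cmod_power2 one_power2)
    then have "(Re c - 1) * (Re c + 1) = - (Im c * Im c)" by (simp add: power2_eq_square algebra_simps)
    then have A: "a * (Re c + 1) = - Im c" using s by (simp add: a_def field_simps)
    have B: "1 + a * Im c = Re c" using s by (simp add: a_def)
    have cz: "c * z = X (Y (X z))" for z
    proof (rule complex_eqI)
      have "Re (X (Y (X z))) = (1 + a * Im c) * Re z + a * ((1 + a * Im c) + 1) * Im z"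
        by (simp add: X_def Y_def algebra_simps)
      then show "Re (c * z) = Re (X (Y (X z)))" unfolding B A by simp
      have "Im (X (Y (X z))) = Im c * Re z + (1 + a * Im c) * Im z"
        by (simp add: X_def Y_def algebra_simps)
      then show "Im (c * z) = Im (X (Y (X z)))" unfolding B by simp
    qed
    have 1: "(\<lambda>z. h (X z)) \<in> borel_measurable borel" "(\<lambda>z. h (X (Y z))) \<in> borel_measurable borel"
      using h by measurable
    have "(\<integral>\<^sup>+z. h (c * z) \<partial>lborel) = (\<integral>\<^sup>+z. h (X (Y z)) \<partial>lborel)"
      unfolding cz using nn_integral_shear(1)[OF 1(2), of a] by (simp add: X_def)
    also have "\<dots> = (\<integral>\<^sup>+z. h (X z) \<partial>lborel)"
      using nn_integral_shear(2)[OF 1(1), of "Im c"] by (simp add: Y_def)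
    also have "\<dots> = (\<integral>\<^sup>+z. h z \<partial>lborel)"
      using nn_integral_shear(1)[OF h, of a] by (simp add: X_def)
    finally show ?thesis .
  qed
  show ?thesis
  proof (cases "Im c = 0")
    case False
    then show ?thesis using main c h by blast
  next
    case True
    with c have "Re c = 1 \<or> Re c = -1" by (simp add: cmod_def abs_if split: if_splits)
    \<comment> \<open>The half turn has vanishing sine and is done as two quarter turns, each
      covered by \<open>main\<close>.\<close>
    then consider "c = 1" | "c = \<i> * \<i>" using True by (auto simp: complex_eq_iff)
    then show ?thesis
    proof cases
      case 2
      have hi: "(\<lambda>z. h (\<i> * z)) \<in> borel_measurable borel" using h by measurable
      have "(\<integral>\<^sup>+z. h (c * z) \<partial>lborel) = (\<integral>\<^sup>+z. h (\<i> * (\<i> * z)) \<partial>lborel)" by (simp add: 2)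
      also have "\<dots> = (\<integral>\<^sup>+z. h (\<i> * z) \<partial>lborel)" using main[OF _ _ hi, of \<i>] by simp
      also have "\<dots> = (\<integral>\<^sup>+z. h z \<partial>lborel)" using main[OF _ _ h, of \<i>] by simp
      finally show ?thesis .
    qed simp
  qed
qed

lemma distr_lborel_rotate:
  assumes "cmod c = 1"
  shows "distr lborel borel ((*) c) = (lborel :: complex measure)"
proof (rule measure_eqI)
  fix A :: "complex set" assume "A \<in> sets (distr lborel borel ((*) c))"
  then have A: "A \<in> sets borel" by simp
  have "emeasure (distr lborel borel ((*) c)) A = (\<integral>\<^sup>+z. indicator A z \<partial>distr lborel borel ((*) c))"
    using A by simp
  also have "\<dots> = (\<integral>\<^sup>+z. indicator A (c * z) \<partial>lborel)"
    using A by (intro nn_integral_distr) simp_all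
  also have "\<dots> = emeasure lborel A"
    using A by (subst nn_integral_lborel_rotate[OF assms]) auto
  finally show "emeasure (distr lborel borel ((*) c)) A = emeasure lborel A" .
qed simp

lemma borel_measurable_rot: "rot t \<in> borel_measurable borel"
  unfolding rot_def[abs_def] by (intro borel_measurable_continuous_onI continuous_intros)

text \<open>Each coordinate is rotated in its own factor, so the product measure is preserved: on
  measurable rectangles this is \<open>distr_lborel_rotate\<close>, factor by factor.\<close>

lemma nn_integral_rot:
  fixes h :: "complex^'n::finite \<Rightarrow> ennreal"
  assumes h: "h \<in> borel_measurable borel"
  shows "(\<integral>\<^sup>+z. h (rot t z) \<partial>lborel) = (\<integral>\<^sup>+z. h z \<partial>lborel)"
proof -
  interpret product_sigma_finite "\<lambda>_::'n. lborel :: complex measure" ..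
  let ?P = "PiM UNIV (\<lambda>_::'n. lborel :: complex measure)"
  let ?T = "\<lambda>x j. expi (t j) * x j"
  have T: "?T \<in> measurable ?P ?P"
    by (rule measurable_PiM_single') (auto simp: space_PiM cong: measurable_cong_sets)
  have "distr ?P ?P ?T = ?P"
  proof (rule PiM_eqI)
    fix A :: "'n \<Rightarrow> complex set" assume A: "\<And>i. i \<in> UNIV \<Longrightarrow> A i \<in> sets lborel"
    have "?T -` PiE UNIV A \<inter> space ?P = PiE UNIV (\<lambda>j. (*) (expi (t j)) -` A j)"
      by (auto simp: space_PiM PiE_UNIV_domain)
    moreover have meas: "(*) (expi (t j)) -` A j \<in> sets borel" for j
      using measurable_sets[of "(*) (expi (t j))" borel borel "A j"] A by simp
    moreover have "emeasure lborel ((*) (expi (t j)) -` A j) = emeasure lborel (A j)" for j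
      using emeasure_distr[of "(*) (expi (t j))" lborel borel "A j"] A
      by (simp add: distr_lborel_rotate)
    ultimately show "emeasure (distr ?P ?P ?T) (PiE UNIV A) = (\<Prod>i\<in>UNIV. emeasure lborel (A i))"
      using T A by (simp add: emeasure_distr emeasure_PiM sets_PiM_I_finite)
  qed auto
  moreover have hv: "(\<lambda>x. h (\<chi> j. x j)) \<in> borel_measurable ?P"
    by (rule measurable_compose[OF _ h], rule borel_measurable_vec_lambda) (simp cong: measurable_cong_sets)
  ultimately have "(\<integral>\<^sup>+x. h (\<chi> j. x j) \<partial>?P) = (\<integral>\<^sup>+x. h (\<chi> j. ?T x j) \<partial>?P)"
    using nn_integral_distr[OF T, of "\<lambda>x. h (\<chi> j. x j)"] by simp
  moreover have "(\<lambda>z. h (rot t z)) \<in> borel_measurable borel"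
    by (rule measurable_compose[OF borel_measurable_rot h])
  ultimately show ?thesis
    using h by (simp add: nn_integral_lborel_vec rot_def)
qed

text \<open>Every rotation leaves the integral unchanged and the torus has mass 1; Tonelli then
  brings the torus integral inside.\<close>

lemma nn_integral_torus_average:
  fixes h :: "complex^'n::finite \<Rightarrow> ennreal"
  assumes h: "h \<in> borel_measurable borel"
  shows "(\<integral>\<^sup>+z. h z \<partial>lborel) = (\<integral>\<^sup>+z. \<integral>\<^sup>+t. h (rot t z) \<partial>torus \<partial>lborel)"
proof -
  interpret T: prob_space "torus :: ('n \<Rightarrow> real) measure" by (rule prob_space_torus)
  interpret pair_sigma_finite "torus :: ('n \<Rightarrow> real) measure" "lborel :: (complex^'n) measure" ..
  have nth: "(\<lambda>z::complex^'n. z$j) \<in> borel_measurable borel" for j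
    by (intro borel_measurable_continuous_onI continuous_intros)
  have "(\<lambda>x. expi (fst x j) * snd x $ j) \<in> borel_measurable (torus \<Otimes>\<^sub>M (lborel :: (complex^'n) measure))" for j
    by (intro borel_measurable_times measurable_compose[OF measurable_fst] measurable_compose[OF measurable_snd]
          measurable_compose[OF measurable_torus_component borel_measurable_expi]) (simp add: nth)
  then have "(\<lambda>x. rot (fst x) (snd x)) \<in> borel_measurable (torus \<Otimes>\<^sub>M (lborel :: (complex^'n) measure))"
    unfolding rot_def by (rule borel_measurable_vec_lambda)
  then have m: "(\<lambda>(t, z). h (rot t z)) \<in> borel_measurable (torus \<Otimes>\<^sub>M (lborel :: (complex^'n) measure))"
    unfolding case_prod_unfold by (rule measurable_compose[OF _ h])
  have "(\<integral>\<^sup>+z. h z \<partial>lborel) = (\<integral>\<^sup>+t. (\<integral>\<^sup>+z. h z \<partial>lborel) \<partial>(torus :: ('n \<Rightarrow> real) measure))"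
    using T.emeasure_space_1 by simp
  also have "\<dots> = (\<integral>\<^sup>+t. (\<integral>\<^sup>+z. h (rot t z) \<partial>lborel) \<partial>torus)"
    by (simp only: nn_integral_rot[OF h])
  also have "\<dots> = (\<integral>\<^sup>+z. \<integral>\<^sup>+t. h (rot t z) \<partial>torus \<partial>lborel)"
    using Fubini'[OF m] by simp
  finally show ?thesis .
qed

section \<open>The Bergman norm in coefficients\<close>

text \<open>The disc of squared radius \<open>t\<close> has area \<open>pi * t\<close>, so the
  squared modulus carries planar Lebesgue measure to \<open>pi\<close> times Lebesgue measure on the
  half-line.\<close>

lemma nn_integral_lborel_radial:
  fixes \<psi> :: "real \<Rightarrow> ennreal"
  assumes \<psi>: "\<psi> \<in> borel_measurable borel"
  shows "(\<integral>\<^sup>+z. \<psi> ((cmod z)\<^sup>2) \<partial>lborel) = ennreal pi * (\<integral>\<^sup>+t. \<psi> t * indicator {0..} t \<partial>lborel)"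
proof -
  \<comment> \<open>The sign is flipped because the measures are compared on rays
    \<open>{x<..}\<close>, which must have finite mass: the preimage of such a ray is then a disc
    and not the complement of one.\<close>
  define M where "M = distr lborel borel (\<lambda>z::complex. - (cmod z)\<^sup>2)"
  define D :: "real measure" where "D = density lborel (\<lambda>t. ennreal pi * indicator {0..} t)"
  define N where "N = distr D borel (uminus :: real \<Rightarrow> real)"
  have M: "emeasure M {x<..} = ennreal (pi * max 0 (- x))" for x
  proof -
    have "emeasure M {x<..} = emeasure lborel ((\<lambda>z::complex. - (cmod z)\<^sup>2) -` {x<..})"
      unfolding M_def by (subst emeasure_distr) auto
    also have "(\<lambda>z::complex. - (cmod z)\<^sup>2) -` {x<..} = (if x < 0 then ball 0 (sqrt (- x)) else {})"
    proof (cases "x < 0")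
      case True
      have "x < - (cmod z)\<^sup>2 \<longleftrightarrow> cmod z < sqrt (- x)" for z
        using True real_less_rsqrt[of "cmod z" "- x"] real_sqrt_less_iff[of "(cmod z)\<^sup>2" "- x"] by auto
      then show ?thesis using True by auto
    next
      case False
      then have "\<not> x < - (cmod z)\<^sup>2" for z by (simp add: not_less) (smt (verit) zero_le_power2)
      then show ?thesis using False by auto
    qed
    also have "emeasure lborel \<dots> = ennreal (pi * max 0 (- x))"
      by (auto simp: emeasure_ball eval_unit_ball_vol max_def)
    finally show ?thesis .
  qed
  have N: "emeasure N {x<..} = ennreal (pi * max 0 (- x))" for x
  proof -
    have "emeasure N {x<..} = emeasure D {..<-x}"
      unfolding N_def by (subst emeasure_distr) (auto simp: D_def intro!: arg_cong2[where f = emeasure])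
    also have "\<dots> = (\<integral>\<^sup>+t. ennreal pi * indicator {0..<-x} t \<partial>lborel)"
      unfolding D_def by (subst emeasure_density) (auto intro!: nn_integral_cong simp: indicator_def)
    also have "\<dots> = ennreal (pi * max 0 (- x))"
      by (simp add: nn_integral_cmult_indicator ennreal_mult max_def)
    finally show ?thesis .
  qed
  have "M = N"
    by (rule measure_eqI_lessThan) (auto simp: M N, auto simp: M_def N_def)
  have "(\<integral>\<^sup>+z. \<psi> ((cmod z)\<^sup>2) \<partial>lborel) = (\<integral>\<^sup>+s. \<psi> (- s) \<partial>M)"
    unfolding M_def using \<psi> by (subst nn_integral_distr) auto
  also have "\<dots> = (\<integral>\<^sup>+t. \<psi> t \<partial>D)"
    unfolding \<open>M = N\<close> N_def using \<psi> by (subst nn_integral_distr) (auto simp: D_def)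
  also have "\<dots> = (\<integral>\<^sup>+t. ennreal pi * (\<psi> t * indicator {0..} t) \<partial>lborel)"
    unfolding D_def using \<psi> by (subst nn_integral_density) (auto simp: mult_ac)
  also have "\<dots> = ennreal pi * (\<integral>\<^sup>+t. \<psi> t * indicator {0..} t \<partial>lborel)"
    using \<psi> by (intro nn_integral_cmult) auto
  finally show ?thesis .
qed

section \<open>The Dirichlet integral\<close>

text \<open>Vanishing for \<open>x \<le> 0\<close> absorbs the indicator of the ball: integrals run
  over the full space, and formulas stay valid when a remainder such as
  \<open>s - (cmod y)\<^sup>2\<close> is negative.\<close>

definition ppow :: "real \<Rightarrow> real \<Rightarrow> real" where
  "ppow \<beta> x = (if x > 0 then x powr \<beta> else 0)"

lemma ppow_nonneg: "ppow \<beta> x \<ge> 0"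
  by (simp add: ppow_def)

lemma borel_measurable_ppow [measurable]: "ppow \<beta> \<in> borel_measurable borel"
  unfolding ppow_def[abs_def] by measurable

text \<open>The Beta integral, rescaled from [0,1] to [0,s]. The result is again a multiple of
  \<open>ppow\<close>, with exponent raised by \<open>Suc p\<close>, so coordinates can be
  integrated out one after another.\<close>

lemma nn_integral_beta:
  assumes \<gamma>: "\<gamma> > -1"
  shows "(\<integral>\<^sup>+t. ennreal (t ^ p * ppow \<gamma> (s - t)) * indicator {0..} t \<partial>lborel) =
         ennreal (fact p * Gamma (\<gamma> + 1) / Gamma (\<gamma> + 1 + real (Suc p)) * ppow (\<gamma> + real (Suc p)) s)"
proof (cases "s > 0")
  case False
  then have "(\<integral>\<^sup>+t. ennreal (t ^ p * ppow \<gamma> (s - t)) * indicator {0..} t \<partial>lborel) = (\<integral>\<^sup>+t. 0 \<partial>(lborel :: real measure))"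
    by (intro nn_integral_cong) (auto simp: ppow_def indicator_def)
  then show ?thesis using False by (simp add: ppow_def)
next
  case s: True
  have B: "Beta (real p + 1) (\<gamma> + 1) = fact p * Gamma (\<gamma> + 1) / Gamma (\<gamma> + 1 + real (Suc p))"
    using Gamma_fact[of p, where 'a = real] by (simp add: Beta_def add_ac)
  have "((\<lambda>t. t powr (real p + 1 - 1) * (1 - t) powr (\<gamma> + 1 - 1)) has_integral Beta (real p + 1) (\<gamma> + 1)) {0..1}"
    using \<gamma> by (intro has_integral_Beta_real) auto
  then have "((\<lambda>t. t powr real p * (1 - t) powr \<gamma>) has_integral Beta (real p + 1) (\<gamma> + 1)) {0<..<1}"
    by (simp add: has_integral_Icc_iff_Ioo)
  then have "(\<integral>\<^sup>+t. ennreal (t powr real p * (1 - t) powr \<gamma>) * indicator {0<..<1} t \<partial>lborel) =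
      ennreal (Beta (real p + 1) (\<gamma> + 1))"
    by (intro nn_integral_has_integral_lebesgue') auto
  also have "(\<integral>\<^sup>+t. ennreal (t powr real p * (1 - t) powr \<gamma>) * indicator {0<..<1} t \<partial>lborel) =
      (\<integral>\<^sup>+t. ennreal (t ^ p * ppow \<gamma> (1 - t)) * indicator {0..} t \<partial>lborel)"
  proof (rule nn_integral_cong_AE)
    \<comment> \<open>At \<open>t = 0\<close> the open interval gives 0 on the left, while for
      \<open>p = 0\<close> the right-hand side is 1 there.\<close>
    have "AE t::real in lborel. t \<noteq> 0" by (rule AE_lborel_singleton)
    then show "AE t::real in lborel. ennreal (t powr real p * (1 - t) powr \<gamma>) * indicator {0<..<1} t =
        ennreal (t ^ p * ppow \<gamma> (1 - t)) * indicator {0..} t"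
      by eventually_elim (auto simp: ppow_def indicator_def powr_realpow)
  qed
  finally have 1: "(\<integral>\<^sup>+t. ennreal (t ^ p * ppow \<gamma> (1 - t)) * indicator {0..} t \<partial>lborel) =
      ennreal (Beta (real p + 1) (\<gamma> + 1))" .
  have sc: "ppow \<gamma> (s - s * t) = s powr \<gamma> * ppow \<gamma> (1 - t)" for t
  proof -
    have "s - s * t = s * (1 - t)" by (simp add: algebra_simps)
    then show ?thesis using s by (auto simp: ppow_def powr_mult zero_less_mult_iff)
  qed
  have "(\<integral>\<^sup>+t. ennreal (t ^ p * ppow \<gamma> (s - t)) * indicator {0..} t \<partial>lborel) =
      ennreal s * (\<integral>\<^sup>+t. ennreal ((s * t) ^ p * ppow \<gamma> (s - s * t)) * indicator {0..} (s * t) \<partial>lborel)"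
    using s by (subst nn_integral_real_affine[where c = s and t = 0]) auto
  also have "(\<integral>\<^sup>+t. ennreal ((s * t) ^ p * ppow \<gamma> (s - s * t)) * indicator {0..} (s * t) \<partial>lborel) =
      (\<integral>\<^sup>+t. ennreal (s ^ p * s powr \<gamma>) * (ennreal (t ^ p * ppow \<gamma> (1 - t)) * indicator {0..} t) \<partial>lborel)"
    unfolding sc using s by (intro nn_integral_cong)
      (auto simp: indicator_def zero_le_mult_iff power_mult_distrib ppow_nonneg mult_ac simp flip: ennreal_mult)
  also have "\<dots> = ennreal (s ^ p * s powr \<gamma>) * ennreal (Beta (real p + 1) (\<gamma> + 1))"
    by (subst nn_integral_cmult) (auto simp: 1)
  also have "ennreal s * (ennreal (s ^ p * s powr \<gamma>) * ennreal (Beta (real p + 1) (\<gamma> + 1))) =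
      ennreal (s * (s ^ p * s powr \<gamma>) * Beta (real p + 1) (\<gamma> + 1))"
  proof -
    have "Beta (real p + 1) (\<gamma> + 1) \<ge> 0"
      unfolding B using \<gamma> by (intro divide_nonneg_nonneg mult_nonneg_nonneg Gamma_real_nonneg) auto
    then show ?thesis using s by (simp add: ennreal_mult mult.assoc)
  qed
  also have "s * (s ^ p * s powr \<gamma>) = ppow (\<gamma> + real (Suc p)) s"
  proof -
    have "s * s ^ p = s powr real (Suc p)" using s by (subst powr_realpow) auto
    then have "s * (s ^ p * s powr \<gamma>) = s powr (real (Suc p) + \<gamma>)"
      by (simp only: powr_add mult.assoc[symmetric])
    then show ?thesis using s by (simp only: ppow_def add.commute if_True)
  qed
  finally show ?thesis unfolding B by (simp add: mult.commute)
qed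

text \<open>With \<open>s\<close> left general the induction closes: integrating out
  \<open>J\<close> leaves a power of the same shape in the remaining modulus. Each coordinate
  contributes \<open>pi * fact (p j)\<close>, and the Gamma quotients telescope.\<close>

lemma dirichlet_integral:
  fixes p :: "'n \<Rightarrow> nat"
  assumes J: "finite J" and \<beta>: "\<beta> > -1"
  shows "(\<integral>\<^sup>+x. ennreal ((\<Prod>j\<in>J. cmod (x j) ^ (2 * p j)) * ppow \<beta> (s - (\<Sum>j\<in>J. (cmod (x j))\<^sup>2)))
            \<partial>PiM J (\<lambda>_. lborel)) =
         ennreal (pi ^ card J * (\<Prod>j\<in>J. fact (p j)) * Gamma (\<beta> + 1) / Gamma (\<beta> + 1 + (\<Sum>j\<in>J. real (Suc (p j))))
            * ppow (\<beta> + (\<Sum>j\<in>J. real (Suc (p j)))) s)"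
  using J
proof (induction J arbitrary: s)
  case empty
  have "\<beta> + 1 > 0" using \<beta> by simp
  from Gamma_real_pos[OF this] have "Gamma (\<beta> + 1) \<noteq> 0" by simp
  then show ?case by (simp add: PiM_empty nn_integral_count_space_finite)
next
  case (insert i J)
  interpret product_sigma_finite "\<lambda>_::'n. lborel :: complex measure" ..
  let ?P = "\<lambda>J. PiM J (\<lambda>_::'n. lborel :: complex measure)"
  \<comment> \<open>The exponent left after integrating over \<open>J\<close>; it stays above -1, as
    the Beta integral requires.\<close>
  define \<gamma> where "\<gamma> = \<beta> + (\<Sum>j\<in>J. real (Suc (p j)))"
  have \<gamma>: "\<gamma> > -1" unfolding \<gamma>_def using \<beta> by (intro less_le_trans[OF \<beta>]) (simp add: sum_nonneg)
  define C where "C = pi ^ card J * (\<Prod>j\<in>J. fact (p j)) * Gamma (\<beta> + 1) / Gamma (\<gamma> + 1)"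
  have C0: "C \<ge> 0"
    unfolding C_def using \<beta> \<gamma> by (intro divide_nonneg_nonneg mult_nonneg_nonneg prod_nonneg Gamma_real_nonneg) auto
  have comp: "(\<lambda>x. cmod (x j)) \<in> borel_measurable (?P K)" if "j \<in> K" for j K
    using measurable_compose[OF measurable_component_singleton[OF that, of "\<lambda>_. lborel :: complex measure"], of cmod borel]
    by simp
  define F where "F x = ennreal ((\<Prod>j\<in>insert i J. cmod (x j) ^ (2 * p j)) * ppow \<beta> (s - (\<Sum>j\<in>insert i J. (cmod (x j))\<^sup>2)))" for x
  have "(\<lambda>x. \<Sum>j\<in>insert i J. (cmod (x j))\<^sup>2) \<in> borel_measurable (?P (insert i J))"
    by (intro borel_measurable_sum borel_measurable_power comp)
  moreover have "(\<lambda>x. \<Prod>j\<in>insert i J. cmod (x j) ^ (2 * p j)) \<in> borel_measurable (?P (insert i J))"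
    by (intro borel_measurable_prod borel_measurable_power comp)
  ultimately have F_meas: "F \<in> borel_measurable (?P (insert i J))"
    unfolding F_def by measurable
  have F_eq: "F (x(i := y)) = ennreal (cmod y ^ (2 * p i)) *
      ennreal ((\<Prod>j\<in>J. cmod (x j) ^ (2 * p j)) * ppow \<beta> ((s - (cmod y)\<^sup>2) - (\<Sum>j\<in>J. (cmod (x j))\<^sup>2)))" for x y
  proof -
    have "(\<Prod>j\<in>J. cmod ((x(i := y)) j) ^ (2 * p j)) = (\<Prod>j\<in>J. cmod (x j) ^ (2 * p j))"
      "(\<Sum>j\<in>J. (cmod ((x(i := y)) j))\<^sup>2) = (\<Sum>j\<in>J. (cmod (x j))\<^sup>2)"
      using insert.hyps by (auto intro!: prod.cong sum.cong)
    then show ?thesis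
      using insert.hyps by (simp add: F_def ennreal_mult ppow_nonneg prod_nonneg mult.assoc diff_diff_eq)
  qed
  have F_meas': "(\<lambda>x. (\<Prod>j\<in>J. cmod (x j) ^ (2 * p j)) * ppow \<beta> (r - (\<Sum>j\<in>J. (cmod (x j))\<^sup>2))) \<in> borel_measurable (?P J)" for r
  proof -
    have "(\<lambda>x. \<Sum>j\<in>J. (cmod (x j))\<^sup>2) \<in> borel_measurable (?P J)"
      by (intro borel_measurable_sum borel_measurable_power comp)
    moreover have "(\<lambda>x. \<Prod>j\<in>J. cmod (x j) ^ (2 * p j)) \<in> borel_measurable (?P J)"
      by (intro borel_measurable_prod borel_measurable_power comp)
    ultimately show ?thesis by measurable
  qed
  \<comment> \<open>Coordinate \<open>i\<close> is integrated last, so the inner integral is the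
    induction hypothesis at \<open>s - (cmod y)\<^sup>2\<close>.\<close>
  have "(\<integral>\<^sup>+x. F x \<partial>?P (insert i J)) = (\<integral>\<^sup>+y. \<integral>\<^sup>+x. F (x(i := y)) \<partial>?P J \<partial>lborel)"
    by (rule product_nn_integral_insert_rev[OF insert.hyps F_meas])
  also have "\<dots> = (\<integral>\<^sup>+y. ennreal C * ennreal (((cmod y)\<^sup>2) ^ p i * ppow \<gamma> (s - (cmod y)\<^sup>2)) \<partial>lborel)"
  proof (rule nn_integral_cong)
    fix y :: complex
    have "(\<integral>\<^sup>+x. F (x(i := y)) \<partial>?P J) = ennreal (cmod y ^ (2 * p i)) * ennreal (C * ppow \<gamma> (s - (cmod y)\<^sup>2))"
      unfolding F_eq using F_meas'
      by (subst nn_integral_cmult) (auto simp: insert.IH C_def \<gamma>_def add_ac)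
    then show "(\<integral>\<^sup>+x. F (x(i := y)) \<partial>?P J) = ennreal C * ennreal (((cmod y)\<^sup>2) ^ p i * ppow \<gamma> (s - (cmod y)\<^sup>2))"
      unfolding power_mult using C0 by (simp add: ppow_nonneg mult.left_commute flip: ennreal_mult)
  qed
  also have "\<dots> = ennreal C * (\<integral>\<^sup>+y. ennreal (((cmod y)\<^sup>2) ^ p i * ppow \<gamma> (s - (cmod y)\<^sup>2)) \<partial>lborel)"
    by (rule nn_integral_cmult) measurable
  also have "(\<integral>\<^sup>+y. ennreal (((cmod y)\<^sup>2) ^ p i * ppow \<gamma> (s - (cmod y)\<^sup>2)) \<partial>lborel) =
      ennreal pi * (\<integral>\<^sup>+t. ennreal (t ^ p i * ppow \<gamma> (s - t)) * indicator {0..} t \<partial>lborel)"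
    by (rule nn_integral_lborel_radial) measurable
  also have "\<dots> = ennreal pi * ennreal (fact (p i) * Gamma (\<gamma> + 1) / Gamma (\<gamma> + 1 + real (Suc (p i))) * ppow (\<gamma> + real (Suc (p i))) s)"
    by (simp only: nn_integral_beta[OF \<gamma>])
  also have "ennreal C * \<dots> = ennreal (C * (pi * (fact (p i) * Gamma (\<gamma> + 1) / Gamma (\<gamma> + 1 + real (Suc (p i))) * ppow (\<gamma> + real (Suc (p i))) s)))"
  proof -
    have "ennreal C * (ennreal pi * ennreal X) = ennreal (C * (pi * X))" if "X \<ge> 0" for X
      using C0 that by (simp add: ennreal_mult)
    moreover have "0 \<le> fact (p i) * Gamma (\<gamma> + 1) / Gamma (\<gamma> + 1 + real (Suc (p i))) * ppow (\<gamma> + real (Suc (p i))) s"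
      using \<gamma> by (intro mult_nonneg_nonneg divide_nonneg_nonneg Gamma_real_nonneg ppow_nonneg) auto
    ultimately show ?thesis by blast
  qed
  also have "C * (pi * (fact (p i) * Gamma (\<gamma> + 1) / Gamma (\<gamma> + 1 + real (Suc (p i))) * ppow (\<gamma> + real (Suc (p i))) s)) =
     pi ^ card (insert i J) * (\<Prod>j\<in>insert i J. fact (p j)) * Gamma (\<beta> + 1) / Gamma (\<beta> + 1 + (\<Sum>j\<in>insert i J. real (Suc (p j))))
            * ppow (\<beta> + (\<Sum>j\<in>insert i J. real (Suc (p j)))) s"
  proof -
    have "\<gamma> + 1 > 0" using \<gamma> by simp
    from Gamma_real_pos[OF this] have G: "Gamma (\<gamma> + 1) \<noteq> 0" by simp
    have e1: "\<beta> + 1 + (\<Sum>j\<in>insert i J. real (Suc (p j))) = \<gamma> + 1 + real (Suc (p i))"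
      and e2: "\<beta> + (\<Sum>j\<in>insert i J. real (Suc (p j))) = \<gamma> + real (Suc (p i))"
      using insert.hyps by (simp_all add: \<gamma>_def)
    show ?thesis
      unfolding e1 e2 C_def using insert.hyps G by simp
  qed
  finally show ?case by (simp only: F_def)
qed

definition bnorm :: "real \<Rightarrow> ('n::finite \<Rightarrow> nat) \<Rightarrow> real" where
  "bnorm \<alpha> p = pi ^ CARD('n) * mfact p * Gamma (\<alpha> + 1) / Gamma (\<alpha> + real CARD('n) + 1 + real (mabs p))"

lemma bnorm_pos: "\<alpha> > -1 \<Longrightarrow> bnorm \<alpha> p > 0"
  unfolding bnorm_def mfact_def
  by (intro divide_pos_pos mult_pos_pos Gamma_real_pos prod_pos) auto

lemma wnorm2_monom:
  fixes p :: "'n::finite \<Rightarrow> nat"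
  assumes \<alpha>: "\<alpha> > -1"
  shows "wnorm2 \<alpha> (\<lambda>z. Defs.monom z p) = ennreal (bnorm \<alpha> p)"
proof -
  define h where "h z = ennreal ((\<Prod>j\<in>UNIV. cmod (z$j) ^ (2 * p j)) * ppow \<alpha> (1 - (\<Sum>j\<in>UNIV. (cmod (z$j))\<^sup>2)))" for z :: "complex^'n"
  have nth: "(\<lambda>z::complex^'n. z$j) \<in> borel_measurable borel" for j
    by (intro borel_measurable_continuous_onI continuous_intros)
  note [measurable] = nth
  have h_meas: "h \<in> borel_measurable borel"
    unfolding h_def by measurable
  have "wnorm2 \<alpha> (\<lambda>z. Defs.monom z p) = (\<integral>\<^sup>+z. h z \<partial>lborel)"
    unfolding wnorm2_def
  proof (rule nn_integral_cong)
    fix z :: "complex^'n"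
    have n: "(norm z)\<^sup>2 = (\<Sum>j\<in>UNIV. (cmod (z$j))\<^sup>2)"
      by (simp add: norm_vec_def L2_set_def sum_nonneg)
    have m: "(cmod (Defs.monom z p))\<^sup>2 = (\<Prod>j\<in>UNIV. cmod (z$j) ^ (2 * p j))"
      by (simp add: norm_monom prod_power_distrib power_mult[symmetric] mult.commute)
    show "ennreal ((cmod (Defs.monom z p))\<^sup>2 * weight \<alpha> z) * indicator (ball 0 1) z = h z"
      using mem_unit_ball_iff[of z]
      by (auto simp: h_def weight_def ppow_def n m simp del: mem_ball)
  qed
  also have "\<dots> = (\<integral>\<^sup>+x. h (\<chi> j. x j) \<partial>PiM UNIV (\<lambda>_. lborel))"
    by (rule nn_integral_lborel_vec[OF h_meas])
  also have "\<dots> = ennreal (pi ^ CARD('n) * mfact p * Gamma (\<alpha> + 1) / Gamma (\<alpha> + 1 + (\<Sum>j\<in>(UNIV :: 'n set). real (Suc (p j)))) * ppow (\<alpha> + (\<Sum>j\<in>(UNIV :: 'n set). real (Suc (p j)))) 1)"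
    unfolding h_def using dirichlet_integral[OF finite \<alpha>, of "UNIV :: 'n set" p 1] by (simp add: mfact_def)
  also have "\<dots> = ennreal (bnorm \<alpha> p)"
    by (simp add: bnorm_def ppow_def mabs_def sum.distrib add_ac)
  finally show ?thesis .
qed

section \<open>Norms of power series\<close>

text \<open>Sums over multi-indices are treated as integrals over \<open>count_space\<close>, so
  that Tonelli exchanges them with integrals and divergence shows up as the value
  \<open>top\<close>.\<close>

lemma nn_integral_count_space_has_sum:
  fixes f :: "'i \<Rightarrow> real"
  assumes "(f has_sum s) UNIV" "\<And>i. f i \<ge> 0"
  shows "(\<integral>\<^sup>+i. ennreal (f i) \<partial>count_space UNIV) = ennreal s"
proof -
  have "Infinite_Set_Sum.abs_summable_on f UNIV"
    unfolding abs_summable_equivalent[symmetric] using assms by (auto simp: summable_on_def)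
  from nn_integral_conv_infsetsum[OF this] infsetsum_infsum[OF this] show ?thesis
    using assms by (simp add: infsumI)
qed

lemma nn_integral_count_space_summable:
  fixes f :: "'i \<Rightarrow> real"
  assumes "(\<integral>\<^sup>+i. ennreal (f i) \<partial>count_space UNIV) < top" "\<And>i. f i \<ge> 0"
  shows "f summable_on UNIV"
proof -
  have "integrable (count_space UNIV) f"
    using assms by (intro integrableI_nonneg) auto
  then have "Infinite_Set_Sum.abs_summable_on f UNIV"
    by (simp add: Infinite_Set_Sum.abs_summable_on_def)
  then show ?thesis
    unfolding abs_summable_equivalent[symmetric] by (rule abs_summable_summable)
qed

lemma pseries_measurable:
  assumes "pseries b u"
  shows "(\<lambda>z. indicator (ball 0 1) z *\<^sub>R u z) \<in> borel_measurable borel"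
  using holo_ball_continuous_on[OF pseries_imp_holo_ball[OF assms]]
  by (intro borel_measurable_continuous_on_indicator) auto

lemma borel_measurable_weight [measurable]: "weight \<alpha> \<in> borel_measurable borel"
  unfolding weight_def[abs_def] by measurable

text \<open>An identity of extended nonnegative reals, valid also when both sides are infinite; that
  is why finiteness of the norm later becomes a criterion on coefficients.\<close>

lemma wnorm2_pseries:
  fixes u :: "complex^'n::finite \<Rightarrow> complex"
  assumes \<alpha>: "\<alpha> > -1" and b: "pseries b u"
  shows "wnorm2 \<alpha> u = (\<integral>\<^sup>+p. ennreal (bnorm \<alpha> p * (cmod (b p))\<^sup>2) \<partial>count_space UNIV)"
proof -
  define I where "I = (indicator (ball 0 1) :: complex^'n \<Rightarrow> ennreal)"
  define h where "h z = ennreal ((cmod (u z))\<^sup>2 * weight \<alpha> z) * I z" for z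
  have I_meas [measurable]: "I \<in> borel_measurable borel" unfolding I_def by (intro borel_measurable_indicator) simp
  have w0: "weight \<alpha> z \<ge> 0" for z :: "complex^'n" by (simp add: weight_def)
  \<comment> \<open>The values of \<open>u\<close> off the ball are arbitrary, so \<open>u\<close>
    is replaced by its cut-off, which is measurable.\<close>
  have "h = (\<lambda>z. ennreal ((cmod (indicator (ball 0 1) z *\<^sub>R u z))\<^sup>2 * weight \<alpha> z) * I z)"
    by (auto simp: h_def I_def indicator_def)
  moreover note [measurable] = pseries_measurable[OF b]
  have "(\<lambda>z. ennreal ((cmod (indicator (ball 0 1) z *\<^sub>R u z))\<^sup>2 * weight \<alpha> z) * I z) \<in> borel_measurable borel"
    by measurable
  ultimately have h_meas: "h \<in> borel_measurable borel" by (simp only:)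
  have nth: "(\<lambda>z::complex^'n. z$j) \<in> borel_measurable borel" for j
    by (intro borel_measurable_continuous_onI continuous_intros)
  note [measurable] = nth
  have inner: "(\<integral>\<^sup>+t. h (rot t z) \<partial>torus) =
      (\<integral>\<^sup>+p. ennreal ((cmod (b p))\<^sup>2) * (ennreal ((cmod (Defs.monom z p))\<^sup>2 * weight \<alpha> z) * I z) \<partial>count_space UNIV)" for z
  proof (cases "z \<in> ball 0 1")
    case False
    then show ?thesis by (simp add: h_def I_def)
  next
    case z: True
    have rz: "rot t z \<in> ball 0 1" for t using z by simp
    define \<beta> where "\<beta> p = b p * Defs.monom z p" for p
    have summ: "(\<lambda>p. cmod (\<beta> p)) summable_on UNIV"
      using pseries_abs_summable[OF b z] by (simp add: \<beta>_def norm_mult)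
    have hs: "((\<lambda>p. \<beta> p * tchar p t) has_sum u (rot t z)) UNIV" for t
      using pseriesD[OF b rz[of t]] by (simp add: \<beta>_def monom_rot mult_ac)
    have "(\<lambda>t. rot t z) \<in> borel_measurable torus"
      unfolding rot_def by measurable
    from measurable_compose[OF this pseries_measurable[OF b]]
    have um: "(\<lambda>t. u (rot t z)) \<in> borel_measurable torus"
      using rz by (simp del: mem_ball)
    note P = torus_parseval[OF summ um hs]
    have "h (rot t z) = ennreal (weight \<alpha> z) * ennreal ((cmod (u (rot t z)))\<^sup>2)" for t
      using rz[of t] w0[of z] by (simp add: h_def I_def weight_def ennreal_mult mult.commute)
    then have "(\<integral>\<^sup>+t. h (rot t z) \<partial>torus) = ennreal (weight \<alpha> z) * (\<integral>\<^sup>+t. ennreal ((cmod (u (rot t z)))\<^sup>2) \<partial>torus)"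
      using um by (simp add: nn_integral_cmult)
    also have "(\<integral>\<^sup>+t. ennreal ((cmod (u (rot t z)))\<^sup>2) \<partial>torus) = ennreal (\<integral>t. (cmod (u (rot t z)))\<^sup>2 \<partial>torus)"
      using P(2) by (intro nn_integral_eq_integral) auto
    also have "\<dots> = (\<integral>\<^sup>+p. ennreal ((cmod (\<beta> p))\<^sup>2) \<partial>count_space UNIV)"
      by (rule nn_integral_count_space_has_sum[OF P(1), symmetric]) simp
    also have "ennreal (weight \<alpha> z) * \<dots> = (\<integral>\<^sup>+p. ennreal (weight \<alpha> z) * ennreal ((cmod (\<beta> p))\<^sup>2) \<partial>count_space UNIV)"
      by (rule nn_integral_cmult[symmetric]) simp
    also have "\<dots> = (\<integral>\<^sup>+p. ennreal ((cmod (b p))\<^sup>2) * (ennreal ((cmod (Defs.monom z p))\<^sup>2 * weight \<alpha> z) * I z) \<partial>count_space UNIV)"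
      using z w0[of z] by (intro nn_integral_cong)
        (simp add: I_def \<beta>_def norm_mult power_mult_distrib mult_ac flip: ennreal_mult)
    finally show ?thesis .
  qed
  have "wnorm2 \<alpha> u = (\<integral>\<^sup>+z. h z \<partial>lborel)"
    by (simp add: wnorm2_def h_def I_def)
  also have "\<dots> = (\<integral>\<^sup>+z. \<integral>\<^sup>+t. h (rot t z) \<partial>torus \<partial>lborel)"
    by (rule nn_integral_torus_average[OF h_meas])
  also have "\<dots> = (\<integral>\<^sup>+z. \<integral>\<^sup>+p. ennreal ((cmod (b p))\<^sup>2) * (ennreal ((cmod (Defs.monom z p))\<^sup>2 * weight \<alpha> z) * I z) \<partial>count_space UNIV \<partial>lborel)"
    by (simp only: inner)
  \<comment> \<open>Sum and integral are exchanged: the terms are nonnegative and there are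
    countably many multi-indices.\<close>
  also have "\<dots> = (\<integral>\<^sup>+p. \<integral>\<^sup>+z. ennreal ((cmod (b p))\<^sup>2) * (ennreal ((cmod (Defs.monom z p))\<^sup>2 * weight \<alpha> z) * I z) \<partial>lborel \<partial>count_space UNIV)"
    by (intro nn_integral_count_space_nn_integral) (simp_all add: Defs.monom_def)
  also have "\<dots> = (\<integral>\<^sup>+p. ennreal ((cmod (b p))\<^sup>2) * ennreal (bnorm \<alpha> p) \<partial>count_space UNIV)"
  proof (rule nn_integral_cong)
    fix p
    have "(\<lambda>z. ennreal ((cmod (Defs.monom z p))\<^sup>2 * weight \<alpha> z) * I z) \<in> borel_measurable borel"
      unfolding Defs.monom_def by measurable
    then show "(\<integral>\<^sup>+z. ennreal ((cmod (b p))\<^sup>2) * (ennreal ((cmod (Defs.monom z p))\<^sup>2 * weight \<alpha> z) * I z) \<partial>lborel) =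
        ennreal ((cmod (b p))\<^sup>2) * ennreal (bnorm \<alpha> p)"
      by (simp add: nn_integral_cmult wnorm2_monom[OF \<alpha>, symmetric] wnorm2_def I_def)
  qed
  also have "\<dots> = (\<integral>\<^sup>+p. ennreal (bnorm \<alpha> p * (cmod (b p))\<^sup>2) \<partial>count_space UNIV)"
    by (intro nn_integral_cong) (simp add: bnorm_pos[OF \<alpha>] less_imp_le mult.commute flip: ennreal_mult)
  finally show ?thesis .
qed

section \<open>The Sobolev-Bergman norm in coefficients\<close>

lemma mfact_pos: "mfact p > 0"
  unfolding mfact_def by (intro prod_pos) auto

lemma mabs_diff:
  assumes "\<And>j. q j \<le> r j"
  shows "mabs (\<lambda>j. r j - q j) = mabs r - mabs q"
  unfolding mabs_def using assms by (intro sum_subtractf_nat) auto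

lemma mabs_mono: "(\<And>j. q j \<le> r j) \<Longrightarrow> mabs q \<le> mabs r"
  unfolding mabs_def by (intro sum_mono) auto

text \<open>The weights \<open>N\<^sub>p\<close> of the overview. For \<open>mabs p \<ge> m\<close>
  the quotient of factorials is \<open>fact m\<close> times the binomial coefficient from
  Vandermonde, and the Gamma function in the denominator sees \<open>mabs p - m\<close> because each
  derivative lowers the degree by \<open>m\<close>.\<close>

definition anorm :: "real \<Rightarrow> nat \<Rightarrow> ('n::finite \<Rightarrow> nat) \<Rightarrow> real" where
  "anorm \<alpha> m p = (if mabs p < m then bnorm \<alpha> p
     else pi ^ CARD('n) * mfact p * (fact (mabs p) / fact (mabs p - m)) * Gamma (\<alpha> + 1)
            / Gamma (\<alpha> + real CARD('n) + 1 + real (mabs p - m)))"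

lemma anorm_pos: "\<alpha> > -1 \<Longrightarrow> anorm \<alpha> m p > 0"
  using mfact_pos[of p] bnorm_pos[of \<alpha> p] unfolding anorm_def
  by (auto intro!: divide_pos_pos mult_pos_pos Gamma_real_pos)

text \<open>The contribution of the coefficient at \<open>r\<close> to the norm of the
  \<open>q\<close>-th derivative: differentiating the monomial gives the factor
  \<open>mfact r / mfact (\<lambda>j. r j - q j)\<close>. The value 0 when \<open>q\<close> does not
  lie below \<open>r\<close> allows sums over all \<open>r\<close>.\<close>

definition shift_norm :: "real \<Rightarrow> ('n::finite \<Rightarrow> nat) \<Rightarrow> ('n \<Rightarrow> nat) \<Rightarrow> real" where
  "shift_norm \<alpha> q r = (if \<forall>j. q j \<le> r j
     then bnorm \<alpha> (\<lambda>j. r j - q j) * (mfact r / mfact (\<lambda>j. r j - q j))\<^sup>2 else 0)"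

lemma shift_norm_nonneg: "\<alpha> > -1 \<Longrightarrow> shift_norm \<alpha> q r \<ge> 0"
  by (auto simp: shift_norm_def bnorm_pos less_imp_le)

text \<open>With d = r - q, the summand is a constant times r!^2 / (d! q!), that is r! times the
  product of the binomials \<open>r j choose q j\<close>; the constant depends only on the degree of
  \<open>r\<close>. Vandermonde sums the products.\<close>

lemma anorm_eq:
  fixes r :: "'n::finite \<Rightarrow> nat"
  assumes \<alpha>: "\<alpha> > -1"
  shows "(if mabs r < m then bnorm \<alpha> r else 0) +
         fact m * (\<Sum>q\<in>{q. mabs q = m}. 1 / mfact q * shift_norm \<alpha> q r) = anorm \<alpha> m r"
proof (cases "mabs r < m")
  case True
  have "shift_norm \<alpha> q r = 0" if "mabs q = m" for q
    using mabs_mono[of q r] that True by (auto simp: shift_norm_def)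
  then show ?thesis using True by (simp add: anorm_def)
next
  case False
  define G where "G = pi ^ CARD('n) * Gamma (\<alpha> + 1) / Gamma (\<alpha> + real CARD('n) + 1 + real (mabs r - m))"
  have "1 / mfact q * shift_norm \<alpha> q r = G * mfact r * (\<Prod>j\<in>UNIV. real (r j choose q j))" if q: "mabs q = m" for q
  proof (cases "\<forall>j. q j \<le> r j")
    case True
    define d where "d = (\<lambda>j. r j - q j)"
    have "mfact r = mfact q * mfact d * (\<Prod>j\<in>UNIV. real (r j choose q j))"
      unfolding mfact_def d_def prod.distrib[symmetric]
      using True by (intro prod.cong refl) (simp add: binomial_fact)
    moreover have "bnorm \<alpha> d = G * mfact d"
      using mabs_diff[of q r] True q by (simp add: bnorm_def G_def d_def)
    moreover have "shift_norm \<alpha> q r = bnorm \<alpha> d * (mfact r / mfact d)\<^sup>2"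
      using True by (simp add: shift_norm_def d_def)
    ultimately show ?thesis
      using mfact_pos[of q] mfact_pos[of d] by (simp add: power2_eq_square field_simps)
  next
    case False
    \<comment> \<open>If some \<open>q j\<close> exceeds \<open>r j\<close>, that binomial
      coefficient is 0, in agreement with the default in \<open>shift_norm\<close>.\<close>
    then have "(\<Prod>j\<in>UNIV. real (r j choose q j)) = 0" 
      by (auto simp: prod_zero_iff not_le)
    moreover have "shift_norm \<alpha> q r = 0" using False by (auto simp: shift_norm_def)
    ultimately show ?thesis by (simp only: mult_zero_right)
  qed
  then have "(\<Sum>q\<in>{q. mabs q = m}. 1 / mfact q * shift_norm \<alpha> q r) =
      G * mfact r * (\<Sum>q\<in>midx UNIV m. \<Prod>j\<in>UNIV. real (r j choose q j))"
    by (simp add: midx_UNIV sum_distrib_left)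
  also have "(\<Sum>q\<in>midx UNIV m. \<Prod>j\<in>UNIV. real (r j choose q j)) = real (mabs r choose m)"
    unfolding of_nat_prod[symmetric] of_nat_sum[symmetric] mabs_def
    by (simp only: multi_vandermonde[OF finite])
  also have "\<dots> = fact (mabs r) / (fact m * fact (mabs r - m))"
    using False by (simp add: binomial_fact)
  finally show ?thesis
    using False by (simp add: anorm_def G_def mult_ac)
qed

lemma bij_betw_add_midx: "bij_betw (\<lambda>p j. p j + q j) UNIV {r. \<forall>j. q j \<le> (r j :: nat)}"
  by (rule bij_betwI[where g = "\<lambda>r j. r j - q j"]) auto

text \<open>A derivative of order \<open>m\<close> reads only coefficients of degree at least
  \<open>m\<close>, so the truncation in \<open>f2\<close> disappears.\<close>

lemma pseries_Dp_f2:
  assumes "pseries a f" "mabs q = m"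
  shows "pseries (\<lambda>p. of_real (mfact (\<lambda>j. p j + q j) / mfact p) * a (\<lambda>j. p j + q j)) (Dp q (f2 m f))"
proof -
  have "\<not> mabs (\<lambda>j. p j + q j) < m" for p
    using assms(2) mabs_mono[of q "\<lambda>j. p j + q j"] by simp
  then show ?thesis
    using pseries_Dp[OF pseries_f2[OF assms(1), of m], of q] by simp
qed

lemma shift_norm_add:
  "shift_norm \<alpha> q (\<lambda>j. p j + q j) = bnorm \<alpha> p * (mfact (\<lambda>j. p j + q j) / mfact p)\<^sup>2"
  by (simp add: shift_norm_def)

lemma wnorm2_Dp_f2:
  assumes \<alpha>: "\<alpha> > -1" and a: "pseries a f" and q: "mabs q = m"
  shows "wnorm2 \<alpha> (Dp q (f2 m f)) = (\<integral>\<^sup>+r. ennreal (shift_norm \<alpha> q r * (cmod (a r))\<^sup>2) \<partial>count_space UNIV)"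
proof -
  have "bnorm \<alpha> p * (cmod (of_real (mfact (\<lambda>j. p j + q j) / mfact p) * a (\<lambda>j. p j + q j)))\<^sup>2 =
      shift_norm \<alpha> q (\<lambda>j. p j + q j) * (cmod (a (\<lambda>j. p j + q j)))\<^sup>2" for p
    unfolding shift_norm_add norm_mult norm_of_real power_mult_distrib power2_abs by simp
  then have "wnorm2 \<alpha> (Dp q (f2 m f)) =
      (\<integral>\<^sup>+p. ennreal (shift_norm \<alpha> q (\<lambda>j. p j + q j) * (cmod (a (\<lambda>j. p j + q j)))\<^sup>2) \<partial>count_space UNIV)"
    by (simp only: wnorm2_pseries[OF \<alpha> pseries_Dp_f2[OF a q]])
  also have "\<dots> = (\<integral>\<^sup>+r. ennreal (shift_norm \<alpha> q r * (cmod (a r))\<^sup>2) \<partial>count_space {r. \<forall>j. q j \<le> r j})"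
    by (rule nn_integral_bij_count_space[OF bij_betw_add_midx])
  also have "\<dots> = (\<integral>\<^sup>+r. ennreal (shift_norm \<alpha> q r * (cmod (a r))\<^sup>2) \<partial>count_space UNIV)"
    by (subst nn_integral_count_space_indicator) (auto simp: shift_norm_def indicator_def intro!: nn_integral_cong)
  finally show ?thesis .
qed

lemma Anorm2_pseries:
  fixes f :: "complex^'n::finite \<Rightarrow> complex"
  assumes \<alpha>: "\<alpha> > -1" and a: "pseries a f"
  shows "Anorm2 \<alpha> m f = (\<integral>\<^sup>+p. ennreal (anorm \<alpha> m p * (cmod (a p))\<^sup>2) \<partial>count_space UNIV)"
proof -
  let ?C = "count_space (UNIV :: ('n \<Rightarrow> nat) set)"
  let ?Q = "{q :: 'n \<Rightarrow> nat. mabs q = m}"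
  have "Anorm2 \<alpha> m f = (\<integral>\<^sup>+p. ennreal (bnorm \<alpha> p * (cmod (if mabs p < m then a p else 0))\<^sup>2) \<partial>?C) +
      ennreal (fact m) * (\<Sum>q\<in>?Q. ennreal (1 / mfact q) * (\<integral>\<^sup>+r. ennreal (shift_norm \<alpha> q r * (cmod (a r))\<^sup>2) \<partial>?C))"
    by (simp add: Anorm2_def wnorm2_pseries[OF \<alpha> pseries_f1[OF a]] wnorm2_Dp_f2[OF \<alpha> a])
  also have "\<dots> = (\<integral>\<^sup>+p. ennreal (bnorm \<alpha> p * (cmod (if mabs p < m then a p else 0))\<^sup>2) +
      ennreal (fact m) * (\<Sum>q\<in>?Q. ennreal (1 / mfact q) * ennreal (shift_norm \<alpha> q p * (cmod (a p))\<^sup>2)) \<partial>?C)"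
    by (simp add: nn_integral_add nn_integral_cmult nn_integral_sum)
  also have "\<dots> = (\<integral>\<^sup>+p. ennreal (anorm \<alpha> m p * (cmod (a p))\<^sup>2) \<partial>?C)"
  proof (rule nn_integral_cong)
    fix p :: "'n \<Rightarrow> nat"
    have nn: "1 / mfact q * (shift_norm \<alpha> q p * (cmod (a p))\<^sup>2) \<ge> 0" for q
      using mfact_pos[of q] shift_norm_nonneg[OF \<alpha>, of q p] by simp
    have "(\<Sum>q\<in>?Q. ennreal (1 / mfact q) * ennreal (shift_norm \<alpha> q p * (cmod (a p))\<^sup>2)) =
        ennreal (\<Sum>q\<in>?Q. 1 / mfact q * (shift_norm \<alpha> q p * (cmod (a p))\<^sup>2))"
    proof -
      have "ennreal (1 / mfact q) * ennreal (shift_norm \<alpha> q p * (cmod (a p))\<^sup>2) =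
          ennreal (1 / mfact q * (shift_norm \<alpha> q p * (cmod (a p))\<^sup>2))" for q
        using mfact_pos[of q] shift_norm_nonneg[OF \<alpha>, of q p] by (intro ennreal_mult[symmetric]) auto
      then show ?thesis using nn by (simp only: sum_ennreal)
    qed
    then have "ennreal (bnorm \<alpha> p * (cmod (if mabs p < m then a p else 0))\<^sup>2) +
      ennreal (fact m) * (\<Sum>q\<in>?Q. ennreal (1 / mfact q) * ennreal (shift_norm \<alpha> q p * (cmod (a p))\<^sup>2)) =
      ennreal (bnorm \<alpha> p * (cmod (if mabs p < m then a p else 0))\<^sup>2 +
        fact m * (\<Sum>q\<in>?Q. 1 / mfact q * (shift_norm \<alpha> q p * (cmod (a p))\<^sup>2)))"
      using bnorm_pos[OF \<alpha>, of p] by (simp only: ennreal_plus ennreal_mult sum_nonneg nn fact_ge_zero mult_nonneg_nonneg less_imp_le zero_le_power2)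
    also have "bnorm \<alpha> p * (cmod (if mabs p < m then a p else 0))\<^sup>2 +
        fact m * (\<Sum>q\<in>?Q. 1 / mfact q * (shift_norm \<alpha> q p * (cmod (a p))\<^sup>2)) =
       ((if mabs p < m then bnorm \<alpha> p else 0) + fact m * (\<Sum>q\<in>?Q. 1 / mfact q * shift_norm \<alpha> q p)) * (cmod (a p))\<^sup>2"
      by (simp add: distrib_right sum_distrib_right mult.assoc)
    also have "\<dots> = anorm \<alpha> m p * (cmod (a p))\<^sup>2"
      by (simp only: anorm_eq[OF \<alpha>])
    finally show "ennreal (bnorm \<alpha> p * (cmod (if mabs p < m then a p else 0))\<^sup>2) +
      ennreal (fact m) * (\<Sum>q\<in>?Q. ennreal (1 / mfact q) * ennreal (shift_norm \<alpha> q p * (cmod (a p))\<^sup>2)) =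
      ennreal (anorm \<alpha> m p * (cmod (a p))\<^sup>2)" .
  qed
  finally show ?thesis .
qed

lemma nn_integral_count_space_finite_iff:
  fixes f :: "'i \<Rightarrow> real"
  assumes "\<And>i. f i \<ge> 0"
  shows "(\<integral>\<^sup>+i. ennreal (f i) \<partial>count_space UNIV) < top \<longleftrightarrow> f summable_on UNIV"
  using nn_integral_count_space_summable[of f] nn_integral_count_space_has_sum[of f] assms
  by (auto simp: summable_on_def)

text \<open>Both directions of "holomorphic means analytic" enter here; afterwards membership is
  purely a matter of coefficients.\<close>

lemma Aspace_iff:
  assumes \<alpha>: "\<alpha> > -1"
  shows "f \<in> Aspace \<alpha> m \<longleftrightarrow> (\<exists>a. pseries a f \<and> (\<lambda>p. anorm \<alpha> m p * (cmod (a p))\<^sup>2) summable_on UNIV)"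
proof -
  have nn: "anorm \<alpha> m p * (cmod c)\<^sup>2 \<ge> 0" for p :: "'a \<Rightarrow> nat" and c
    using anorm_pos[OF \<alpha>, of m p] by simp
  have fin: "Anorm2 \<alpha> m f < top \<longleftrightarrow> (\<lambda>p. anorm \<alpha> m p * (cmod (a p))\<^sup>2) summable_on UNIV" if "pseries a f" for a
    unfolding Anorm2_pseries[OF \<alpha> that] by (rule nn_integral_count_space_finite_iff) (rule nn)
  show ?thesis
  proof
    assume "f \<in> Aspace \<alpha> m"
    then have "holo_ball f" "Anorm2 \<alpha> m f < top" by (simp_all add: Aspace_def)
    then show "\<exists>a. pseries a f \<and> (\<lambda>p. anorm \<alpha> m p * (cmod (a p))\<^sup>2) summable_on UNIV"
      using holo_ball_imp_pseries[of f] fin by blast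
  next
    assume "\<exists>a. pseries a f \<and> (\<lambda>p. anorm \<alpha> m p * (cmod (a p))\<^sup>2) summable_on UNIV"
    then obtain a where a: "pseries a f" "(\<lambda>p. anorm \<alpha> m p * (cmod (a p))\<^sup>2) summable_on UNIV" by blast
    then show "f \<in> Aspace \<alpha> m"
      unfolding Aspace_def using fin[OF a(1)] pseries_imp_holo_ball[OF a(1)] by simp
  qed
qed

section \<open>Inner products by polarization\<close>

text \<open>Passes from the extended-valued norm to a Bochner integral, the form of
  \<open>wip\<close>, so that several such integrals can be combined linearly.\<close>

lemma wnorm2_integrable:
  fixes u :: "complex^'n::finite \<Rightarrow> complex"
  assumes b: "pseries b u" and fin: "wnorm2 \<alpha> u < top"
  shows "integrable lborel (\<lambda>z. indicator (ball 0 1) z * (weight \<alpha> z * (cmod (u z))\<^sup>2))"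
    and "(\<integral>z. indicator (ball 0 1) z * (weight \<alpha> z * (cmod (u z))\<^sup>2) \<partial>lborel) = enn2real (wnorm2 \<alpha> u)"
proof -
  have w0: "weight \<alpha> z \<ge> 0" for z :: "complex^'n" by (simp add: weight_def)
  note [measurable] = pseries_measurable[OF b]
  have I_meas [measurable]: "(indicator (ball 0 1) :: complex^'n \<Rightarrow> real) \<in> borel_measurable borel"
    by (intro borel_measurable_indicator) simp
  have eq: "indicator (ball 0 1) z * (weight \<alpha> z * (cmod (u z))\<^sup>2) =
      indicator (ball 0 1) z * (weight \<alpha> z * (cmod (indicator (ball 0 1) z *\<^sub>R u z))\<^sup>2)" for z
    by (auto simp: indicator_def)
  have m: "(\<lambda>z. indicator (ball 0 1) z * (weight \<alpha> z * (cmod (u z))\<^sup>2)) \<in> borel_measurable lborel"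
    unfolding eq by measurable
  have nn: "(\<integral>\<^sup>+z. ennreal (indicator (ball 0 1) z * (weight \<alpha> z * (cmod (u z))\<^sup>2)) \<partial>lborel) = wnorm2 \<alpha> u"
    unfolding wnorm2_def by (intro nn_integral_cong) (auto simp: indicator_def mult.commute)
  show "integrable lborel (\<lambda>z. indicator (ball 0 1) z * (weight \<alpha> z * (cmod (u z))\<^sup>2))"
    using m fin w0 by (intro integrableI_nonneg) (auto simp: nn)
  show "(\<integral>z. indicator (ball 0 1) z * (weight \<alpha> z * (cmod (u z))\<^sup>2) \<partial>lborel) = enn2real (wnorm2 \<alpha> u)"
    using m w0 by (subst integral_eq_nn_integral) (auto simp: nn)
qed

lemma norm_add_sq_le: "(cmod (x + y))\<^sup>2 \<le> 2 * (cmod x)\<^sup>2 + 2 * (cmod y)\<^sup>2"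
proof -
  have "(cmod (x + y))\<^sup>2 \<le> (cmod x + cmod y)\<^sup>2"
    by (intro power_mono norm_triangle_ineq) simp
  also have "\<dots> \<le> 2 * (cmod x)\<^sup>2 + 2 * (cmod y)\<^sup>2"
    using sum_squares_bound[of "cmod x" "cmod y"] by (simp add: power2_sum)
  finally show ?thesis .
qed

lemma weighted_summable_add:
  fixes N :: "'i \<Rightarrow> real" and a b :: "'i \<Rightarrow> complex"
  assumes N: "\<And>p. N p \<ge> 0"
    and "(\<lambda>p. N p * (cmod (a p))\<^sup>2) summable_on UNIV" "(\<lambda>p. N p * (cmod (b p))\<^sup>2) summable_on UNIV"
  shows "(\<lambda>p. N p * (cmod (a p + b p))\<^sup>2) summable_on UNIV"
proof (rule summable_on_comparison_test)
  show "(\<lambda>p. 2 * (N p * (cmod (a p))\<^sup>2) + 2 * (N p * (cmod (b p))\<^sup>2)) summable_on UNIV"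
    by (intro summable_on_add summable_on_cmult_right assms)
  fix p
  show "N p * (cmod (a p + b p))\<^sup>2 \<le> 2 * (N p * (cmod (a p))\<^sup>2) + 2 * (N p * (cmod (b p))\<^sup>2)"
    using mult_left_mono[OF norm_add_sq_le[of "a p" "b p"] N[of p]] by (simp add: algebra_simps)
qed (simp add: N)

lemma weighted_summable_cmult:
  fixes N :: "'i \<Rightarrow> real" and a :: "'i \<Rightarrow> complex"
  assumes "(\<lambda>p. N p * (cmod (a p))\<^sup>2) summable_on UNIV"
  shows "(\<lambda>p. N p * (cmod (c * a p))\<^sup>2) summable_on UNIV"
  using summable_on_cmult_right[OF assms, of "(cmod c)\<^sup>2"]
  by (simp add: norm_mult power_mult_distrib mult.left_commute)

lemma weighted_summable_diff:
  fixes N :: "'i \<Rightarrow> real" and a b :: "'i \<Rightarrow> complex"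
  assumes "\<And>p. N p \<ge> 0"
    and "(\<lambda>p. N p * (cmod (a p))\<^sup>2) summable_on UNIV" "(\<lambda>p. N p * (cmod (b p))\<^sup>2) summable_on UNIV"
  shows "(\<lambda>p. N p * (cmod (a p - b p))\<^sup>2) summable_on UNIV"
  using weighted_summable_add[OF assms(1,2) weighted_summable_cmult[OF assms(3), of "-1"]] by simp

text \<open>The terms are written as \<open>x + c * y\<close> with \<open>c\<close> a fourth root of
  unity, so one statement with parameter \<open>c\<close> serves them all.\<close>

lemma polarization_complex:
  "4 * (x * cnj y) = of_real ((cmod (x + y))\<^sup>2) - of_real ((cmod (x + (-1) * y))\<^sup>2)
     + \<i> * of_real ((cmod (x + \<i> * y))\<^sup>2) - \<i> * of_real ((cmod (x + (- \<i>) * y))\<^sup>2)"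
  unfolding complex_norm_square by (simp add: algebra_simps)

text \<open>Parseval is available for norms only. Applied to \<open>u + c * v\<close> for the four
  roots of unity, it gives the mixed formula by polarizing once under the integral and once under
  the sum.\<close>

lemma wip_has_sum:
  fixes u v :: "complex^'n::finite \<Rightarrow> complex"
  assumes \<alpha>: "\<alpha> > -1" and b: "pseries b u" and d: "pseries d v"
    and fin: "wnorm2 \<alpha> u < top" "wnorm2 \<alpha> v < top"
  shows "((\<lambda>p. of_real (bnorm \<alpha> p) * (b p * cnj (d p))) has_sum wip \<alpha> u v) UNIV"
proof -
  \<comment> \<open>The value shared by the integral and the coefficient sum belonging to
    \<open>u + c * v\<close>; it is finite, so real arithmetic applies.\<close>
  define S where "S c = enn2real (wnorm2 \<alpha> (\<lambda>z. u z + c * v z))" for c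
  define q where "q c z = indicator (ball 0 1) z * (weight \<alpha> z * (cmod (u z + c * v z))\<^sup>2)" for c and z :: "complex^'n"
  have bn0: "bnorm \<alpha> p \<ge> 0" for p :: "'n \<Rightarrow> nat" using bnorm_pos[OF \<alpha>, of p] by simp
  have ps: "pseries (\<lambda>p. b p + c * d p) (\<lambda>z. u z + c * v z)" for c
    by (intro pseries_add pseries_cmult b d)
  have summ: "(\<lambda>p. bnorm \<alpha> p * (cmod (b p))\<^sup>2) summable_on UNIV" "(\<lambda>p. bnorm \<alpha> p * (cmod (d p))\<^sup>2) summable_on UNIV"
    using fin nn_integral_count_space_finite_iff bn0
    by (auto simp: wnorm2_pseries[OF \<alpha> b] wnorm2_pseries[OF \<alpha> d] intro!: nn_integral_count_space_summable)
  have summc: "(\<lambda>p. bnorm \<alpha> p * (cmod (b p + c * d p))\<^sup>2) summable_on UNIV" for c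
    by (intro weighted_summable_add weighted_summable_cmult bn0 summ)
  have wn: "wnorm2 \<alpha> (\<lambda>z. u z + c * v z) = ennreal (infsum (\<lambda>p. bnorm \<alpha> p * (cmod (b p + c * d p))\<^sup>2) UNIV)" for c
    unfolding wnorm2_pseries[OF \<alpha> ps]
    by (intro nn_integral_count_space_has_sum has_sum_infsum summc) (simp add: bn0)
  have hs: "((\<lambda>p. bnorm \<alpha> p * (cmod (b p + c * d p))\<^sup>2) has_sum S c) UNIV" for c
    unfolding S_def wn using summc[of c] by (simp add: infsum_nonneg bn0)
  have q: "integrable lborel (q c)" "(\<integral>z. q c z \<partial>lborel) = S c" for c
    using wnorm2_integrable[OF ps, of \<alpha> c] unfolding wn by (simp_all add: q_def[abs_def] S_def wn)
  have "4 * wip \<alpha> u v = (\<integral>z. 4 * (indicator (ball 0 1) z *\<^sub>R (complex_of_real (weight \<alpha> z) * (u z * cnj (v z)))) \<partial>lborel)"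
    by (simp only: wip_def set_lebesgue_integral_def integral_mult_right_zero)
  also have "\<dots> = (\<integral>z. complex_of_real (q 1 z) - of_real (q (-1) z) + \<i> * of_real (q \<i> z) - \<i> * of_real (q (-\<i>) z) \<partial>lborel)"
  proof (intro Bochner_Integration.integral_cong refl)
    fix z :: "complex^'n"
    have "4 * (indicator (ball 0 1) z *\<^sub>R (complex_of_real (weight \<alpha> z) * (u z * cnj (v z)))) =
        of_real (indicator (ball 0 1) z * weight \<alpha> z) * (4 * (u z * cnj (v z)))"
      by (simp add: scaleR_conv_of_real)
    also have "\<dots> = complex_of_real (q 1 z) - of_real (q (-1) z) + \<i> * of_real (q \<i> z) - \<i> * of_real (q (-\<i>) z)"
      unfolding polarization_complex q_def by (simp add: algebra_simps)
    finally show "4 * (indicator (ball 0 1) z *\<^sub>R (complex_of_real (weight \<alpha> z) * (u z * cnj (v z)))) =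
      complex_of_real (q 1 z) - of_real (q (-1) z) + \<i> * of_real (q \<i> z) - \<i> * of_real (q (-\<i>) z)" .
  qed
  also have "\<dots> = of_real (S 1) - of_real (S (-1)) + \<i> * of_real (S \<i>) - \<i> * of_real (S (-\<i>))"
  proof -
    have i: "integrable lborel (\<lambda>z. complex_of_real (q c z))" "(\<integral>z. complex_of_real (q c z) \<partial>lborel) = of_real (S c)" for c
      using q[of c] by (simp_all only: complex_of_real_integrable_eq integral_complex_of_real)
    show ?thesis
      by (simp add: i q(2) integrable_mult_right)
  qed
  finally have W: "4 * wip \<alpha> u v = of_real (S 1) - of_real (S (-1)) + \<i> * of_real (S \<i>) - \<i> * of_real (S (-\<i>))" .
  have hc: "((\<lambda>p. of_real (bnorm \<alpha> p * (cmod (b p + c * d p))\<^sup>2) :: complex) has_sum of_real (S c)) UNIV" for c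
    using has_sum_of_real[OF hs[of c]] .
  have "((\<lambda>p. complex_of_real (bnorm \<alpha> p * (cmod (b p + 1 * d p))\<^sup>2) + (-1) * of_real (bnorm \<alpha> p * (cmod (b p + (-1) * d p))\<^sup>2)
      + \<i> * of_real (bnorm \<alpha> p * (cmod (b p + \<i> * d p))\<^sup>2) + (-\<i>) * of_real (bnorm \<alpha> p * (cmod (b p + (-\<i>) * d p))\<^sup>2))
      has_sum (of_real (S 1) + (-1) * of_real (S (-1)) + \<i> * of_real (S \<i>) + (-\<i>) * of_real (S (-\<i>)))) UNIV"
    by (intro has_sum_add has_sum_cmult_right hc)
  moreover have "complex_of_real (bnorm \<alpha> p * (cmod (b p + 1 * d p))\<^sup>2) + (-1) * of_real (bnorm \<alpha> p * (cmod (b p + (-1) * d p))\<^sup>2)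
      + \<i> * of_real (bnorm \<alpha> p * (cmod (b p + \<i> * d p))\<^sup>2) + (-\<i>) * of_real (bnorm \<alpha> p * (cmod (b p + (-\<i>) * d p))\<^sup>2)
      = of_real (bnorm \<alpha> p) * (4 * (b p * cnj (d p)))" for p
    unfolding polarization_complex by (simp add: algebra_simps)
  ultimately have "((\<lambda>p. of_real (bnorm \<alpha> p) * (4 * (b p * cnj (d p)))) has_sum (4 * wip \<alpha> u v)) UNIV"
    unfolding W by simp
  from has_sum_cmult_right[OF this, of "1/4"] show ?thesis by (simp add: mult.left_commute)
qed

lemma has_sum_finite_sum:
  fixes F :: "'q \<Rightarrow> 'i \<Rightarrow> complex"
  assumes "\<And>q. q \<in> Q \<Longrightarrow> (F q has_sum s q) A"
  shows "((\<lambda>x. \<Sum>q\<in>Q. F q x) has_sum (\<Sum>q\<in>Q. s q)) A"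
  using assms by (induction Q rule: infinite_finite_induct) (auto intro!: has_sum_add)

lemma Aip_has_sum:
  fixes f g :: "complex^'n::finite \<Rightarrow> complex"
  assumes \<alpha>: "\<alpha> > -1" and a: "pseries a f" and b: "pseries b g"
    and fin: "Anorm2 \<alpha> m f < top" "Anorm2 \<alpha> m g < top"
  shows "((\<lambda>p. of_real (anorm \<alpha> m p) * (a p * cnj (b p))) has_sum Aip \<alpha> m f g) UNIV"
proof -
  let ?Q = "{q :: 'n \<Rightarrow> nat. mabs q = m}"
  have finQ: "finite ?Q" using finite_midx[OF finite, of "UNIV :: 'n set" m] by (simp add: midx_UNIV)
  \<comment> \<open>The summands of \<open>Anorm2\<close> are nonnegative with positive factors, so
    a finite total forces each piece to be finite, as \<open>wip_has_sum\<close> requires of every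
    derivative.\<close>
  have fin': "wnorm2 \<alpha> (f1 m h) < top" "\<And>q. mabs q = m \<Longrightarrow> wnorm2 \<alpha> (Dp q (f2 m h)) < top"
    if "Anorm2 \<alpha> m h < top" for h :: "complex^'n \<Rightarrow> complex"
  proof -
    show "wnorm2 \<alpha> (f1 m h) < top" using that by (simp add: Anorm2_def)
    fix q :: "'n \<Rightarrow> nat" assume q: "mabs q = m"
    have "(\<Sum>p\<in>?Q. ennreal (1 / mfact p) * wnorm2 \<alpha> (Dp p (f2 m h))) < top"
      using that by (auto simp: Anorm2_def ennreal_mult_less_top)
    moreover have "ennreal (1 / mfact q) * wnorm2 \<alpha> (Dp q (f2 m h)) \<le>
        (\<Sum>p\<in>?Q. ennreal (1 / mfact p) * wnorm2 \<alpha> (Dp p (f2 m h)))"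
      using finQ q by (intro member_le_sum) auto
    ultimately have "ennreal (1 / mfact q) * wnorm2 \<alpha> (Dp q (f2 m h)) < top"
      by (rule le_less_trans[rotated])
    then show "wnorm2 \<alpha> (Dp q (f2 m h)) < top"
      using mfact_pos[of q] by (auto simp: ennreal_mult_less_top)
  qed
  have 1: "((\<lambda>p. of_real (if mabs p < m then bnorm \<alpha> p else 0) * (a p * cnj (b p))) has_sum wip \<alpha> (f1 m f) (f1 m g)) UNIV"
    using wip_has_sum[OF \<alpha> pseries_f1[OF a] pseries_f1[OF b] fin'(1)[OF fin(1)] fin'(1)[OF fin(2)]]
    by (rule has_sum_cong[THEN iffD1, rotated]) auto
  have 2: "((\<lambda>r. of_real (shift_norm \<alpha> q r) * (a r * cnj (b r))) has_sum wip \<alpha> (Dp q (f2 m f)) (Dp q (f2 m g))) UNIV"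
    if q: "mabs q = m" for q
  proof -
    let ?F = "\<lambda>r. of_real (shift_norm \<alpha> q r) * (a r * cnj (b r))"
    have "((\<lambda>p. ?F (\<lambda>j. p j + q j)) has_sum wip \<alpha> (Dp q (f2 m f)) (Dp q (f2 m g))) UNIV"
      using wip_has_sum[OF \<alpha> pseries_Dp_f2[OF a q] pseries_Dp_f2[OF b q] fin'(2)[OF fin(1) q] fin'(2)[OF fin(2) q]]
      by (rule has_sum_cong[THEN iffD1, rotated])
         (simp add: shift_norm_add power2_eq_square)
    \<comment> \<open>The sum over \<open>p\<close> becomes one over \<open>r = p + q\<close>; the
      remaining \<open>r\<close> have \<open>shift_norm\<close> equal to 0 and can be added.\<close>
    then have "(?F has_sum wip \<alpha> (Dp q (f2 m f)) (Dp q (f2 m g))) {r. \<forall>j. q j \<le> r j}"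
      by (simp only: has_sum_reindex_bij_betw[OF bij_betw_add_midx, of ?F])
    then show ?thesis
      by (rule has_sum_cong_neutral[THEN iffD1, rotated -1]) (auto simp: shift_norm_def)
  qed
  have "((\<lambda>r. of_real (if mabs r < m then bnorm \<alpha> r else 0) * (a r * cnj (b r)) +
      of_real (fact m) * (\<Sum>q\<in>?Q. of_real (1 / mfact q) * (of_real (shift_norm \<alpha> q r) * (a r * cnj (b r)))))
      has_sum Aip \<alpha> m f g) UNIV"
    unfolding Aip_def by (intro has_sum_add 1 has_sum_cmult_right has_sum_finite_sum 2) auto
  moreover have "of_real (if mabs r < m then bnorm \<alpha> r else 0) * (a r * cnj (b r)) +
      of_real (fact m) * (\<Sum>q\<in>?Q. of_real (1 / mfact q) * (of_real (shift_norm \<alpha> q r) * (a r * cnj (b r)))) =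
      of_real (anorm \<alpha> m r) * (a r * cnj (b r))" for r
    unfolding anorm_eq[OF \<alpha>, symmetric]
    by (simp only: of_real_add of_real_mult of_real_sum distrib_right sum_distrib_right mult.assoc)
  ultimately show ?thesis by simp
qed

section \<open>The kernel as a power series\<close>

text \<open>The multinomial theorem groups the multi-indices of degree \<open>k\<close> into one
  power. Regrouping needs absolute convergence, hence the hypothesis on the sum of the moduli
  \<open>cmod (x j)\<close> and not on the modulus of the sum.\<close>

lemma has_sum_homogeneous:
  fixes x :: "'n::finite \<Rightarrow> complex" and c :: "nat \<Rightarrow> real"
  assumes c: "\<And>k. c k \<ge> 0"
    and summ: "summable (\<lambda>k. c k * ((\<Sum>j\<in>UNIV. cmod (x j)) ^ k / fact k))"
  shows "((\<lambda>p. of_real (c (mabs p) / mfact p) * (\<Prod>j\<in>UNIV. x j ^ p j)) has_sum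
           (\<Sum>k. of_real (c k) * ((\<Sum>j\<in>UNIV. x j) ^ k / fact k))) UNIV"
    and "summable (\<lambda>k. complex_of_real (c k) * ((\<Sum>j\<in>UNIV. x j) ^ k / fact k))"
proof -
  define F where "F = (\<lambda>(k, p). of_real (c k) * (\<Prod>j\<in>UNIV. x j ^ p j / fact (p j)))"
  define g where "g k = complex_of_real (c k) * ((\<Sum>j\<in>UNIV. x j) ^ k / fact k)" for k
  have t0: "(\<Sum>j\<in>UNIV. cmod (x j)) \<ge> 0" by (intro sum_nonneg) auto
  have Fg: "((\<lambda>p. F (k, p)) has_sum g k) (midx UNIV k)" for k
  proof -
    have "g k = (\<Sum>p\<in>midx UNIV k. F (k, p))"
      unfolding g_def F_def by (simp add: multinomial_power[symmetric] sum_distrib_left)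
    then show ?thesis by (simp add: has_sum_finite finite_midx)
  qed
  have Fn: "((\<lambda>p. cmod (F (k, p))) has_sum c k * ((\<Sum>j\<in>UNIV. cmod (x j)) ^ k / fact k)) (midx UNIV k)" for k
  proof -
    have "cmod (F (k, p)) = c k * (\<Prod>j\<in>UNIV. cmod (x j) ^ p j / fact (p j))" for p
      using c[of k] by (simp add: F_def norm_mult norm_power norm_divide flip: prod_norm)
    then have "c k * ((\<Sum>j\<in>UNIV. cmod (x j)) ^ k / fact k) = (\<Sum>p\<in>midx UNIV k. cmod (F (k, p)))"
      by (simp add: multinomial_power[symmetric] sum_distrib_left)
    then show ?thesis by (simp add: has_sum_finite finite_midx)
  qed
  have "(\<lambda>k. c k * ((\<Sum>j\<in>UNIV. cmod (x j)) ^ k / fact k)) summable_on UNIV"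
    using summ c t0 by (intro norm_summable_imp_summable_on) (simp add: abs_mult)
  then have "(\<lambda>kp. cmod (F kp)) summable_on Sigma UNIV (midx UNIV)"
    by (rule summable_on_SigmaI[OF Fn]) auto
  then have F_summ: "F summable_on Sigma UNIV (midx UNIV)"
    by (rule abs_summable_summable)
  have "cmod (g k) \<le> c k * ((\<Sum>j\<in>UNIV. cmod (x j)) ^ k / fact k)" for k
    unfolding g_def using c[of k]
    by (auto simp: norm_mult norm_divide norm_power intro!: mult_left_mono divide_right_mono power_mono norm_sum)
  then have gs: "summable (\<lambda>k. cmod (g k))"
    by (intro summable_comparison_test'[OF summ, of 0]) simp
  from gs show "summable (\<lambda>k. complex_of_real (c k) * ((\<Sum>j\<in>UNIV. x j) ^ k / fact k))"
    unfolding g_def[symmetric] by (rule summable_norm_cancel)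
  have "(g has_sum (\<Sum>k. g k)) UNIV"
    by (rule norm_summable_imp_has_sum[OF gs summable_sums[OF summable_norm_cancel[OF gs]]])
  with F_summ Fg have "(F has_sum (\<Sum>k. g k)) (Sigma UNIV (midx UNIV))"
    by (intro has_sum_SigmaI) auto
  moreover have b: "bij_betw (\<lambda>p. (mabs p, p)) UNIV (Sigma UNIV (midx (UNIV :: 'n set)))"
    by (rule bij_betwI[where g = snd]) (auto simp: midx_UNIV)
  ultimately have "((\<lambda>p. F (mabs p, p)) has_sum (\<Sum>k. g k)) UNIV"
    using has_sum_reindex_bij_betw[OF b, of F "\<Sum>k. g k"] by simp
  moreover have "F (mabs p, p) = of_real (c (mabs p) / mfact p) * (\<Prod>j\<in>UNIV. x j ^ p j)" for p
    by (simp add: F_def mfact_def prod_dividef)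
  ultimately show "((\<lambda>p. of_real (c (mabs p) / mfact p) * (\<Prod>j\<in>UNIV. x j ^ p j)) has_sum
           (\<Sum>k. of_real (c k) * ((\<Sum>j\<in>UNIV. x j) ^ k / fact k))) UNIV"
    by (simp add: g_def)
qed

section \<open>Coefficients of the kernel\<close>

text \<open>The binomial series of \<open>(1 - t) powr (- a)\<close>.\<close>

lemma summable_pochhammer:
  fixes a t :: real
  assumes "\<bar>t\<bar> < 1"
  shows "summable (\<lambda>k. pochhammer a k / fact k * t ^ k)"
proof -
  have "summable (\<lambda>k. (- a gchoose k) * (- t) ^ k)"
    using gen_binomial_real[of "- t" "- a"] assms by (auto simp: sums_iff)
  also have "(\<lambda>k. (- a gchoose k) * (- t) ^ k) = (\<lambda>k. pochhammer a k / fact k * t ^ k)"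
  proof
    fix k
    have "((-1) ^ k * (- t) ^ k :: real) = t ^ k"
      by (simp add: power_mult_distrib[symmetric])
    then show "(- a gchoose k) * (- t) ^ k = pochhammer a k / fact k * t ^ k"
      by (simp add: gbinomial_pochhammer mult.commute mult.left_commute)
  qed
  finally show ?thesis .
qed

text \<open>The coefficient of \<open>s ^ k / fact k\<close> in the kernel. For
  \<open>k \<ge> m\<close> it is the hypergeometric term of index j = k - m, simplified by (1)_j =
  j! and (m+1)_j = k!/m!; the latter, squared, cancels the prefactor 1/(m!)^2.\<close>

definition kcoeff :: "real \<Rightarrow> nat \<Rightarrow> nat \<Rightarrow> nat \<Rightarrow> real" where
  "kcoeff \<alpha> n m k = Gamma (\<alpha> + real n + 1) / (pi ^ n * Gamma (\<alpha> + 1)) *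
     (if k < m then pochhammer (\<alpha> + real n + 1) k
      else pochhammer (\<alpha> + real n + 1) (k - m) * fact (k - m) / fact k)"

lemma kcoeff_nonneg: "\<alpha> > -1 \<Longrightarrow> kcoeff \<alpha> n m k \<ge> 0"
  unfolding kcoeff_def by (auto intro!: mult_nonneg_nonneg divide_nonneg_nonneg Gamma_real_nonneg pochhammer_nonneg)

text \<open>Here the norms and the hypergeometric coefficients meet:
  \<open>Gamma A * pochhammer A k = Gamma (A + k)\<close> with
  \<open>A = \<alpha> + n + 1\<close>.\<close>

lemma kcoeff_anorm:
  fixes p :: "'n::finite \<Rightarrow> nat"
  assumes \<alpha>: "\<alpha> > -1"
  shows "kcoeff \<alpha> CARD('n) m (mabs p) / mfact p = 1 / anorm \<alpha> m p"
proof -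
  define A where "A = \<alpha> + real CARD('n) + 1"
  have A: "A > 0" using \<alpha> by (simp add: A_def)
  have G: "Gamma A > 0" "Gamma (\<alpha> + 1) > 0" using A \<alpha> by (auto intro!: Gamma_real_pos)
  have "A \<notin> \<int>\<^sub>\<le>\<^sub>0" using A by (auto elim!: nonpos_Ints_cases)
  then have P: "pochhammer A k = Gamma (A + real k) / Gamma A" for k
    by (rule pochhammer_Gamma)
  have Gk: "Gamma (A + real k) > 0" for k using A by (auto intro!: Gamma_real_pos)
  show ?thesis
    using G mfact_pos[of p] Gk
    by (simp add: kcoeff_def anorm_def bnorm_def A_def[symmetric] P mult_ac)
qed

text \<open>Finitely many terms do not matter; after the shift by \<open>m\<close> the extra
  factorials only help, and the binomial series dominates.\<close>

lemma kcoeff_summable: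
  assumes \<alpha>: "\<alpha> > -1" and t: "0 \<le> t" "t < 1"
  shows "summable (\<lambda>k. kcoeff \<alpha> n m k * (t ^ k / fact k))"
proof (subst summable_iff_shift[of _ m, symmetric], rule summable_comparison_test')
  define A where "A = \<alpha> + real n + 1"
  define C where "C = Gamma A / (pi ^ n * Gamma (\<alpha> + 1))"
  have A: "A > 0" using \<alpha> by (simp add: A_def)
  have C: "C \<ge> 0" unfolding C_def using A \<alpha> by (intro divide_nonneg_nonneg mult_nonneg_nonneg Gamma_real_nonneg) auto
  show "summable (\<lambda>k. C * (pochhammer A k / fact k * t ^ k))"
    using t by (intro summable_mult summable_pochhammer) auto
  fix k :: nat
  have f: "fact k / (fact (k + m) * fact (k + m)) \<le> (1 / fact k :: real)"
  proof -
    have "fact k \<le> (fact (k + m) :: real)" by (intro fact_mono) simp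
    then have "fact k * fact k \<le> (fact (k + m) * fact (k + m) :: real)" by (intro mult_mono) auto
    then show ?thesis by (simp add: field_simps)
  qed
  have "kcoeff \<alpha> n m (k + m) * (t ^ (k + m) / fact (k + m)) =
      C * (pochhammer A k * (fact k / (fact (k + m) * fact (k + m))) * t ^ (k + m))"
    by (simp add: kcoeff_def A_def C_def)
  also have "\<dots> \<le> C * (pochhammer A k * (1 / fact k) * t ^ k)"
    using C A t f by (intro mult_left_mono mult_mono mult_nonneg_nonneg pochhammer_nonneg)
      (auto simp: power_decreasing)
  finally show "norm (kcoeff \<alpha> n m (k + m) * (t ^ (k + m) / fact (k + m))) \<le> C * (pochhammer A k / fact k * t ^ k)"
    using kcoeff_nonneg[OF \<alpha>, of n m "k + m"] t by simp
qed

lemma bergman_kernel_eq: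
  fixes z w :: "complex^'n::finite"
  assumes summ: "summable (\<lambda>k. complex_of_real (kcoeff \<alpha> CARD('n) m k) * (cinner z w ^ k / fact k))"
  shows "bergman_kernel \<alpha> m z w = (\<Sum>k. of_real (kcoeff \<alpha> CARD('n) m k) * (cinner z w ^ k / fact k))"
proof -
  define A where "A = \<alpha> + real CARD('n) + 1"
  define C where "C = complex_of_real (Gamma A / (pi ^ CARD('n) * Gamma (\<alpha> + 1)))"
  define s where "s = cinner z w"
  let ?g = "\<lambda>k. complex_of_real (kcoeff \<alpha> CARD('n) m k) * (s ^ k / fact k)"
  let ?h = "\<lambda>k. pochhammer 1 k * pochhammer 1 k * pochhammer (of_real A) k
       / (pochhammer (of_nat m + 1) k * pochhammer (of_nat m + 1) k) * s ^ k / (fact k :: complex)"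
  have poch: "fact (k + m) = fact m * pochhammer (of_nat m + 1 :: complex) k" for k
    using pochhammer_product'[of 1 m k] by (simp add: pochhammer_fact add.commute)
  have shift: "?g (k + m) = C * s ^ m / (fact m)\<^sup>2 * ?h k" for k
  proof -
    have "pochhammer (of_nat m + 1 :: complex) k \<noteq> 0"
      using poch[of k] by (metis fact_nonzero mult_zero_right)
    then show ?thesis
      by (simp add: kcoeff_def poch C_def A_def[symmetric] pochhammer_fact[symmetric] pochhammer_of_real[symmetric]
           power_add power2_eq_square mult_ac)
  qed
  have summg: "summable ?g" using summ by (simp add: s_def)
  \<comment> \<open>The factor \<open>C * s ^ m / (fact m)\<^sup>2\<close> can be 0, in which case
    summability of the bare series cannot be recovered by division and both sides are simply
    0.\<close>
  have cmult: "(\<Sum>k. c * h k) = c * (\<Sum>k. h k)" if "summable (\<lambda>k. c * h k)" for c and h :: "nat \<Rightarrow> complex"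
    using that by (cases "c = 0") (auto simp: suminf_mult)
  have "(\<Sum>k. ?g k) = (\<Sum>k. ?g (k + m)) + (\<Sum>k<m. ?g k)"
    by (rule suminf_split_initial_segment[OF summg])
  also have "(\<Sum>k. ?g (k + m)) = C * s ^ m / (fact m)\<^sup>2 * (\<Sum>k. ?h k)"
    using summable_iff_shift[of ?g m] summg unfolding shift by (intro cmult) blast
  also have "(\<Sum>k<m. ?g k) = C * (\<Sum>k<m. of_real (pochhammer A k) * s ^ k / fact k)"
    by (simp add: sum_distrib_left kcoeff_def C_def A_def[symmetric] mult.assoc)
  finally show ?thesis
    unfolding bergman_kernel_def Let_def hyp3F2_def A_def[symmetric] C_def[symmetric] s_def[symmetric]
    by (simp only: add.commute)
qed


text \<open>Cauchy-Schwarz on the moduli, which bounds more than \<open>cinner z w\<close> itself: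
  this is the absolute convergence that \<open>has_sum_homogeneous\<close> asks for.\<close>

lemma sum_norm_mult_less_1:
  fixes z w :: "complex^'n::finite"
  assumes "z \<in> ball 0 1" "w \<in> ball 0 1"
  shows "(\<Sum>j\<in>UNIV. cmod (z$j * cnj (w$j))) < 1"
proof -
  have "(\<Sum>j\<in>UNIV. cmod (z$j * cnj (w$j))) = (\<Sum>j\<in>UNIV. \<bar>cmod (z$j)\<bar> * \<bar>cmod (w$j)\<bar>)"
    by (simp add: norm_mult)
  also have "\<dots> \<le> norm z * norm w"
    unfolding norm_vec_def by (rule L2_set_mult_ineq)
  also have "\<dots> \<le> norm z * 1"
    using assms by (intro mult_left_mono) auto
  also have "\<dots> < 1" using assms by simp
  finally show ?thesis .
qed

lemma bergman_kernel_has_sum: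
  fixes z w :: "complex^'n::finite"
  assumes \<alpha>: "\<alpha> > -1" and z: "z \<in> ball 0 1" and w: "w \<in> ball 0 1"
  shows "((\<lambda>p. of_real (1 / anorm \<alpha> m p) * cnj (Defs.monom w p) * Defs.monom z p) has_sum bergman_kernel \<alpha> m z w) UNIV"
proof -
  have "summable (\<lambda>k. kcoeff \<alpha> CARD('n) m k * ((\<Sum>j\<in>UNIV. cmod (z$j * cnj (w$j))) ^ k / fact k))"
    using sum_norm_mult_less_1[OF z w] by (intro kcoeff_summable \<alpha>) (auto intro: sum_nonneg)
  note h = has_sum_homogeneous[OF kcoeff_nonneg[OF \<alpha>] this]
  have "(\<Sum>j\<in>UNIV. z$j * cnj (w$j)) = cinner z w" by (simp add: cinner_def)
  note h = h[unfolded this]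
  have "of_real (kcoeff \<alpha> CARD('n) m (mabs p) / mfact p) * (\<Prod>j\<in>UNIV. (z$j * cnj (w$j)) ^ p j) =
      of_real (1 / anorm \<alpha> m p) * cnj (Defs.monom w p) * Defs.monom z p" for p
    unfolding kcoeff_anorm[OF \<alpha>] by (simp add: Defs.monom_def power_mult_distrib prod.distrib mult.commute)
  then show ?thesis
    using h(1) unfolding bergman_kernel_eq[OF h(2)] by simp
qed

section \<open>Weighted spaces of power series\<close>

definition wsum :: "('i \<Rightarrow> real) \<Rightarrow> ('i \<Rightarrow> complex) \<Rightarrow> real" where
  "wsum N a = (\<Sum>\<^sub>\<infinity>p. N p * (cmod (a p))\<^sup>2)"

text \<open>Positive weights force convergence of every coordinate. The Cauchy estimate passes to
  the limit on finite index sets, and the bound, uniform in the set, then holds for the infinite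
  sum.\<close>

lemma weighted_l2_complete:
  fixes N :: "'i \<Rightarrow> real" and A :: "nat \<Rightarrow> 'i \<Rightarrow> complex"
  assumes N: "\<And>p. N p > 0"
    and summ: "\<And>k. (\<lambda>p. N p * (cmod (A k p))\<^sup>2) summable_on UNIV"
    and cauchy: "\<And>e. e > 0 \<Longrightarrow> \<exists>n. \<forall>i\<ge>n. \<forall>j\<ge>n. wsum N (\<lambda>p. A i p - A j p) < e"
  obtains a where "(\<lambda>p. N p * (cmod (a p))\<^sup>2) summable_on UNIV"
    and "(\<lambda>k. wsum N (\<lambda>p. A k p - a p)) \<longlonglongrightarrow> 0"
proof -
  have N0: "N p \<ge> 0" for p using N[of p] by simp
  have summd: "(\<lambda>p. N p * (cmod (A i p - A j p))\<^sup>2) summable_on UNIV" for i j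
    by (intro weighted_summable_diff N0 summ)
  have partial: "(\<Sum>p\<in>F. N p * (cmod (A i p - A j p))\<^sup>2) \<le> wsum N (\<lambda>p. A i p - A j p)" if "finite F" for F i j
    unfolding wsum_def using that by (intro finite_sum_le_infsum summd) (auto simp: N0)
  have "convergent (\<lambda>k. A k p)" for p
  proof (rule Cauchy_convergent, rule metric_CauchyI)
    fix e :: real assume e: "e > 0"
    \<comment> \<open>The tolerance is scaled by the weight, which is divided out again to control
      the single coordinate \<open>p\<close>.\<close>
    then obtain n where n: "\<And>i j. i \<ge> n \<Longrightarrow> j \<ge> n \<Longrightarrow> wsum N (\<lambda>p. A i p - A j p) < N p * e\<^sup>2"
      using cauchy[of "N p * e\<^sup>2"] N[of p] by auto
    have "dist (A i p) (A j p) < e" if "i \<ge> n" "j \<ge> n" for i j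
    proof -
      have "N p * (cmod (A i p - A j p))\<^sup>2 < N p * e\<^sup>2"
        using partial[of "{p}" i j] n[OF that] by simp
      then have "(cmod (A i p - A j p))\<^sup>2 < e\<^sup>2" using N[of p] by simp
      then show ?thesis using e by (simp add: dist_norm power_less_imp_less_base)
    qed
    then show "\<exists>M. \<forall>m\<ge>M. \<forall>n\<ge>M. dist (A m p) (A n p) < e" by blast
  qed
  then obtain a where a: "\<And>p. (\<lambda>k. A k p) \<longlonglongrightarrow> a p"
    unfolding convergent_def by metis
  have key: "\<exists>n. \<forall>i\<ge>n. (\<lambda>p. N p * (cmod (A i p - a p))\<^sup>2) summable_on UNIV \<and> wsum N (\<lambda>p. A i p - a p) \<le> e"
    if e: "e > 0" for e
  proof -
    obtain n where n: "\<And>i j. i \<ge> n \<Longrightarrow> j \<ge> n \<Longrightarrow> wsum N (\<lambda>p. A i p - A j p) < e"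
      using cauchy[OF e] by blast
    \<comment> \<open>On a finite set of indices \<open>j\<close> can go to infinity with
      \<open>i\<close> fixed.\<close>
    have fin: "(\<Sum>p\<in>F. N p * (cmod (A i p - a p))\<^sup>2) \<le> e" if "finite F" "i \<ge> n" for F i
    proof (rule tendsto_upperbound)
      show "(\<lambda>j. \<Sum>p\<in>F. N p * (cmod (A i p - A j p))\<^sup>2) \<longlonglongrightarrow> (\<Sum>p\<in>F. N p * (cmod (A i p - a p))\<^sup>2)"
        by (intro tendsto_intros a)
      show "\<forall>\<^sub>F j in sequentially. (\<Sum>p\<in>F. N p * (cmod (A i p - A j p))\<^sup>2) \<le> e"
        using partial[OF that(1), of i] n[OF that(2)]
        by (intro eventually_sequentiallyI[of n]) (meson less_imp_le order_trans)
    qed simp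
    have "(\<lambda>p. N p * (cmod (A i p - a p))\<^sup>2) summable_on UNIV \<and> wsum N (\<lambda>p. A i p - a p) \<le> e" if i: "i \<ge> n" for i
    proof
      show s: "(\<lambda>p. N p * (cmod (A i p - a p))\<^sup>2) summable_on UNIV"
        using fin[OF _ i] N0 by (intro nonneg_bdd_above_summable_on bdd_aboveI2[where M = e]) auto
      show "wsum N (\<lambda>p. A i p - a p) \<le> e"
        unfolding wsum_def using fin[OF _ i] by (intro infsum_le_finite_sums s) auto
    qed
    then show ?thesis by blast
  qed
  show ?thesis
  proof
    obtain i where "(\<lambda>p. N p * (cmod (A i p - a p))\<^sup>2) summable_on UNIV"
      using key[of 1] by auto
    \<comment> \<open>The limit is written as \<open>A i - (A i - a)\<close>, a difference of two
      square-summable families.\<close>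
    from weighted_summable_diff[OF N0 summ[of i] this]
    show "(\<lambda>p. N p * (cmod (a p))\<^sup>2) summable_on UNIV" by simp
    show "(\<lambda>k. wsum N (\<lambda>p. A k p - a p)) \<longlonglongrightarrow> 0"
    proof (rule LIMSEQ_I)
      fix r :: real assume r: "r > 0"
      obtain n where n: "\<And>i. i \<ge> n \<Longrightarrow> wsum N (\<lambda>p. A i p - a p) \<le> r / 2"
        using key[of "r / 2"] r by auto
      have "wsum N (\<lambda>p. A i p - a p) \<ge> 0" for i
        unfolding wsum_def by (intro infsum_nonneg) (simp add: N0)
      then show "\<exists>n. \<forall>i\<ge>n. norm (wsum N (\<lambda>p. A i p - a p) - 0) < r"
        using n r by (intro exI[of _ n]) (smt (verit) field_sum_of_halves real_norm_def)
    qed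
  qed
qed

text \<open>The space, the inner product and the kernel enter only through coefficients. Uniqueness
  of the expansion makes the coefficient formula for \<open>ip\<close> determine it, so the axioms
  reduce to properties of weighted square-summable families.\<close>

lemma weighted_rkhs:
  fixes N :: "('n::finite \<Rightarrow> nat) \<Rightarrow> real" and H :: "(complex^'n \<Rightarrow> complex) set"
  assumes N: "\<And>p. N p > 0"
    and H: "\<And>f. f \<in> H \<longleftrightarrow> (\<exists>a. pseries a f \<and> (\<lambda>p. N p * (cmod (a p))\<^sup>2) summable_on UNIV)"
    and ip: "\<And>a b f g. f \<in> H \<Longrightarrow> g \<in> H \<Longrightarrow> pseries a f \<Longrightarrow> pseries b g \<Longrightarrow>
        ((\<lambda>p. of_real (N p) * (a p * cnj (b p))) has_sum ip f g) UNIV"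
    and K: "\<And>z w. z \<in> ball 0 1 \<Longrightarrow> w \<in> ball 0 1 \<Longrightarrow>
        ((\<lambda>p. of_real (1 / N p) * cnj (Defs.monom w p) * Defs.monom z p) has_sum K z w) UNIV"
  shows "rkhs_with_kernel (ball 0 1) H ip K"
proof -
  have N0: "N p \<ge> 0" for p using N[of p] by simp
  have zeroH: "(\<lambda>_. 0) \<in> H"
    unfolding H by (intro exI[of _ "\<lambda>_. 0"]) (simp add: pseries_def)
  have addH: "(\<lambda>x. f x + g x) \<in> H" if "f \<in> H" "g \<in> H" for f g
    using that unfolding H by (blast intro: pseries_add weighted_summable_add N0)
  have cmultH: "(\<lambda>x. c * f x) \<in> H" if "f \<in> H" for f c
    using that unfolding H by (blast intro: pseries_cmult weighted_summable_cmult)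
  have diffH: "(\<lambda>x. f x - g x) \<in> H" if "f \<in> H" "g \<in> H" for f g
    using that unfolding H by (blast intro: pseries_diff weighted_summable_diff N0)
  have obt: "\<exists>a. pseries a f \<and> (\<lambda>p. N p * (cmod (a p))\<^sup>2) summable_on UNIV" if "f \<in> H" for f
    using that unfolding H .
  have ip_self: "ip f f = of_real (wsum N a)" if f: "f \<in> H" and a: "pseries a f" for f a
  proof -
    have "(\<lambda>p. N p * (cmod (a p))\<^sup>2) summable_on UNIV"
      using obt[OF f] pseries_unique[OF a] by metis
    then have "((\<lambda>p. N p * (cmod (a p))\<^sup>2) has_sum wsum N a) UNIV"
      unfolding wsum_def by (rule has_sum_infsum)
    then have "((\<lambda>p. complex_of_real (N p * (cmod (a p))\<^sup>2)) has_sum of_real (wsum N a)) UNIV"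
      by (simp only: has_sum_of_real_iff)
    then have "((\<lambda>p. of_real (N p) * (a p * cnj (a p))) has_sum of_real (wsum N a)) UNIV"
      by (simp only: of_real_mult complex_norm_square)
    then show ?thesis using ip[OF f f a a] has_sum_unique by blast
  qed
  have wsum_nonneg: "wsum N a \<ge> 0" for a
    unfolding wsum_def by (intro infsum_nonneg) (simp add: N0)
  have ip_add: "ip (\<lambda>x. f x + g x) h = ip f h + ip g h" if fgh: "f \<in> H" "g \<in> H" "h \<in> H" for f g h
  proof -
    obtain a b c where abc: "pseries a f" "pseries b g" "pseries c h"
      using obt[OF fgh(1)] obt[OF fgh(2)] obt[OF fgh(3)] by blast
    have "((\<lambda>p. of_real (N p) * (a p * cnj (c p)) + of_real (N p) * (b p * cnj (c p))) has_sum ip f h + ip g h) UNIV"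
      by (intro has_sum_add ip fgh abc)
    moreover have "((\<lambda>p. of_real (N p) * ((a p + b p) * cnj (c p))) has_sum ip (\<lambda>x. f x + g x) h) UNIV"
      by (intro ip addH fgh pseries_add abc)
    ultimately show ?thesis by (simp add: algebra_simps has_sum_unique)
  qed
  have ip_cmult: "ip (\<lambda>x. c * f x) g = c * ip f g" if fg: "f \<in> H" "g \<in> H" for f g c
  proof -
    obtain a b where ab: "pseries a f" "pseries b g"
      using obt[OF fg(1)] obt[OF fg(2)] by blast
    have "((\<lambda>p. c * (of_real (N p) * (a p * cnj (b p)))) has_sum c * ip f g) UNIV"
      by (intro has_sum_cmult_right ip fg ab)
    moreover have "((\<lambda>p. of_real (N p) * ((c * a p) * cnj (b p))) has_sum ip (\<lambda>x. c * f x) g) UNIV"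
      by (intro ip cmultH fg pseries_cmult ab)
    ultimately show ?thesis by (simp add: mult_ac has_sum_unique)
  qed
  have ip_cnj: "ip g f = cnj (ip f g)" if fg: "f \<in> H" "g \<in> H" for f g
  proof -
    obtain a b where ab: "pseries a f" "pseries b g"
      using obt[OF fg(1)] obt[OF fg(2)] by blast
    have "((\<lambda>p. cnj (of_real (N p) * (a p * cnj (b p)))) has_sum cnj (ip f g)) UNIV"
      using ip[OF fg ab] by (simp only: has_sum_cnj_iff)
    moreover have "((\<lambda>p. of_real (N p) * (b p * cnj (a p))) has_sum ip g f) UNIV"
      by (intro ip fg ab)
    ultimately show ?thesis by (simp add: mult_ac has_sum_unique)
  qed
  have ip_pos: "ip f f \<in> \<real> \<and> Re (ip f f) \<ge> 0" if "f \<in> H" for f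
    using obt[OF that] ip_self[OF that] wsum_nonneg by auto
  have ip_zero: "f x = 0" if f: "f \<in> H" and z: "ip f f = 0" and x: "x \<in> ball 0 1" for f x
  proof -
    obtain a where a: "pseries a f" "(\<lambda>p. N p * (cmod (a p))\<^sup>2) summable_on UNIV"
      using obt[OF f] by blast
    have "wsum N a = 0" using ip_self[OF f a(1)] z by simp
    then have "N p * (cmod (a p))\<^sup>2 = 0" for p
      using a(2) unfolding wsum_def by (intro nonneg_infsum_le_0D[of "\<lambda>p. N p * (cmod (a p))\<^sup>2" UNIV]) (auto simp: N0)
    then have "a p = 0" for p using N[of p] by (metis less_irrefl mult_eq_0_iff norm_eq_zero power_eq_0_iff)
    then have "((\<lambda>p::'n \<Rightarrow> nat. 0) has_sum f x) UNIV" using pseriesD[OF a(1) x] by simp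
    then show ?thesis by (simp add: has_sum_0 has_sum_unique)
  qed
  have Kw: "pseries (\<lambda>p. of_real (1 / N p) * cnj (Defs.monom w p)) (\<lambda>z. K z w)"
    and Kw_summ: "(\<lambda>p. (cmod (Defs.monom w p))\<^sup>2 / N p) summable_on UNIV"
    and KH: "(\<lambda>z. K z w) \<in> H" if w: "w \<in> ball 0 1" for w
  proof -
    show 1: "pseries (\<lambda>p. of_real (1 / N p) * cnj (Defs.monom w p)) (\<lambda>z. K z w)"
      unfolding pseries_def using K[OF _ w] by blast
    \<comment> \<open>On the diagonal \<open>z = w\<close> the kernel series has terms of modulus
      \<open>(cmod (monom w p))\<^sup>2 / N p\<close>, which are also the weighted squares of the
      coefficients of \<open>K z w\<close> in \<open>z\<close>. Convergence there is membership in
      \<open>H\<close>.\<close>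
    have "cmod (of_real (1 / N p) * cnj (Defs.monom w p)) * cmod (Defs.monom w p) = (cmod (Defs.monom w p))\<^sup>2 / N p" for p
      using N0[of p] by (simp add: norm_mult norm_divide power2_eq_square)
    then show 2: "(\<lambda>p. (cmod (Defs.monom w p))\<^sup>2 / N p) summable_on UNIV"
      using pseries_abs_summable[OF 1 w] by simp
    have "N p * (cmod (of_real (1 / N p) * cnj (Defs.monom w p)))\<^sup>2 = (cmod (Defs.monom w p))\<^sup>2 / N p" for p
      using N[of p] by (simp add: norm_mult norm_divide power2_eq_square)
    then show "(\<lambda>z. K z w) \<in> H"
      unfolding H using 1 2 by (intro exI[of _ "\<lambda>p. of_real (1 / N p) * cnj (Defs.monom w p)"]) simp
  qed
  have reproducing: "f w = ip f (\<lambda>z. K z w)" if f: "f \<in> H" and w: "w \<in> ball 0 1" for f w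
  proof -
    obtain a where a: "pseries a f" using obt[OF f] by blast
    have "((\<lambda>p. of_real (N p) * (a p * cnj (of_real (1 / N p) * cnj (Defs.monom w p)))) has_sum ip f (\<lambda>z. K z w)) UNIV"
      by (rule ip[OF f KH[OF w] a Kw[OF w]])
    \<comment> \<open>The weight cancels its reciprocal, leaving the power series of
      \<open>f\<close> at \<open>w\<close>.\<close>
    moreover have "of_real (N p) * (a p * cnj (of_real (1 / N p) * cnj (Defs.monom w p))) = a p * Defs.monom w p" for p
      using N[of p] by simp
    ultimately show ?thesis using pseriesD[OF a w] has_sum_unique by force
  qed
  have complete: "\<exists>f\<in>H. (\<lambda>k. Re (ip (\<lambda>x. F k x - f x) (\<lambda>x. F k x - f x))) \<longlonglongrightarrow> 0"
    if F: "\<And>k. F k \<in> H"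
      and cauchy: "\<And>e. e > 0 \<Longrightarrow> \<exists>n. \<forall>i\<ge>n. \<forall>j\<ge>n. Re (ip (\<lambda>x. F i x - F j x) (\<lambda>x. F i x - F j x)) < e" for F
  proof -
    obtain A where A: "\<And>k. pseries (A k) (F k)" "\<And>k. (\<lambda>p. N p * (cmod (A k p))\<^sup>2) summable_on UNIV"
      using obt[OF F] by metis
    have eq: "Re (ip (\<lambda>x. F i x - f x) (\<lambda>x. F i x - f x)) = wsum N (\<lambda>p. A i p - a p)"
      if "f \<in> H" "pseries a f" for i f a
      using ip_self[OF diffH[OF F that(1)] pseries_diff[OF A(1) that(2)]] by simp
    have "\<exists>n. \<forall>i\<ge>n. \<forall>j\<ge>n. wsum N (\<lambda>p. A i p - A j p) < e" if "e > 0" for e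
      using cauchy[OF that] by (simp add: eq[OF F A(1)])
    from weighted_l2_complete[OF N A(2) this] obtain a where
      a: "(\<lambda>p. N p * (cmod (a p))\<^sup>2) summable_on UNIV" "(\<lambda>k. wsum N (\<lambda>p. A k p - a p)) \<longlonglongrightarrow> 0"
      by blast
    \<comment> \<open>The limit function is built from the limit coefficients; its series must still
      be shown to converge on the ball.\<close>
    define f where "f z = (\<Sum>\<^sub>\<infinity>p. a p * Defs.monom z p)" for z
    have f: "pseries a f"
      unfolding pseries_def f_def
    proof (rule ballI, rule has_sum_infsum, rule abs_summable_summable)
      fix z :: "complex^'n" assume z: "z \<in> ball 0 1"
      \<comment> \<open>The inequality between product and sum of squares, with the weight split as
        \<open>sqrt (N p)\<close> and its reciprocal. The second majorant is the diagonal kernel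
        series at \<open>z\<close>.\<close>
      have le: "cmod (a p * Defs.monom z p) \<le> N p * (cmod (a p))\<^sup>2 + (cmod (Defs.monom z p))\<^sup>2 / N p" for p
      proof -
        define x where "x = sqrt (N p) * cmod (a p)"
        define y where "y = cmod (Defs.monom z p) / sqrt (N p)"
        have xy: "x * y = cmod (a p * Defs.monom z p)" "x\<^sup>2 = N p * (cmod (a p))\<^sup>2"
            "y\<^sup>2 = (cmod (Defs.monom z p))\<^sup>2 / N p"
          using N[of p] by (simp_all add: x_def y_def norm_mult power_mult_distrib power_divide)
        have "x \<ge> 0" "y \<ge> 0" using N0[of p] by (simp_all add: x_def y_def)
        then have "0 \<le> x * y" by simp
        then show ?thesis using sum_squares_bound[of x y] unfolding xy(1)[symmetric] xy(2,3)[symmetric] by linarith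
      qed
      show "(\<lambda>p. norm (a p * Defs.monom z p)) summable_on UNIV"
        by (rule summable_on_comparison_test[OF summable_on_add[OF a(1) Kw_summ[OF z]]]) (use le in auto)
    qed
    then have "f \<in> H" using a(1) unfolding H by blast
    moreover have "(\<lambda>k. Re (ip (\<lambda>x. F k x - f x) (\<lambda>x. F k x - f x))) \<longlonglongrightarrow> 0"
      using a(2) by (simp only: eq[OF \<open>f \<in> H\<close> f])
    ultimately show ?thesis by blast
  qed
  show ?thesis
    unfolding rkhs_with_kernel_def
    by (intro conjI ballI allI impI zeroH addH cmultH ip_add ip_cmult ip_cnj KH reproducing complete)
       (use ip_pos ip_zero in auto)
qed

theorem theorem1:
  fixes \<alpha> :: real and m :: nat
  assumes "\<alpha> > -1"
  shows "rkhs_with_kernel (ball (0::complex^'n::finite) 1) (Aspace \<alpha> m) (Aip \<alpha> m) (bergman_kernel \<alpha> m)"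
proof (rule weighted_rkhs[where N = "anorm \<alpha> m"])
  fix f g :: "complex^'n \<Rightarrow> complex" and a b
  assume "f \<in> Aspace \<alpha> m" "g \<in> Aspace \<alpha> m" "pseries a f" "pseries b g"
  then show "((\<lambda>p. of_real (anorm \<alpha> m p) * (a p * cnj (b p))) has_sum Aip \<alpha> m f g) UNIV"
    using assms by (intro Aip_has_sum) (auto simp: Aspace_def)
qed (rule assms anorm_pos Aspace_iff bergman_kernel_has_sum; assumption?)+

end
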